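(* Let $\varphi$ be an Orlicz function with complementary function $\psi$, and let $\omega:[0,1)\to[0,\infty)$ be a weight function with $\alpha:=\sup\{t\ge0:\omega(t)>0\}=1$. Then the Orlicz-Lorentz space $\Lambda^\circ_{\varphi,\omega}[0,1)$ (endowed with the Orlicz norm) is locally uniformly non-square if and only if $\psi\in\Delta_2(\infty)$.
   Context: Orlicz function: $\varphi:\mathbb{R}\to[0,\infty)$ is convex, even, $\varphi(0)=0$, $\varphi(u)>0$ for all $u>0$, $\lim_{u\to0}\varphi(u)/u=0$ and $\lim_{u\to\infty}\varphi(u)/u=\infty$. Its complementary function is $\psi(v)=\sup_{u>0}\{|uv|-\varphi(u)\}$, $v\in\mathbb{R}$ (again an Orlicz function). $\psi\in\Delta_2(\infty)$ means that there are constants $K>0$ and $u_0\ge0$ with $\psi(2u)\le K\psi(u)$ for all $u\ge u_0$. Rearrangements: let $\gamma=1$ and let $\mu$ be Lebesgue measure. For measurable $x:[0,\gamma)\to\mathbb{R}$, put $d_x(\theta)=\mu\{s\in[0,\gamma):|x(s)|>\theta\}$ and $x^\ast(t)=\inf\{\theta>0:d_x(\theta)\le t\}$, $t\ge0$. Weight function: $\omega:[0,\gamma)\to[0,\infty)$ that is non-increasing and locally integrable (so integrable near $0$). Put $\rho_{\varphi,\omega}(x)=\int_0^\gamma\varphi(x^\ast(t))\omega(t)\,dt$, and similarly $\rho_{\psi,\omega}$. The Orlicz-Lorentz space $\Lambda_{\varphi,\omega}[0,\gamma)$ is the set of (classes of a.e. equal) measurable functions $x$ on $[0,\gamma)$ with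 $\rho_{\varphi,\omega}(\lambda x)<\infty$ for some $\lambda>0$. The Orlicz norm is $$\|x\|^\circ_{\varphi,\omega}=\sup_{\rho_{\psi,\omega}(y)\le1}\int_0^\gamma x^\ast(t)y^\ast(t)\omega(t)\,dt=\inf_{k>0}\frac1k\bigl(1+\rho_{\varphi,\omega}(kx)\bigr),$$ the supremum being over measurable $y$ on $[0,\gamma)$ (the second equality is known). $\Lambda^\circ_{\varphi,\omega}[0,\gamma)$ denotes $\Lambda_{\varphi,\omega}[0,\gamma)$ with this norm; it is a Banach space. A Banach space $X$ with unit sphere $S(X)$ and closed unit ball $B(X)$ is locally uniformly non-square if for every $x\in S(X)$ there exists $\delta=\delta(x)\in(0,1)$ such that $\min\{\|\frac{x-y}{2}\|,\|\frac{x+y}{2}\|\}\le1-\delta$ for all $y\in B(X)$. *)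

theory Defs
  imports "HOL-Analysis.Analysis"
begin

definition orlicz_function :: "(real \<Rightarrow> real) \<Rightarrow> bool" where
  "orlicz_function \<phi> \<longleftrightarrow>
     convex_on UNIV \<phi> \<and> (\<forall>u. \<phi> (- u) = \<phi> u) \<and> (\<forall>u. 0 \<le> \<phi> u) \<and>
     \<phi> 0 = 0 \<and> (\<forall>u>0. 0 < \<phi> u) \<and>
     ((\<lambda>u. \<phi> u / u) \<longlongrightarrow> 0) (at 0) \<and> filterlim (\<lambda>u. \<phi> u / u) at_top at_top"

text \<open>For an Orlicz function the set below is bounded above, since \<open>\<phi> u / u\<close> tends to
  infinity, so the real supremum is the true one.\<close>

definition complementary :: "(real \<Rightarrow> real) \<Rightarrow> real \<Rightarrow> real" where
  "complementary \<phi> v = (SUP u\<in>{0<..}. \<bar>u * v\<bar> - \<phi> u)"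

definition Delta2_infinity :: "(real \<Rightarrow> real) \<Rightarrow> bool" where
  "Delta2_infinity \<psi> \<longleftrightarrow> (\<exists>K>0. \<exists>u0\<ge>0. \<forall>u\<ge>u0. \<psi> (2 * u) \<le> K * \<psi> u)"

text \<open>Functions on \<open>[0,1)\<close> are represented by total functions whose values outside
  \<open>[0,1)\<close> are never looked at.\<close>

abbreviation leb01 :: "real measure" where
  "leb01 \<equiv> lebesgue_on {0..<1}"

definition distr_fun :: "(real \<Rightarrow> real) \<Rightarrow> real \<Rightarrow> real" where
  "distr_fun x \<theta> = measure leb01 {s \<in> {0..<1}. \<bar>x s\<bar> > \<theta>}"

text \<open>For measurable \<open>x\<close> and \<open>t > 0\<close> the infimum is over a nonempty set. It can be over the empty
  set only at \<open>t = 0\<close> (when \<open>x\<close> is essentially unbounded); the value there is infinite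
  on paper and unspecified here, but rearrangements are only ever used under integrals.\<close>

definition rearrangement :: "(real \<Rightarrow> real) \<Rightarrow> real \<Rightarrow> real" where
  "rearrangement x t = Inf {\<theta>. 0 < \<theta> \<and> distr_fun x \<theta> \<le> t}"

text \<open>Monotonicity is required on \<open>(0,1)\<close> only, so that the value at the null point \<open>0\<close> plays no
  role: with a real value at \<open>0\<close>, monotonicity on \<open>[0,1)\<close> would force the weight to be bounded
  and make local integrability redundant, excluding weights such as \<open>1 / sqrt t\<close>.
  Every weight that is non-increasing on all of \<open>[0,1)\<close> is included.\<close>

definition weight_function :: "(real \<Rightarrow> real) \<Rightarrow> bool" where
  "weight_function \<omega> \<longleftrightarrow>
     (\<forall>t\<in>{0..<1}. 0 \<le> \<omega> t) \<and> antimono_on {0<..<1} \<omega> \<and>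
     (\<forall>a\<in>{0<..<1}. set_integrable lebesgue {0..a} \<omega>)"

text \<open>Extended reals, because the real supremum of the empty set (arising from \<open>\<omega> = 0\<close>) is
  unspecified.\<close>

definition weight_end :: "(real \<Rightarrow> real) \<Rightarrow> ereal" where
  "weight_end \<omega> = (SUP t\<in>{t\<in>{0..<1}. \<omega> t > 0}. ereal t)"

definition modular :: "(real \<Rightarrow> real) \<Rightarrow> (real \<Rightarrow> real) \<Rightarrow> (real \<Rightarrow> real) \<Rightarrow> ennreal" where
  "modular \<phi> \<omega> x = (\<integral>\<^sup>+ t. ennreal (\<phi> (rearrangement x t) * \<omega> t) \<partial>leb01)"

text \<open>The space is described by representatives: almost everywhere equal functions have the
  same rearrangement, hence the same modular and the same norm.\<close>

definition orlicz_lorentz_space :: "(real \<Rightarrow> real) \<Rightarrow> (real \<Rightarrow> real) \<Rightarrow> (real \<Rightarrow> real) set" where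
  "orlicz_lorentz_space \<phi> \<omega> =
     {x \<in> borel_measurable leb01. \<exists>c>0. modular \<phi> \<omega> (\<lambda>t. c * x t) < \<infinity>}"

text \<open>The supremum is finite on the Orlicz-Lorentz space by Young's inequality, so the
  conversion to a real number loses nothing there.\<close>

definition orlicz_norm :: "(real \<Rightarrow> real) \<Rightarrow> (real \<Rightarrow> real) \<Rightarrow> (real \<Rightarrow> real) \<Rightarrow> real" where
  "orlicz_norm \<phi> \<omega> x =
     enn2real (SUP y\<in>{y \<in> borel_measurable leb01. modular (complementary \<phi>) \<omega> y \<le> 1}.
       \<integral>\<^sup>+ t. ennreal (rearrangement x t * rearrangement y t * \<omega> t) \<partial>leb01)"

text \<open>\<open>X\<close> is a linear space of real functions and \<open>N\<close> its norm (a norm after identifying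
  functions at distance \<open>0\<close>, which changes none of the quantifications below).\<close>

definition locally_uniformly_non_square ::
    "('a \<Rightarrow> real) set \<Rightarrow> (('a \<Rightarrow> real) \<Rightarrow> real) \<Rightarrow> bool" where
  "locally_uniformly_non_square X N \<longleftrightarrow>
     (\<forall>x\<in>X. N x = 1 \<longrightarrow>
        (\<exists>\<delta>. 0 < \<delta> \<and> \<delta> < 1 \<and>
           (\<forall>y\<in>X. N y \<le> 1 \<longrightarrow>
              min (N (\<lambda>t. (x t - y t) / 2)) (N (\<lambda>t. (x t + y t) / 2)) \<le> 1 - \<delta>)))"

end

theory Submission
  imports Defs
begin

text \<open>Write \<open>\<parallel>z\<parallel>\<close> as the supremum of \<open>\<integral> z* h \<omega>\<close> over decreasing \<open>h\<close> of \<open>\<psi>\<close>-modular at most \<open>1\<close>. A measure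
  preserving \<open>\<tau>\<close> with \<open>\<bar>z\<bar> \<ge> z* \<circ> \<tau>\<close> turns such an integral into \<open>\<integral> \<bar>z\<bar> v dP\<close> with \<open>v = h \<circ> \<tau>\<close> and
  \<open>dP = (\<omega> \<circ> \<tau>) ds\<close>, and conversely every pairing of this kind is at most \<open>\<parallel>z\<parallel>\<close>. Since \<open>\<omega> > 0\<close> on \<open>(0,1)\<close>,
  sets of small \<open>P\<close>-measure have small Lebesgue measure, uniformly in \<open>\<tau>\<close>.

  Let \<open>\<psi>\<close> satisfy the doubling condition, \<open>\<parallel>x\<parallel> = 1\<close> and \<open>\<parallel>y\<parallel> \<le> 1\<close>. If \<open>(x + y) / 2\<close> has norm close to \<open>1\<close>, then
  \<open>v\<close> almost norms both \<open>x\<close> and \<open>y\<close>; it is then bounded below where \<open>\<bar>x\<bar> \<ge> c\<close>, which forces \<open>\<bar>y\<bar>\<close> to be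
  non-negligible there and \<open>xy > 0\<close> on most of that set. In the same way \<open>(x - y) / 2\<close> forces \<open>xy < 0\<close> on most of it.

  If the doubling condition fails, a constant function \<open>x\<close> and tall indicator functions \<open>y\<close> of short
  initial intervals are almost square: \<open>y\<close> is almost normed by densities of arbitrarily small modular,
  which can be combined with the density norming \<open>x\<close>.\<close>

text \<open>The arrangement that almost norms \<open>(x + y) / 2\<close> depends on \<open>y\<close>
  and differs from the one for \<open>(x - y) / 2\<close>, so the two densities live over unrelated
  measures \<open>P\<close>. Lebesgue measure is the only scale common to both. Each half of the
  argument must therefore end in a Lebesgue bound for a set described by \<open>x\<close> and
  \<open>y\<close> alone, and the conversion from \<open>P\<close> may not depend on \<tau>; the
  conversion is \<open>tail_mass\<close>, the weight carried by an interval at the right end. All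
  thresholds are fixed before \<open>y\<close> appears, in the order \<open>c\<close>,
  \<open>r\<close>, \<open>v0\<close>, \<eta>, \<open>e\<close>, \<delta>. Norming densities need
  not exist: every estimate tolerates a pairing that is only close to the norm. The map \<tau> is
  not built from \<open>z*\<close> directly, because \<open>z*\<close> does not tell apart points on
  a level set of \<open>z\<close>. It is the rank in a linear order of the points, and the work lies
  in showing that this rank has no atoms.\<close>

lemma space_leb01 [simp]: "space leb01 = {0..<1}"
  by (simp add: space_restrict_space)

lemma finite_measure_leb01: "finite_measure leb01"
  by (rule finite_measureI) (simp add: emeasure_restrict_space)

interpretation leb01: finite_measure leb01 by (rule finite_measure_leb01)

lemma borel_imp_leb01: "f \<in> borel_measurable borel \<Longrightarrow> f \<in> borel_measurable leb01"
  by (simp add: measurable_restrict_space1 measurable_completion)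

lemma emeasure_leb01_le:
  assumes "0 \<le> p" "p \<le> 1" shows "emeasure leb01 {0<..<p} = ennreal p"
proof -
  have "emeasure leb01 {0<..<p} = emeasure lebesgue {0<..<p}"
    using assms by (subst emeasure_restrict_space) auto
  then show ?thesis using assms by simp
qed

lemma AE_leb01_pos: "AE t in leb01. 0 < t \<and> t < 1"
proof -
  have "{0} \<in> null_sets leb01"
    by (auto simp: null_sets_def emeasure_restrict_space sets_restrict_space)
  then show ?thesis
    by (rule AE_I') auto
qed

section \<open>Rank functions of measurable linear orders\<close>

text \<open>Used twice: for Lebesgue measure with the points sorted by decreasing modulus of a
  function, and for the weighted measure \<open>mw\<close> with the order of the line.\<close>

locale measurable_strict_order = finite_measure P for P :: "'a measure" +
  fixes less :: "'a \<Rightarrow> 'a \<Rightarrow> bool" (infix "\<sqsubset>" 50)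
  assumes trans: "r \<sqsubset> s \<Longrightarrow> s \<sqsubset> t \<Longrightarrow> r \<sqsubset> t"
    and irrefl: "\<not> s \<sqsubset> s"
    and total: "r \<in> space P \<Longrightarrow> s \<in> space P \<Longrightarrow> r \<noteq> s \<Longrightarrow> r \<sqsubset> s \<or> s \<sqsubset> r"
    and rel_meas: "Measurable.pred (P \<Otimes>\<^sub>M P) (\<lambda>(r, s). r \<sqsubset> s)"
    and points_null: "s \<in> space P \<Longrightarrow> {s} \<in> null_sets P"
begin

definition below :: "'a \<Rightarrow> 'a set" where "below s = {r \<in> space P. r \<sqsubset> s}"
definition rank :: "'a \<Rightarrow> real" where "rank s = measure P (below s)"

lemma pair_sf: "pair_sigma_finite P P" ..

lemma rel_meas': "Measurable.pred (P \<Otimes>\<^sub>M P) (\<lambda>(s, r). r \<sqsubset> s)"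
  using measurable_compose[OF measurable_pair_swap' rel_meas] by (simp add: split_beta')

lemma below_sets [simp]: "s \<in> space P \<Longrightarrow> below s \<in> sets P"
  unfolding below_def using measurable_compose[OF measurable_Pair1' rel_meas'] by simp

lemma below_sets' [simp]: "s \<in> space P \<Longrightarrow> {r \<in> space P. r \<sqsubset> s} \<in> sets P"
  using below_sets by (simp add: below_def)

lemma above_sets [simp]: "s \<in> space P \<Longrightarrow> {r \<in> space P. s \<sqsubset> r} \<in> sets P"
  using measurable_compose[OF measurable_Pair1' rel_meas] by simp

lemma rank_measurable [measurable]: "rank \<in> borel_measurable P"
proof -
  have "{x \<in> space (P \<Otimes>\<^sub>M P). (\<lambda>(s, r). r \<sqsubset> s) x} \<in> sets (P \<Otimes>\<^sub>M P)"
    using rel_meas' by simp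
  from measurable_emeasure_Pair[OF this]
  have "(\<lambda>s. emeasure P (Pair s -` {x \<in> space (P \<Otimes>\<^sub>M P). (\<lambda>(s, r). r \<sqsubset> s) x})) \<in> borel_measurable P" .
  also have "?this \<longleftrightarrow> (\<lambda>s. emeasure P (below s)) \<in> borel_measurable P"
    by (intro measurable_cong arg_cong[where f="emeasure P"]) (auto simp: below_def space_pair_measure)
  finally show ?thesis
    unfolding rank_def measure_def by measurable
qed

lemma rank_sets [measurable]:
  "{s \<in> space P. rank s = a} \<in> sets P" "{s \<in> space P. rank s < a} \<in> sets P"
  "{s \<in> space P. rank s \<le> a} \<in> sets P" "{s \<in> space P. a < rank s} \<in> sets P"
  using rank_measurable by simp_all

lemma rank_mono: "r \<in> space P \<Longrightarrow> s \<in> space P \<Longrightarrow> r \<sqsubset> s \<Longrightarrow> rank r \<le> rank s"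
  unfolding rank_def by (intro finite_measure_mono) (auto simp: below_def dest: trans)

lemma rank_less_imp: "r \<in> space P \<Longrightarrow> s \<in> space P \<Longrightarrow> rank r < rank s \<Longrightarrow> r \<sqsubset> s"
  using rank_mono[of s r] total[of r s] by (cases "r = s") (auto simp: not_less)

text \<open>Diagonal sections are null by \<open>points_null\<close>, so up to a null set the square
  of \<open>L\<close> splits into the parts below and above the diagonal. Swapping the variables
  exchanges the two parts.\<close>

lemma square_formula:
  assumes L [measurable]: "L \<in> sets P"
  shows "emeasure P L * emeasure P L = 2 * (\<integral>\<^sup>+s\<in>L. emeasure P (L \<inter> below s) \<partial>P)"
proof -
  interpret pair_sigma_finite P P by (rule pair_sf)
  have Lsub: "L \<subseteq> space P" using sets.sets_into_space[OF L] by simp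
  define f :: "'a \<Rightarrow> 'a \<Rightarrow> ennreal" where
    "f = (\<lambda>s r. indicator L s * indicator L r * indicator {x \<in> space (P \<Otimes>\<^sub>M P). (\<lambda>(s, r). r \<sqsubset> s) x} (s, r))"
  have [measurable]: "{x \<in> space (P \<Otimes>\<^sub>M P). (\<lambda>(s, r). r \<sqsubset> s) x} \<in> sets (P \<Otimes>\<^sub>M P)"
    using rel_meas' by simp
  have f_meas [measurable]: "case_prod f \<in> borel_measurable (P \<Otimes>\<^sub>M P)"
    unfolding f_def by measurable
  have 1: "(\<integral>\<^sup>+r. f s r \<partial>P) = emeasure P (L \<inter> below s) * indicator L s" if "s \<in> space P" for s
  proof -
    have "(\<integral>\<^sup>+r. f s r \<partial>P) = (\<integral>\<^sup>+r. indicator L s * indicator (L \<inter> below s) r \<partial>P)"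
      using that by (intro nn_integral_cong)
        (auto simp: f_def indicator_def below_def space_pair_measure)
    also have "\<dots> = indicator L s * emeasure P (L \<inter> below s)"
      using that by (subst nn_integral_cmult_indicator) auto
    finally show ?thesis by (simp add: mult.commute)
  qed
  have 2: "(\<integral>\<^sup>+s. f s r \<partial>P) = emeasure P (L \<inter> {s\<in>space P. r \<sqsubset> s}) * indicator L r" if "r \<in> space P" for r
  proof -
    have "(\<integral>\<^sup>+s. f s r \<partial>P) = (\<integral>\<^sup>+s. indicator L r * indicator (L \<inter> {s\<in>space P. r \<sqsubset> s}) s \<partial>P)"
      using that by (intro nn_integral_cong)
        (auto simp: f_def indicator_def below_def space_pair_measure)
    also have "\<dots> = indicator L r * emeasure P (L \<inter> {s\<in>space P. r \<sqsubset> s})"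
      using that by (subst nn_integral_cmult_indicator) auto
    finally show ?thesis by (simp add: mult.commute)
  qed
  have swap: "(\<integral>\<^sup>+s. \<integral>\<^sup>+r. f s r \<partial>P \<partial>P) = (\<integral>\<^sup>+r. \<integral>\<^sup>+s. f s r \<partial>P \<partial>P)"
    by (rule Fubini'[symmetric]) measurable
  have split: "emeasure P L = emeasure P (L \<inter> below s) + emeasure P (L \<inter> {r\<in>space P. s \<sqsubset> r})"
    if s: "s \<in> space P" for s
  proof -
    have "emeasure P L = emeasure P (L - {s})"
      by (rule emeasure_Diff_null_set[OF points_null[OF s] L, symmetric])
    also have "L - {s} = (L \<inter> below s) \<union> (L \<inter> {r\<in>space P. s \<sqsubset> r})"
      using s Lsub total[of s] irrefl by (auto simp: below_def)
    also have "emeasure P \<dots> = emeasure P (L \<inter> below s) + emeasure P (L \<inter> {r\<in>space P. s \<sqsubset> r})"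
      using s by (intro plus_emeasure[symmetric]) (auto simp: below_def dest: trans intro: irrefl[THEN notE])
    finally show ?thesis .
  qed
  have "emeasure P L * emeasure P L = (\<integral>\<^sup>+s\<in>L. emeasure P L \<partial>P)"
    by (simp add: nn_integral_cmult_indicator)
  also have "\<dots> = (\<integral>\<^sup>+s. (\<integral>\<^sup>+r. f s r \<partial>P) + (\<integral>\<^sup>+r. f r s \<partial>P) \<partial>P)"
    by (intro nn_integral_cong) (simp add: 1 2 split[symmetric] distrib_right[symmetric])
  also have "\<dots> = (\<integral>\<^sup>+s. \<integral>\<^sup>+r. f s r \<partial>P \<partial>P) + (\<integral>\<^sup>+s. \<integral>\<^sup>+r. f r s \<partial>P \<partial>P)"
    by (intro nn_integral_add) measurable
  also have "\<dots> = 2 * (\<integral>\<^sup>+s. \<integral>\<^sup>+r. f s r \<partial>P \<partial>P)"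
    using swap by (simp add: mult_2)
  also have "(\<integral>\<^sup>+s. \<integral>\<^sup>+r. f s r \<partial>P \<partial>P) = (\<integral>\<^sup>+s\<in>L. emeasure P (L \<inter> below s) \<partial>P)"
    by (intro nn_integral_cong) (simp add: 1)
  finally show ?thesis .
qed

text \<open>By \<open>square_formula\<close> a constant section measure is half of the measure of the whole set, whereas a
  section carrying all or nothing of it leaves only measure zero.\<close>

lemma const_section_null:
  assumes L: "L \<in> sets P" and k: "\<And>s. s \<in> L \<Longrightarrow> measure P (L \<inter> below s) = measure P L \<or> measure P (L \<inter> below s) = 0"
    and same: "\<And>r s. r \<in> L \<Longrightarrow> s \<in> L \<Longrightarrow> measure P (L \<inter> below s) = measure P (L \<inter> below r)"
  shows "measure P L = 0"
proof (cases "L = {}")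
  case False
  then obtain s0 where s0: "s0 \<in> L" by auto
  define q where "q = measure P (L \<inter> below s0)"
  have q: "measure P (L \<inter> below s) = q" if "s \<in> L" for s
    unfolding q_def using s0 that by (rule same)
  have "(\<integral>\<^sup>+s\<in>L. emeasure P (L \<inter> below s) \<partial>P) = (\<integral>\<^sup>+s\<in>L. ennreal q \<partial>P)"
    by (intro nn_integral_cong) (auto simp: q emeasure_eq_measure split: split_indicator)
  also have "\<dots> = ennreal q * emeasure P L"
    using L by (simp add: nn_integral_cmult_indicator)
  finally have "ennreal (measure P L * measure P L) = ennreal (2 * (q * measure P L))"
    using square_formula[OF L] by (simp add: emeasure_eq_measure ennreal_mult q_def)
  then have "measure P L * measure P L = 2 * (q * measure P L)"
    by (simp add: q_def)
  moreover have "q = measure P L \<or> q = 0" using k[OF s0] by (simp add: q_def)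
  ultimately show ?thesis by auto
qed simp

text \<open>If \<open>r\<close> precedes \<open>s\<close> in a level set, \<open>below s\<close>
  minus \<open>below r\<close> is null, so all sections of the level set have equal measure. Inside
  one section every smaller section then carries the full measure, which forces it to be null; with
  all sections null, the level set is null as well.\<close>

lemma rank_level_null: "measure P {s \<in> space P. rank s = a} = 0"
proof -
  define L where "L = {s \<in> space P. rank s = a}"
  have L [measurable]: "L \<in> sets P" unfolding L_def by (rule rank_sets)
  have eq: "measure P (L \<inter> below r) = measure P (L \<inter> below s)"
    if "r \<in> L" "s \<in> L" "r \<sqsubset> s" for r s
  proof -
    have sp: "r \<in> space P" "s \<in> space P" using that by (auto simp: L_def)
    have "measure P (below s - below r) = measure P (below s) - measure P (below r)"
      using sp that by (intro finite_measure_Diff) (auto simp: below_def dest: trans)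
    also have "\<dots> = 0" using that by (simp add: L_def rank_def)
    finally have n: "measure P (below s - below r) = 0" .
    have "measure P (L \<inter> below s) \<le> measure P ((L \<inter> below r) \<union> (below s - below r))"
      using sp L by (intro finite_measure_mono sets.Un sets.Int sets.Diff below_sets) auto
    also have "\<dots> \<le> measure P (L \<inter> below r) + measure P (below s - below r)"
      using sp by (intro measure_Un_le) auto
    finally have "measure P (L \<inter> below s) \<le> measure P (L \<inter> below r)" using n by simp
    moreover have "measure P (L \<inter> below r) \<le> measure P (L \<inter> below s)"
      using sp that by (intro finite_measure_mono) (auto simp: below_def dest: trans)
    ultimately show ?thesis by simp
  qed
  have same: "measure P (L \<inter> below r) = measure P (L \<inter> below s)" if "r \<in> L" "s \<in> L" for r s
    using eq[of r s] eq[of s r] total[of r s] that by (cases "r = s") (auto simp: L_def)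
  have zero: "measure P (L \<inter> below s) = 0" if s: "s \<in> L" for s
  proof (rule const_section_null)
    have sp: "s \<in> space P" using that by (auto simp: L_def)
    show "L \<inter> below s \<in> sets P" using sp by auto
    have *: "L \<inter> below s \<inter> below r = L \<inter> below r" if "r \<in> L \<inter> below s" for r
      using that by (auto simp: below_def dest: trans)
    show "measure P (L \<inter> below s \<inter> below r) = measure P (L \<inter> below s) \<or>
          measure P (L \<inter> below s \<inter> below r) = 0" if "r \<in> L \<inter> below s" for r
      unfolding *[OF that] using that s by (intro disjI1 same) auto
    show "measure P (L \<inter> below s \<inter> below t) = measure P (L \<inter> below s \<inter> below r)"
      if "r \<in> L \<inter> below s" "t \<in> L \<inter> below s" for r t
      unfolding *[OF that(1)] *[OF that(2)] using that by (intro same) auto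
  qed
  have "measure P L = 0"
    by (rule const_section_null) (auto simp: zero L)
  then show ?thesis by (simp add: L_def)
qed

text \<open>The set need not have a greatest point, but its ranks approach their supremum
  \<open>a\<close> along a sequence. It is covered by the null level \<open>rank = a\<close> and by
  the strict sublevel sets at this sequence; a finite union of these lies in a single
  \<open>below (s m)\<close> and so has measure at most \<open>a\<close>.\<close>

lemma rank_less_le:
  assumes "0 \<le> t" shows "measure P {s \<in> space P. rank s < t} \<le> t"
proof (cases "{s \<in> space P. rank s < t} = {}")
  case True then show ?thesis using assms by (simp only: True) simp
next
  case False
  define a where "a = (SUP s \<in> {s \<in> space P. rank s < t}. rank s)"
  have bdd: "bdd_above (rank ` {s \<in> space P. rank s < t})"
    by (rule bdd_aboveI[of _ t]) auto
  have "a \<le> t" unfolding a_def using False by (intro cSUP_least) auto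
  have upper: "rank s \<le> a" if "s \<in> space P" "rank s < t" for s
    unfolding a_def using that bdd by (intro cSUP_upper) auto
  have "\<exists>s. s \<in> space P \<and> rank s < t \<and> a - 1 / Suc n < rank s" for n
  proof -
    have "a - 1 / Suc n < a" by simp
    then show ?thesis unfolding a_def
      using less_cSUP_iff[OF False bdd] by (auto simp: a_def)
  qed
  then obtain s where s: "\<And>n. s n \<in> space P" "\<And>n. rank (s n) < t" "\<And>n. a - 1 / Suc n < rank (s n)"
    by metis
  have sub: "{s \<in> space P. rank s < t} \<subseteq> (\<Union>n. {r \<in> space P. rank r < rank (s n)}) \<union> {r \<in> space P. rank r = a}"
  proof
    fix r assume r: "r \<in> {s \<in> space P. rank s < t}"
    show "r \<in> (\<Union>n. {r \<in> space P. rank r < rank (s n)}) \<union> {r \<in> space P. rank r = a}"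
    proof (cases "rank r = a")
      case False
      then have "0 < a - rank r" using upper r by force
      then obtain n where "1 / Suc n < a - rank r" using nat_approx_posE by blast
      then show ?thesis using s(3)[of n] r by (auto intro!: exI[of _ n])
    qed (use r in auto)
  qed
  have mono_s: "measure P (\<Union>i\<le>n. {r \<in> space P. rank r < rank (s i)}) \<le> a" for n
  proof -
    have "Max ((\<lambda>i. rank (s i)) ` {..n}) \<in> (\<lambda>i. rank (s i)) ` {..n}"
      by (rule Max_in) auto
    then obtain m where m: "Max ((\<lambda>i. rank (s i)) ` {..n}) = rank (s m)" by (rule imageE)
    have "rank (s i) \<le> rank (s m)" if "i \<le> n" for i
      unfolding m[symmetric] using that by (intro Max_ge) auto
    then have "(\<Union>i\<le>n. {r \<in> space P. rank r < rank (s i)}) \<subseteq> {r \<in> space P. rank r < rank (s m)}"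
      by fastforce
    also have "\<dots> \<subseteq> below (s m)" using rank_less_imp s by (auto simp: below_def)
    finally have "measure P (\<Union>i\<le>n. {r \<in> space P. rank r < rank (s i)}) \<le> rank (s m)"
      unfolding rank_def using s by (intro finite_measure_mono) auto
    also have "\<dots> \<le> a" using upper s by auto
    finally show ?thesis .
  qed
  have "(\<lambda>n. measure P (\<Union>i\<le>n. {r \<in> space P. rank r < rank (s i)})) \<longlonglongrightarrow>
      measure P (\<Union>n. \<Union>i\<le>n. {r \<in> space P. rank r < rank (s i)})"
  proof (rule finite_Lim_measure_incseq)
    show "range (\<lambda>n. \<Union>i\<le>n. {r \<in> space P. rank r < rank (s i)}) \<subseteq> sets P"
      by (intro image_subsetI sets.finite_UN) auto
    show "incseq (\<lambda>n. \<Union>i\<le>n. {r \<in> space P. rank r < rank (s i)})"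
      by (intro monoI UN_mono) auto
  qed
  then have "measure P (\<Union>n. \<Union>i\<le>n. {r \<in> space P. rank r < rank (s i)}) \<le> a"
    by (rule LIMSEQ_le_const2) (intro exI[of _ 0] allI impI mono_s)
  also have "(\<Union>n. \<Union>i\<le>n. {r \<in> space P. rank r < rank (s i)}) = (\<Union>n. {r \<in> space P. rank r < rank (s n)})"
    by blast
  finally have A: "measure P (\<Union>n. {r \<in> space P. rank r < rank (s n)}) \<le> a" .
  have "measure P {s \<in> space P. rank s < t} \<le>
      measure P ((\<Union>n. {r \<in> space P. rank r < rank (s n)}) \<union> {r \<in> space P. rank r = a})"
    by (rule finite_measure_mono[OF sub]) measurable
  also have "\<dots> \<le> measure P (\<Union>n. {r \<in> space P. rank r < rank (s n)}) + measure P {r \<in> space P. rank r = a}"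
    by (rule measure_Un_le) measurable
  finally show ?thesis using A rank_level_null \<open>a \<le> t\<close> by simp
qed

text \<open>Points being null, the rank in the reversed order is the total mass minus
  \<open>rank\<close>, so this is \<open>rank_less_le\<close> for the reversed order.\<close>

lemma rank_greater_le:
  assumes "t \<le> measure P (space P)"
  shows "measure P {s \<in> space P. rank s > t} \<le> measure P (space P) - t"
proof -
  interpret dual: measurable_strict_order P "\<lambda>r s. s \<sqsubset> r"
    by unfold_locales (use trans irrefl total points_null rel_meas' in \<open>blast+\<close>)
  have "dual.rank s = measure P (space P) - rank s" if s: "s \<in> space P" for s
  proof -
    have "measure P (space P) = measure P (below s \<union> dual.below s)"
    proof -
      have "emeasure P (space P) = emeasure P (space P - {s})"
        by (rule emeasure_Diff_null_set[OF points_null[OF s] sets.top, symmetric])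
      also have "space P - {s} = below s \<union> dual.below s"
        using total[of _ s] s irrefl by (auto simp: below_def dual.below_def)
      finally show ?thesis by (simp add: measure_def)
    qed
    also have "\<dots> = measure P (below s) + measure P (dual.below s)"
      using s by (intro finite_measure_Union)
        (auto simp: below_def dual.below_def dest: trans intro: irrefl[THEN notE])
    finally show ?thesis by (simp add: rank_def dual.rank_def)
  qed
  then have "{s \<in> space P. rank s > t} = {s \<in> space P. dual.rank s < measure P (space P) - t}"
    by auto
  then show ?thesis using dual.rank_less_le[of "measure P (space P) - t"] assms by simp
qed

lemma rank_le_le_rank_less:
  "measure P {s \<in> space P. rank s \<le> t} \<le> measure P {s \<in> space P. rank s < t}"
proof -
  have eq: "{s \<in> space P. rank s \<le> t} = {s \<in> space P. rank s < t} \<union> {s \<in> space P. rank s = t}"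
    by auto
  have "measure P {s \<in> space P. rank s \<le> t} \<le>
      measure P {s \<in> space P. rank s < t} + measure P {s \<in> space P. rank s = t}"
    unfolding eq by (rule measure_Un_le) measurable
  then show ?thesis using rank_level_null by simp
qed

text \<open>So \<open>rank\<close> is uniformly distributed between \<open>0\<close> and the total
  mass. For Lebesgue measure this makes it measure preserving; for \<open>mw\<close> it takes the
  place of continuity of the primitive \<open>M\<close>.\<close>

lemma rank_le_eq:
  assumes "0 \<le> t" "t \<le> measure P (space P)"
  shows "measure P {s \<in> space P. rank s \<le> t} = t"
proof (rule antisym)
  show "measure P {s \<in> space P. rank s \<le> t} \<le> t"
    using rank_less_le[OF assms(1)] rank_le_le_rank_less by (rule order_trans[rotated])
  have "measure P {s \<in> space P. rank s \<le> t} = measure P (space P) - measure P {s \<in> space P. rank s > t}"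
    by (subst finite_measure_compl[symmetric], measurable) (auto intro: arg_cong[where f="measure P"])
  then show "t \<le> measure P {s \<in> space P. rank s \<le> t}"
    using rank_greater_le[OF assms(2)] by simp
qed

lemma rank_less_eq:
  assumes "0 \<le> t" "t \<le> measure P (space P)"
  shows "measure P {s \<in> space P. rank s < t} = t"
proof (rule antisym)
  show "t \<le> measure P {s \<in> space P. rank s < t}"
    using rank_le_le_rank_less[of t] by (simp only: rank_le_eq[OF assms])
qed (rule rank_less_le[OF assms(1)])

end

section \<open>Layer cakes\<close>

text \<open>With \<open>d\<close> the Lebesgue tail of a modulus this is the decreasing
  rearrangement; with \<open>d\<close> the tail of a density under \<open>P\<close> it yields the
  rearrangement with respect to \<omega> dt.\<close>

definition gen_inv :: "(real \<Rightarrow> real) \<Rightarrow> real \<Rightarrow> real" where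
  "gen_inv d t = Inf {\<theta>. 0 < \<theta> \<and> d \<theta> \<le> t}"

text \<open>Right continuity carries \<open>t < d \<theta>\<close> to a slightly larger level, which
  keeps the infimum strictly above \<theta>. The limit of \<open>d\<close> and \<open>t > 0\<close>
  make the infimum range over a nonempty set.\<close>

lemma less_gen_inv_iff:
  assumes anti: "\<And>a b. a \<le> b \<Longrightarrow> d b \<le> d a"
    and rc: "\<And>a. (\<lambda>n. d (a + 1 / Suc n)) \<longlonglongrightarrow> d a"
    and lim: "(\<lambda>n. d (real n)) \<longlonglongrightarrow> 0"
    and t: "0 < t" and \<theta>: "0 \<le> \<theta>"
  shows "\<theta> < gen_inv d t \<longleftrightarrow> t < d \<theta>"
proof -
  define S where "S = {\<theta>. 0 < \<theta> \<and> d \<theta> \<le> t}"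
  have "\<forall>\<^sub>F n in sequentially. d (real n) < t"
    using order_tendstoD(2)[OF lim t] .
  then obtain n where n: "d (real n) < t" by (auto simp: eventually_sequentially)
  have "d (real (Suc n)) \<le> t" using anti[of "real n" "real (Suc n)"] n by simp
  then have ne: "S \<noteq> {}" unfolding S_def by (intro ex_in_conv[THEN iffD1] exI[of _ "real (Suc n)"]) simp
  have bdd: "bdd_below S" by (rule bdd_belowI[of _ 0]) (auto simp: S_def)
  have "Inf S \<le> \<theta>" if "d \<theta> \<le> t"
  proof (rule field_le_epsilon)
    fix e :: real assume "e > 0"
    then have "\<theta> + e \<in> S" using \<theta> that anti[of \<theta> "\<theta> + e"] by (auto simp: S_def)
    then show "Inf S \<le> \<theta> + e" by (rule cInf_lower[OF _ bdd])
  qed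
  moreover have "\<theta> < Inf S" if "t < d \<theta>"
  proof -
    from order_tendstoD(1)[OF rc that]
    obtain n where n: "t < d (\<theta> + 1 / Suc n)" by (auto simp: eventually_sequentially)
    have "\<theta> + 1 / Suc n \<le> s" if "s \<in> S" for s
      using that n anti[of s "\<theta> + 1 / Suc n"] by (force simp: S_def)
    then have "\<theta> + 1 / Suc n \<le> Inf S" by (rule cInf_greatest[OF ne])
    moreover have "0 < 1 / real (Suc n)" by simp
    ultimately show ?thesis by linarith
  qed
  ultimately show ?thesis unfolding gen_inv_def S_def[symmetric] by (meson not_less)
qed

context finite_measure begin

lemma tail_antimono:
  assumes [measurable]: "f \<in> borel_measurable M" and "a \<le> b"
  shows "measure M {s \<in> space M. f s > b} \<le> measure M {s \<in> space M. f s > (a::real)}"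
  using assms(2) by (intro finite_measure_mono) auto

lemma tail_right_cont:
  assumes [measurable]: "f \<in> borel_measurable M"
  shows "(\<lambda>n. measure M {s \<in> space M. f s > a + 1 / Suc n}) \<longlonglongrightarrow> measure M {s \<in> space M. f s > (a::real)}"
proof -
  have "(\<lambda>n. measure M {s \<in> space M. f s > a + 1 / Suc n}) \<longlonglongrightarrow> measure M (\<Union>n. {s \<in> space M. f s > a + 1 / Suc n})"
  proof (rule finite_Lim_measure_incseq)
    show "incseq (\<lambda>n. {s \<in> space M. f s > a + 1 / Suc n})"
    proof (rule incseq_SucI, safe)
      fix n s assume "a + 1 / Suc n < f s"
      moreover have "1 / real (Suc (Suc n)) \<le> 1 / real (Suc n)" by (simp add: field_simps)
      ultimately show "a + 1 / Suc (Suc n) < f s" by linarith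
    qed
  qed auto
  also have "(\<Union>n. {s \<in> space M. f s > a + 1 / Suc n}) = {s \<in> space M. f s > a}"
  proof (rule set_eqI, rule iffI)
    fix s assume "s \<in> (\<Union>n. {s \<in> space M. f s > a + 1 / Suc n})"
    then obtain n where "s \<in> space M" "f s > a + 1 / Suc n" by auto
    moreover have "0 < 1 / real (Suc n)" by simp
    ultimately show "s \<in> {s \<in> space M. f s > a}" by (smt (verit) mem_Collect_eq)
  next
    fix s assume s: "s \<in> {s \<in> space M. f s > a}"
    then have "0 < f s - a" by simp
    then obtain n where "1 / Suc n < f s - a" using nat_approx_posE by blast
    then show "s \<in> (\<Union>n. {s \<in> space M. f s > a + 1 / Suc n})"
      using s by (intro UN_I[of n]) (auto simp del: of_nat_Suc)
  qed
  finally show ?thesis .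
qed

lemma tail_tendsto_0:
  assumes [measurable]: "f \<in> borel_measurable M"
  shows "(\<lambda>n. measure M {s \<in> space M. f s > real n}) \<longlonglongrightarrow> 0"
proof -
  have "(\<lambda>n. measure M {s \<in> space M. f s > real n}) \<longlonglongrightarrow> measure M (\<Inter>n. {s \<in> space M. f s > real n})"
    by (rule finite_Lim_measure_decseq) (auto simp: decseq_def)
  also have "(\<Inter>n. {s \<in> space M. f s > real n}) = {}"
    using reals_Archimedean2 by (auto dest: less_asym)
  finally show ?thesis by simp
qed

lemma less_gen_inv_tail_iff:
  assumes [measurable]: "f \<in> borel_measurable M" and "0 < t" "0 \<le> (\<theta>::real)"
  shows "\<theta> < gen_inv (\<lambda>\<theta>. measure M {s \<in> space M. f s > \<theta>}) t \<longleftrightarrow>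
    t < measure M {s \<in> space M. f s > \<theta>}"
  using tail_antimono[OF assms(1)] tail_right_cont[OF assms(1)] tail_tendsto_0[OF assms(1)] assms(2,3)
  by (rule less_gen_inv_iff)

end

lemma double_layer_cake:
  fixes f g :: "'a \<Rightarrow> real"
  assumes "sigma_finite_measure M"
    and [measurable]: "f \<in> borel_measurable M" "g \<in> borel_measurable M"
  shows "(\<integral>\<^sup>+s. ennreal (f s) * ennreal (g s) \<partial>M) =
    (\<integral>\<^sup>+a\<in>{0<..}. (\<integral>\<^sup>+b\<in>{0<..}. emeasure M {s \<in> space M. f s > a \<and> g s > b} \<partial>lborel) \<partial>lborel)"
proof -
  interpret sigma_finite_measure M by fact
  interpret pair_sigma_finite M "lborel :: real measure" ..
  interpret pair_sigma_finite M "lborel \<Otimes>\<^sub>M lborel :: (real \<times> real) measure" ..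
  \<comment> \<open>A negative \<open>u\<close> gives \<open>0\<close> on the left and an empty
    interval on the right.\<close>
  have layer: "ennreal u = (\<integral>\<^sup>+a. indicator {a. 0 < a \<and> a < u} a \<partial>lborel)" for u :: real
  proof -
    have eq: "{a. 0 < a \<and> a < u} = {0<..<u}" by auto
    show ?thesis unfolding eq by (cases "0 \<le> u") (auto simp: ennreal_neg)
  qed
  define K :: "'a \<Rightarrow> real \<times> real \<Rightarrow> ennreal" where
    "K = (\<lambda>s p. indicator {0<..} (fst p) * indicator {0<..} (snd p) *
      indicator {s \<in> space M. f s > fst p \<and> g s > snd p} s)"
  have [measurable]: "case_prod K \<in> borel_measurable (M \<Otimes>\<^sub>M (lborel \<Otimes>\<^sub>M lborel))"
  proof -
    have "case_prod K = (\<lambda>x. indicator {0<..} (fst (snd x)) * indicator {0<..} (snd (snd x)) *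
      indicator {x \<in> space (M \<Otimes>\<^sub>M (lborel \<Otimes>\<^sub>M lborel)). f (fst x) > fst (snd x) \<and> g (fst x) > snd (snd x)} x)"
      by (auto simp: K_def fun_eq_iff indicator_def space_pair_measure)
    then show ?thesis by simp
  qed
  have "(\<integral>\<^sup>+s. ennreal (f s) * ennreal (g s) \<partial>M) = (\<integral>\<^sup>+s. (\<integral>\<^sup>+p. K s p \<partial>(lborel \<Otimes>\<^sub>M lborel)) \<partial>M)"
  proof (rule nn_integral_cong)
    fix s assume s: "s \<in> space M"
    have "(\<integral>\<^sup>+p. K s p \<partial>(lborel \<Otimes>\<^sub>M lborel)) =
        (\<integral>\<^sup>+p. indicator {a. 0 < a \<and> a < f s} (fst p) * indicator {b. 0 < b \<and> b < g s} (snd p) \<partial>(lborel \<Otimes>\<^sub>M lborel))"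
      using s by (intro nn_integral_cong) (auto simp: K_def indicator_def)
    also have "\<dots> = (\<integral>\<^sup>+a. \<integral>\<^sup>+b. indicator {a. 0 < a \<and> a < f s} a * indicator {b. 0 < b \<and> b < g s} b \<partial>lborel \<partial>lborel)"
      by (subst lborel.nn_integral_fst[symmetric]) auto
    also have "\<dots> = ennreal (f s) * ennreal (g s)"
      by (simp add: nn_integral_cmult nn_integral_multc layer[symmetric])
    finally show "ennreal (f s) * ennreal (g s) = (\<integral>\<^sup>+p. K s p \<partial>(lborel \<Otimes>\<^sub>M lborel))" ..
  qed
  also have "\<dots> = (\<integral>\<^sup>+p. (\<integral>\<^sup>+s. K s p \<partial>M) \<partial>(lborel \<Otimes>\<^sub>M lborel))"
    by (rule Fubini'[symmetric]) measurable
  also have "\<dots> = (\<integral>\<^sup>+p. indicator {0<..} (fst p) * (indicator {0<..} (snd p) *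
      emeasure M {s \<in> space M. f s > fst p \<and> g s > snd p}) \<partial>(lborel \<Otimes>\<^sub>M lborel))"
    by (intro nn_integral_cong) (simp add: K_def nn_integral_cmult mult.assoc)
  also have "\<dots> = (\<integral>\<^sup>+a. \<integral>\<^sup>+b. indicator {0<..} a * (indicator {0<..} b *
      emeasure M {s \<in> space M. f s > a \<and> g s > b}) \<partial>lborel \<partial>lborel)"
    by (subst lborel.nn_integral_fst[symmetric]) auto
  also have "\<dots> = (\<integral>\<^sup>+a\<in>{0<..}. (\<integral>\<^sup>+b\<in>{0<..}. emeasure M {s \<in> space M. f s > a \<and> g s > b} \<partial>lborel) \<partial>lborel)"
    by (intro nn_integral_cong) (auto simp: mult.commute nn_integral_cmult split: split_indicator)
  finally show ?thesis .
qed


text \<open>A joint tail is at most the smaller of the two single tails. Over \<open>N\<close> one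
  superlevel set contains the other up to a null set, so there the smaller tail is attained. This is
  the Hardy-Littlewood inequality with two different base measures.\<close>

lemma nn_integral_mult_mono_nested:
  fixes f g :: "'a \<Rightarrow> real" and F G :: "'b \<Rightarrow> real"
  assumes "sigma_finite_measure M" "sigma_finite_measure N"
    and [measurable]: "f \<in> borel_measurable M" "g \<in> borel_measurable M"
      "F \<in> borel_measurable N" "G \<in> borel_measurable N"
    and f: "\<And>a. 0 < a \<Longrightarrow> emeasure M {s \<in> space M. f s > a} \<le> emeasure N {t \<in> space N. F t > a}"
    and g: "\<And>a. 0 < a \<Longrightarrow> emeasure M {s \<in> space M. g s > a} \<le> emeasure N {t \<in> space N. G t > a}"
    and nested: "\<And>a b. 0 < a \<Longrightarrow> 0 < b \<Longrightarrow>
      (AE t in N. F t > a \<longrightarrow> G t > b) \<or> (AE t in N. G t > b \<longrightarrow> F t > a)"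
  shows "(\<integral>\<^sup>+s. ennreal (f s) * ennreal (g s) \<partial>M) \<le> (\<integral>\<^sup>+t. ennreal (F t) * ennreal (G t) \<partial>N)"
proof -
  have "emeasure M {s \<in> space M. f s > a \<and> g s > b} \<le> emeasure N {t \<in> space N. F t > a \<and> G t > b}"
    if "0 < a" "0 < b" for a b
    using nested[OF that]
  proof
    assume ae: "AE t in N. F t > a \<longrightarrow> G t > b"
    have "emeasure M {s \<in> space M. f s > a \<and> g s > b} \<le> emeasure M {s \<in> space M. f s > a}"
      by (intro emeasure_mono) auto
    also have "\<dots> \<le> emeasure N {t \<in> space N. F t > a}" by (rule f[OF that(1)])
    also have "\<dots> = emeasure N {t \<in> space N. F t > a \<and> G t > b}"
      using ae by (intro emeasure_eq_AE) auto
    finally show ?thesis .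
  next
    assume ae: "AE t in N. G t > b \<longrightarrow> F t > a"
    have "emeasure M {s \<in> space M. f s > a \<and> g s > b} \<le> emeasure M {s \<in> space M. g s > b}"
      by (intro emeasure_mono) auto
    also have "\<dots> \<le> emeasure N {t \<in> space N. G t > b}" by (rule g[OF that(2)])
    also have "\<dots> = emeasure N {t \<in> space N. F t > a \<and> G t > b}"
      using ae by (intro emeasure_eq_AE) auto
    finally show ?thesis .
  qed
  then show ?thesis
    unfolding double_layer_cake[OF assms(1) assms(3,4)] double_layer_cake[OF assms(2) assms(5,6)]
    by (intro nn_integral_mono) (auto intro!: nn_integral_mono split: split_indicator)
qed

text \<open>The constant second factors reduce the single layer cake comparison to the double one.\<close>

lemma nn_integral_mono_tails:
  fixes f :: "'a \<Rightarrow> real" and F :: "'b \<Rightarrow> real"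
  assumes "sigma_finite_measure M" "sigma_finite_measure N"
    and "f \<in> borel_measurable M" "F \<in> borel_measurable N"
    and "emeasure M (space M) \<le> emeasure N (space N)"
    and "\<And>a. 0 < a \<Longrightarrow> emeasure M {s \<in> space M. f s > a} \<le> emeasure N {t \<in> space N. F t > a}"
  shows "(\<integral>\<^sup>+s. ennreal (f s) \<partial>M) \<le> (\<integral>\<^sup>+t. ennreal (F t) \<partial>N)"
proof -
  have "(\<integral>\<^sup>+s. ennreal (f s) * ennreal 1 \<partial>M) \<le> (\<integral>\<^sup>+t. ennreal (F t) * ennreal 1 \<partial>N)"
  proof (rule nn_integral_mult_mono_nested[OF assms(1,2,3) _ assms(4)])
    show "emeasure M {s \<in> space M. 1 > a} \<le> emeasure N {s \<in> space N. 1 > a}" for a :: real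
      using assms(5) by (cases "1 > a") simp_all
    show "(AE t in N. F t > a \<longrightarrow> 1 > b) \<or> (AE t in N. 1 > b \<longrightarrow> F t > a)" for a b :: real
      by (cases "1 > b") simp_all
  qed (use assms(6) in auto)
  then show ?thesis by simp
qed

section \<open>Decreasing rearrangements\<close>

lemma gen_inv_nonneg:
  assumes "(\<lambda>n. d (real n)) \<longlonglongrightarrow> 0" and t: "0 < t"
  shows "0 \<le> gen_inv d t"
proof -
  have "\<forall>\<^sub>F n in sequentially. d (real n) < t \<and> 0 < n"
    using order_tendstoD(2)[OF assms] eventually_gt_at_top[of 0] by eventually_elim auto
  then obtain n where n: "d (real n) < t" "0 < n" by (auto simp: eventually_sequentially)
  then have "real n \<in> {\<theta>. 0 < \<theta> \<and> d \<theta> \<le> t}" by simp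
  then show ?thesis unfolding gen_inv_def by (intro cInf_greatest) (blast, simp add: less_imp_le)
qed

lemma abs_meas: "x \<in> borel_measurable leb01 \<Longrightarrow> (\<lambda>s. \<bar>x s\<bar> :: real) \<in> borel_measurable leb01"
  by simp

lemma distr_fun_eq: "distr_fun x \<theta> = measure leb01 {s \<in> space leb01. \<bar>x s\<bar> > \<theta>}"
  by (simp add: distr_fun_def)

lemma rearrangement_eq_gen_inv:
  "rearrangement x t = gen_inv (\<lambda>\<theta>. measure leb01 {s \<in> space leb01. \<bar>x s\<bar> > \<theta>}) t"
  by (simp add: rearrangement_def gen_inv_def distr_fun_eq)

lemma less_rearrangement_iff:
  assumes "x \<in> borel_measurable leb01" "0 < t" "0 \<le> \<theta>"
  shows "\<theta> < rearrangement x t \<longleftrightarrow> t < distr_fun x \<theta>"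
  unfolding rearrangement_eq_gen_inv distr_fun_eq
  by (rule leb01.less_gen_inv_tail_iff[OF abs_meas[OF assms(1)] assms(2,3)])

lemma rearrangement_nonneg:
  assumes "x \<in> borel_measurable leb01" "0 < t"
  shows "0 \<le> rearrangement x t"
  unfolding rearrangement_eq_gen_inv
  by (rule gen_inv_nonneg[OF leb01.tail_tendsto_0[OF abs_meas[OF assms(1)]] assms(2)])

lemma distr_fun_bounds: "0 \<le> distr_fun x \<theta>" "distr_fun x \<theta> \<le> 1"
  using leb01.bounded_measure[of "{s \<in> {0..<1}. \<bar>x s\<bar> > \<theta>}"]
  by (auto simp: distr_fun_def measure_restrict_space)

lemma rearrangement_antimono:
  assumes x: "x \<in> borel_measurable leb01" and "0 < s" "s \<le> t"
  shows "rearrangement x t \<le> rearrangement x s"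
proof (rule ccontr)
  assume "\<not> ?thesis"
  then have "rearrangement x s < rearrangement x t" by simp
  then have "t < distr_fun x (rearrangement x s)"
    using less_rearrangement_iff[OF x, of t] rearrangement_nonneg[OF x] assms by auto
  then have "rearrangement x s < rearrangement x s"
    using less_rearrangement_iff[OF x, of s "rearrangement x s"] rearrangement_nonneg[OF x, of s] assms
    by simp
  then show False by simp
qed

lemma rearrangement_eqI:
  assumes x: "x \<in> borel_measurable leb01" and t: "0 < t" and u: "0 \<le> u"
    and "\<And>\<theta>. 0 \<le> \<theta> \<Longrightarrow> \<theta> < u \<longleftrightarrow> t < distr_fun x \<theta>"
  shows "rearrangement x t = u"
proof (rule ccontr)
  assume "\<not> ?thesis"
  then consider "rearrangement x t < u" | "u < rearrangement x t" by linarith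
  then show False
    using less_rearrangement_iff[OF x t] rearrangement_nonneg[OF x t] u assms(4)
    by cases (metis less_irrefl)+
qed

lemma rearrangement_scale:
  assumes x: "x \<in> borel_measurable leb01" and t: "0 < t" and c: "0 < c"
  shows "rearrangement (\<lambda>s. c * x s) t = c * rearrangement x t"
proof (rule rearrangement_eqI)
  show "(\<lambda>s. c * x s) \<in> borel_measurable leb01" using x by simp
  show "0 < t" by fact
  show "0 \<le> c * rearrangement x t" using rearrangement_nonneg[OF x t] c by simp
  fix \<theta> :: real assume \<theta>: "0 \<le> \<theta>"
  have "distr_fun (\<lambda>s. c * x s) \<theta> = distr_fun x (\<theta> / c)"
    using c by (simp add: distr_fun_def abs_mult field_simps)
  then show "\<theta> < c * rearrangement x t \<longleftrightarrow> t < distr_fun (\<lambda>s. c * x s) \<theta>"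
    using less_rearrangement_iff[OF x t, of "\<theta> / c"] \<theta> c by (simp add: field_simps)
qed

lemma measure_leb01_initial:
  assumes "A \<inter> {0<..<1} = {0<..<1} \<inter> {..<p}" "A \<in> sets leb01"
  shows "measure leb01 A = max 0 (min 1 p)"
proof -
  have A: "A \<subseteq> {0..<1}" using sets.sets_into_space[OF assms(2)] by simp
  have "emeasure leb01 A = emeasure leb01 {0<..<max 0 (min 1 p)}"
  proof (rule emeasure_eq_AE)
    show "AE x in leb01. x \<in> A \<longleftrightarrow> x \<in> {0<..<max 0 (min 1 p)}"
      using AE_leb01_pos
    proof eventually_elim
      case (elim x)
      then have "x \<in> A \<longleftrightarrow> x \<in> A \<inter> {0<..<1}" by auto
      then show ?case unfolding assms(1) using elim by auto
    qed
    show "{0<..<max 0 (min 1 p)} \<in> sets leb01" by (auto simp: sets_restrict_space_iff)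
  qed fact
  then show ?thesis by (simp add: measure_def emeasure_leb01_le)
qed

text \<open>Monotonicity begins to the right of \<open>0\<close>, which allows a blow-up there with
  real values. Vanishing outside the interval makes such a function Borel on the whole line, as
  composition with \<tau> requires.\<close>

definition decreasing01 :: "(real \<Rightarrow> real) \<Rightarrow> bool" where
  "decreasing01 f \<longleftrightarrow> (\<forall>t. 0 \<le> f t) \<and> (\<forall>s t. 0 < s \<longrightarrow> s \<le> t \<longrightarrow> t < 1 \<longrightarrow> f t \<le> f s) \<and>
     (\<forall>t. t \<le> 0 \<or> 1 \<le> t \<longrightarrow> f t = 0)"

lemma decreasing01D:
  assumes "decreasing01 f"
  shows "0 \<le> f t" "0 < s \<Longrightarrow> s \<le> t \<Longrightarrow> t < 1 \<Longrightarrow> f t \<le> f s" "t \<le> 0 \<or> 1 \<le> t \<Longrightarrow> f t = 0"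
  using assms by (auto simp: decreasing01_def)

lemma decreasing01_borel:
  assumes "decreasing01 f" shows "f \<in> borel_measurable borel"
proof -
  have "mono_on {0<..<1} (\<lambda>t. - f t)"
    using decreasing01D(2)[OF assms] by (auto intro!: mono_onI)
  then have "(\<lambda>t. - f t) \<in> borel_measurable (restrict_space borel {0<..<1})"
    by (rule borel_measurable_mono_on_fnc)
  then have "(\<lambda>t. - (- f t)) \<in> borel_measurable (restrict_space borel {0<..<1})"
    by (rule borel_measurable_uminus)
  then have "(\<lambda>t. indicator {0<..<1} t *\<^sub>R f t) \<in> borel_measurable borel"
    by (subst (asm) borel_measurable_restrict_space_iff) simp_all
  also have "(\<lambda>t. indicator {0<..<1} t *\<^sub>R f t) = f"
    using decreasing01D(3)[OF assms] by (fastforce simp: indicator_def not_less)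
  finally show ?thesis .
qed

lemma decreasing01_leb01: "decreasing01 f \<Longrightarrow> f \<in> borel_measurable leb01"
  by (intro borel_imp_leb01 decreasing01_borel)

lemma decreasing01_nested:
  assumes "decreasing01 F" "decreasing01 G" and that: "0 < a" "0 < b"
  shows "(AE t in N. F t > a \<longrightarrow> G t > b) \<or> (AE t in N. G t > b \<longrightarrow> F t > a)"
proof -
  have "(\<forall>t. F t > a \<longrightarrow> G t > b) \<or> (\<forall>t. G t > b \<longrightarrow> F t > a)"
  proof (rule ccontr)
    assume "\<not> ?thesis"
    then obtain s t where st: "F s > a" "\<not> G s > b" "G t > b" "\<not> F t > a" by auto
    have "0 < s" "s < 1" "0 < t" "t < 1"
      using st that decreasing01D(3)[OF assms(1), of s] decreasing01D(3)[OF assms(2), of t] by force+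
    then show False
      using st decreasing01D(2)[OF assms(1), of t s] decreasing01D(2)[OF assms(2), of s t]
      by (cases "s \<le> t") auto
  qed
  then show ?thesis by auto
qed

text \<open>The cut-off discards the unspecified value at \<open>0\<close> and puts the
  rearrangement of a measurable function into the class \<open>decreasing01\<close>.\<close>

definition rearr :: "(real \<Rightarrow> real) \<Rightarrow> real \<Rightarrow> real" where
  "rearr x t = (if 0 < t \<and> t < 1 then rearrangement x t else 0)"

lemma decreasing01_rearr: "x \<in> borel_measurable leb01 \<Longrightarrow> decreasing01 (rearr x)"
  by (auto simp: decreasing01_def rearr_def rearrangement_nonneg intro: rearrangement_antimono)

lemma less_rearr_iff:
  assumes "x \<in> borel_measurable leb01" "0 \<le> \<theta>"
  shows "\<theta> < rearr x t \<longleftrightarrow> 0 < t \<and> t < distr_fun x \<theta> \<and> t < 1"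
  using less_rearrangement_iff[OF assms(1) _ assms(2)] assms(2) by (auto simp: rearr_def)

text \<open>Ties of \<open>\<bar>z\<bar>\<close> are broken by the order of the line; the rank function of the resulting linear
  order is the required \<open>\<tau>\<close>.\<close>

lemma exists_arrangement:
  assumes z [measurable]: "z \<in> borel_measurable leb01"
  obtains \<tau> where "\<tau> \<in> borel_measurable leb01"
    "distr leb01 borel \<tau> = distr leb01 borel (\<lambda>t. t)"
    "\<And>s. s \<in> {0..<1} \<Longrightarrow> rearr z (\<tau> s) \<le> \<bar>z s\<bar>"
proof -
  define lt where "lt r s \<longleftrightarrow> \<bar>z r\<bar> > \<bar>z s\<bar> \<or> \<bar>z r\<bar> = \<bar>z s\<bar> \<and> r < s" for r s
  have [measurable]: "(\<lambda>x. x) \<in> borel_measurable leb01" by (rule borel_imp_leb01) simp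
  have [measurable]: "fst \<in> borel_measurable (leb01 \<Otimes>\<^sub>M leb01)" "snd \<in> borel_measurable (leb01 \<Otimes>\<^sub>M leb01)"
    using measurable_compose[OF measurable_fst \<open>(\<lambda>x. x) \<in> borel_measurable leb01\<close>]
      measurable_compose[OF measurable_snd \<open>(\<lambda>x. x) \<in> borel_measurable leb01\<close>] by auto
  interpret ord: measurable_strict_order leb01 lt
  proof
    show "Measurable.pred (leb01 \<Otimes>\<^sub>M leb01) (\<lambda>(r, s). lt r s)"
      unfolding lt_def split_beta' by measurable
    show "{s} \<in> null_sets leb01" if "s \<in> space leb01" for s
      using that by (auto simp: null_sets_def emeasure_restrict_space sets_restrict_space_iff)
  qed (auto simp: lt_def)
  have one: "measure leb01 (space leb01) = 1" by (simp add: measure_restrict_space)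
  have id_le: "measure leb01 {s \<in> space leb01. s \<le> t} = t" if t: "0 \<le> t" "t \<le> 1" for t
  proof -
    have "measure leb01 {s \<in> space leb01. s \<le> t} = measure lebesgue {s \<in> space leb01. s \<le> t}"
      by (rule measure_restrict_space) auto
    also have eq: "{s \<in> space leb01. s \<le> t} = (if t = 1 then {0..<1} else {0..t})" using t by auto
    finally show ?thesis unfolding eq using t by (auto split: if_splits)
  qed
  have rank01: "0 \<le> ord.rank s" "ord.rank s \<le> 1" for s
    using one leb01.bounded_measure[of "ord.below s"] by (auto simp: ord.rank_def)
  have le_eq: "measure leb01 {s \<in> space leb01. ord.rank s \<le> t} = measure leb01 {s \<in> space leb01. s \<le> t}" for t
  proof -
    consider "t < 0" | "1 \<le> t" | "0 \<le> t" "t \<le> 1" by linarith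
    then show ?thesis
    proof cases
      case 1
      then have "\<not> ord.rank s \<le> t" for s using rank01(1)[of s] by linarith
      then have "{s \<in> space leb01. ord.rank s \<le> t} = {}" "{s \<in> space leb01. s \<le> t} = {}"
        using 1 by auto
      then show ?thesis by (simp only:)
    next
      case 2
      then have "ord.rank s \<le> t" for s using rank01(2)[of s] by linarith
      then have "{s \<in> space leb01. ord.rank s \<le> t} = space leb01" "{s \<in> space leb01. s \<le> t} = space leb01"
        using 2 by auto
      then show ?thesis by (simp only:)
    next
      case 3 then show ?thesis using ord.rank_le_eq[of t] id_le[of t] one by simp
    qed
  qed
  have gr: "measure leb01 {s \<in> space leb01. t < f s} = 1 - measure leb01 {s \<in> space leb01. f s \<le> t}"
    if [measurable]: "f \<in> borel_measurable leb01" for f :: "real \<Rightarrow> real" and t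
  proof -
    have eq: "{s \<in> space leb01. t < f s} = space leb01 - {s \<in> space leb01. f s \<le> t}" by auto
    have "{s \<in> space leb01. f s \<le> t} \<in> sets leb01" by measurable
    then show ?thesis
      unfolding eq by (subst leb01.finite_measure_compl) (simp_all only: one)
  qed
  have "distr leb01 borel ord.rank = distr leb01 borel (\<lambda>t. t)"
  proof (rule measure_eqI_lessThan)
    show "emeasure (distr leb01 borel ord.rank) {x<..} < \<infinity>" for x
      by (simp add: emeasure_distr less_top[symmetric])
    show "emeasure (distr leb01 borel ord.rank) {x<..} = emeasure (distr leb01 borel (\<lambda>t. t)) {x<..}" for x
    proof -
      have "emeasure (distr leb01 borel f) {x<..} = ennreal (1 - measure leb01 {s \<in> space leb01. f s \<le> x})"
        if [measurable]: "f \<in> borel_measurable leb01" for f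
      proof -
        have "emeasure (distr leb01 borel f) {x<..} = emeasure leb01 {s \<in> space leb01. x < f s}"
          by (subst emeasure_distr) (auto intro!: arg_cong[where f="emeasure leb01"])
        then show ?thesis using gr[OF that] by (simp add: leb01.emeasure_eq_measure)
      qed
      then show ?thesis using le_eq by simp
    qed
  qed simp_all
  \<comment> \<open>All points of larger modulus precede \<open>s\<close>, so the tail of
    \<open>z\<close> at the level \<open>\<bar>z s\<bar>\<close> is at most the rank of
    \<open>s\<close>.\<close>
  moreover have "rearr z (ord.rank s) \<le> \<bar>z s\<bar>" if s: "s \<in> {0..<1}" for s
  proof (rule ccontr)
    assume "\<not> ?thesis"
    then have "ord.rank s < distr_fun z \<bar>z s\<bar>"
      using less_rearr_iff[OF z, of "\<bar>z s\<bar>" "ord.rank s"] by simp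
    also have "\<dots> \<le> ord.rank s"
      unfolding distr_fun_eq ord.rank_def
      using s by (intro leb01.finite_measure_mono ord.below_sets) (simp_all add: ord.below_def lt_def subset_eq)
    finally show False by simp
  qed
  ultimately show thesis by (rule that[OF ord.rank_measurable])
qed

section \<open>Orlicz functions\<close>

context
  fixes \<phi> :: "real \<Rightarrow> real"
  assumes orlicz: "orlicz_function \<phi>"
begin

lemma orlicz_zero: "\<phi> 0 = 0" and orlicz_nonneg: "0 \<le> \<phi> u"
  and orlicz_pos: "0 < u \<Longrightarrow> 0 < \<phi> u" and orlicz_even: "\<phi> (- u) = \<phi> u"
  and orlicz_convex: "convex_on UNIV \<phi>"
  using orlicz by (auto simp: orlicz_function_def)

lemma orlicz_scale: "0 \<le> c \<Longrightarrow> c \<le> 1 \<Longrightarrow> \<phi> (c * u) \<le> c * \<phi> u"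
  using convex_onD[OF orlicz_convex, of c 0 u] by (simp add: orlicz_zero)

lemma orlicz_ratio: "0 < u \<Longrightarrow> u \<le> v \<Longrightarrow> \<phi> u * v \<le> \<phi> v * u"
  using orlicz_scale[of "u / v" v] by (simp add: field_simps)

lemma orlicz_strict_mono: "0 \<le> u \<Longrightarrow> u < v \<Longrightarrow> \<phi> u < \<phi> v"
proof -
  assume uv: "0 \<le> u" "u < v"
  have "\<phi> u \<le> (u / v) * \<phi> v" using orlicz_scale[of "u / v" v] uv by simp
  also have "\<dots> < 1 * \<phi> v" using uv orlicz_pos[of v] by (intro mult_strict_right_mono) auto
  finally show ?thesis by simp
qed

lemma orlicz_mono: "0 \<le> u \<Longrightarrow> u \<le> v \<Longrightarrow> \<phi> u \<le> \<phi> v"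
  using orlicz_strict_mono[of u v] by (cases "u = v") auto

lemma orlicz_continuous: "continuous_on A \<phi>"
  using convex_on_continuous[OF open_UNIV orlicz_convex] continuous_on_subset by blast

lemma orlicz_borel: "\<phi> \<in> borel_measurable borel"
  using orlicz_continuous by (rule borel_measurable_continuous_onI)

lemma orlicz_superlinear: "\<exists>V>0. \<forall>v\<ge>V. C * v \<le> \<phi> v"
proof -
  have "filterlim (\<lambda>u. \<phi> u / u) at_top at_top" using orlicz by (simp add: orlicz_function_def)
  then have "\<forall>\<^sub>F u in at_top. C \<le> \<phi> u / u \<and> 0 < u"
    using eventually_gt_at_top[of 0] by (intro eventually_conj) (auto simp: filterlim_at_top)
  then obtain V where V: "\<And>u. V \<le> u \<Longrightarrow> C \<le> \<phi> u / u \<and> 0 < u" by (auto simp: eventually_at_top_linorder)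
  have "C * v \<le> \<phi> v" if "V \<le> v" for v
    using V[OF that] pos_le_divide_eq[of v C "\<phi> v"] by blast
  then show ?thesis using V[of V] by blast
qed

lemma orlicz_sublinear:
  assumes "0 < e" shows "\<exists>d>0. \<forall>v. 0 \<le> v \<longrightarrow> v \<le> d \<longrightarrow> \<phi> v \<le> e * v"
proof -
  have "((\<lambda>u. \<phi> u / u) \<longlongrightarrow> 0) (at 0)" using orlicz by (simp add: orlicz_function_def)
  then have "\<forall>\<^sub>F u in at 0. \<phi> u / u < e" using assms by (rule order_tendstoD)
  then obtain d where d: "0 < d" "\<And>u. u \<noteq> 0 \<Longrightarrow> \<bar>u\<bar> < d \<Longrightarrow> \<phi> u / u < e"
    by (auto simp: eventually_at dist_real_def)
  have "\<phi> v \<le> e * v" if "0 \<le> v" "v \<le> d / 2" for v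
    using d(2)[of v] that d(1) by (cases "v = 0") (auto simp: orlicz_zero field_simps)
  then show ?thesis using d(1) by (intro exI[of _ "d / 2"]) auto
qed

lemma orlicz_surj:
  assumes "0 \<le> q" obtains v where "0 \<le> v" "\<phi> v = q"
proof -
  obtain V where V: "V > 0" "\<And>v. v \<ge> V \<Longrightarrow> 1 * v \<le> \<phi> v" using orlicz_superlinear[of 1] by auto
  have "q \<le> \<phi> (max V q)" using V(2)[of "max V q"] by simp
  then have "\<exists>v. 0 \<le> v \<and> v \<le> max V q \<and> \<phi> v = q"
    using assms V(1) by (intro IVT') (auto simp: orlicz_zero orlicz_continuous)
  then show thesis using that by auto
qed

text \<open>The slope is positive because the supporting line is positive at \<open>v\<close> and at
  most \<open>\<phi> 0 = 0\<close> at the origin.\<close>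

lemma orlicz_support:
  assumes v: "0 < v" shows "\<exists>p>0. \<forall>h. \<phi> v + p * (h - v) \<le> \<phi> h"
proof -
  obtain p where p: "\<And>h. \<phi> v + p * (h - v) \<le> \<phi> h"
    using convex_le_Inf_differential[OF orlicz_convex, of v] by auto
  have "0 < p * v" using p[of 0] orlicz_pos[OF v] by (simp add: orlicz_zero)
  then show ?thesis using p v by (auto simp: zero_less_mult_iff)
qed

lemma complementary_bdd: "bdd_above ((\<lambda>u. \<bar>u * v\<bar> - \<phi> u) ` {0<..})"
proof -
  obtain U where U: "U > 0" "\<And>u. u \<ge> U \<Longrightarrow> \<bar>v\<bar> * u \<le> \<phi> u" using orlicz_superlinear[of "\<bar>v\<bar>"] by auto
  have "\<bar>u * v\<bar> - \<phi> u \<le> U * \<bar>v\<bar>" if "0 < u" for u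
  proof (cases "U \<le> u")
    case True
    have "0 \<le> U * \<bar>v\<bar>" using U(1) by simp
    then show ?thesis using U(2)[OF True] that by (simp add: abs_mult mult.commute)
  next
    case False
    then have "u * \<bar>v\<bar> \<le> U * \<bar>v\<bar>" by (intro mult_right_mono) auto
    then show ?thesis using orlicz_nonneg[of u] that by (simp add: abs_mult)
  qed
  then show ?thesis by (intro bdd_aboveI[of _ "U * \<bar>v\<bar>"]) auto
qed

lemma complementary_upper: "0 < u \<Longrightarrow> \<bar>u * v\<bar> - \<phi> u \<le> complementary \<phi> v"
  unfolding complementary_def by (intro cSUP_upper complementary_bdd) auto

lemma complementary_least: "(\<And>u. 0 < u \<Longrightarrow> \<bar>u * v\<bar> - \<phi> u \<le> c) \<Longrightarrow> complementary \<phi> v \<le> c"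
  unfolding complementary_def by (intro cSUP_least) auto

lemma complementary_nonneg: "0 \<le> complementary \<phi> v"
proof (rule field_le_epsilon)
  fix e :: real assume e: "0 < e"
  obtain d where d: "d > 0" "\<And>v. 0 \<le> v \<Longrightarrow> v \<le> d \<Longrightarrow> \<phi> v \<le> 1 * v"
    using orlicz_sublinear[of 1] by auto
  have "\<phi> (min d e) \<le> e" using d(2)[of "min d e"] d(1) e by simp
  moreover have "\<bar>min d e * v\<bar> - \<phi> (min d e) \<le> complementary \<phi> v"
    using d e by (intro complementary_upper) auto
  ultimately show "0 \<le> complementary \<phi> v + e" by linarith
qed

lemma young: "0 \<le> u \<Longrightarrow> 0 \<le> v \<Longrightarrow> u * v \<le> \<phi> u + complementary \<phi> v"
  using complementary_upper[of u v] complementary_nonneg[of v]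
  by (cases "u = 0") (auto simp: orlicz_zero)

lemma orlicz_complementary: "orlicz_function (complementary \<phi>)"
  unfolding orlicz_function_def
proof (intro conjI allI impI)
  show "convex_on UNIV (complementary \<phi>)"
  proof (rule convex_onI)
    fix t x y :: real assume t: "0 < t" "t < 1"
    have "\<bar>u * ((1 - t) * x + t * y)\<bar> - \<phi> u \<le> (1 - t) * complementary \<phi> x + t * complementary \<phi> y"
      if u: "0 < u" for u
    proof -
      have "\<bar>u * ((1 - t) * x + t * y)\<bar> = \<bar>(1 - t) * (u * x) + t * (u * y)\<bar>" by (simp add: algebra_simps)
      also have "\<dots> \<le> \<bar>(1 - t) * (u * x)\<bar> + \<bar>t * (u * y)\<bar>" by (rule abs_triangle_ineq)
      also have "\<dots> = (1 - t) * \<bar>u * x\<bar> + t * \<bar>u * y\<bar>" using t by (simp add: abs_mult)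
      finally have "\<bar>u * ((1 - t) * x + t * y)\<bar> - \<phi> u \<le> (1 - t) * (\<bar>u * x\<bar> - \<phi> u) + t * (\<bar>u * y\<bar> - \<phi> u)"
        by (simp add: algebra_simps)
      also have "\<dots> \<le> (1 - t) * complementary \<phi> x + t * complementary \<phi> y"
        using t u by (intro add_mono mult_left_mono complementary_upper) auto
      finally show ?thesis .
    qed
    then have "complementary \<phi> ((1 - t) * x + t * y) \<le> (1 - t) * complementary \<phi> x + t * complementary \<phi> y"
      by (rule complementary_least)
    then show "complementary \<phi> ((1 - t) *\<^sub>R x + t *\<^sub>R y) \<le> (1 - t) * complementary \<phi> x + t * complementary \<phi> y"
      by simp
  qed simp
  show "complementary \<phi> (- u) = complementary \<phi> u" for u by (simp add: complementary_def)
  show "0 \<le> complementary \<phi> u" for u by (rule complementary_nonneg)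
  show "complementary \<phi> 0 = 0"
    by (rule antisym[OF complementary_least complementary_nonneg]) (simp add: orlicz_nonneg)
  show "0 < complementary \<phi> v" if v: "0 < v" for v
  proof -
    obtain d where d: "d > 0" "\<And>u. 0 \<le> u \<Longrightarrow> u \<le> d \<Longrightarrow> \<phi> u \<le> (v / 2) * u"
      using orlicz_sublinear[of "v / 2"] v by auto
    have "0 < v * d" using v d by simp
    moreover have "\<phi> d \<le> v * d / 2" using d(2)[of d] d(1) by simp
    moreover have "\<bar>d * v\<bar> = v * d" using d(1) v by (simp add: abs_mult)
    ultimately have "0 < \<bar>d * v\<bar> - \<phi> d" by linarith
    also have "\<dots> \<le> complementary \<phi> v" using d by (intro complementary_upper)
    finally show ?thesis .
  qed
  \<comment> \<open>Since \<open>\<phi> u / u\<close> increases, every \<open>u > e\<close>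
    satisfies \<open>\<bar>v\<bar> * u \<le> \<phi> u\<close> and contributes nothing positive; only
    \<open>u \<le> e\<close> matters.\<close>
  have small: "complementary \<phi> v \<le> e * \<bar>v\<bar>" if e: "0 < e" and v: "\<bar>v\<bar> \<le> \<phi> e / e" for e v
  proof (rule complementary_least)
    fix u :: real assume u: "0 < u"
    show "\<bar>u * v\<bar> - \<phi> u \<le> e * \<bar>v\<bar>"
    proof (cases "u \<le> e")
      case True
      then have "u * \<bar>v\<bar> \<le> e * \<bar>v\<bar>" by (intro mult_right_mono) auto
      then show ?thesis using orlicz_nonneg[of u] u by (simp add: abs_mult)
    next
      case False
      have "\<bar>v\<bar> * u \<le> \<phi> e / e * u" using v u by (intro mult_right_mono) auto
      also have "\<dots> \<le> \<phi> u" using orlicz_ratio[of e u] e False by (simp add: field_simps)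
      finally show ?thesis using u e by (simp add: abs_mult mult.commute) (smt (verit) mult_nonneg_nonneg abs_ge_zero)
    qed
  qed
  show "((\<lambda>u. complementary \<phi> u / u) \<longlongrightarrow> 0) (at 0)"
  proof (rule tendstoI)
    fix e :: real assume e: "0 < e"
    have "0 < \<phi> (e / 2) / (e / 2)" using e by (simp add: orlicz_pos)
    moreover have "\<bar>complementary \<phi> v / v\<bar> < e" if "v \<noteq> 0" "\<bar>v\<bar> < \<phi> (e / 2) / (e / 2)" for v
    proof -
      have "complementary \<phi> v \<le> (e / 2) * \<bar>v\<bar>" using that e by (intro small) auto
      moreover have "(e / 2) * \<bar>v\<bar> < e * \<bar>v\<bar>" using e that by simp
      ultimately show ?thesis using that complementary_nonneg[of v] by (simp add: abs_divide divide_less_eq)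
    qed
    ultimately show "\<forall>\<^sub>F u in at 0. dist (complementary \<phi> u / u) 0 < e"
      unfolding eventually_at dist_real_def by (intro exI[of _ "\<phi> (e / 2) / (e / 2)"]) auto
  qed
  \<comment> \<open>Testing the supremum with the fixed argument \<open>C\<close> gives a lower
    bound of slope \<open>C\<close>; for \<open>v \<ge> \<phi> C\<close> the constant
    \<open>\<phi> C\<close> costs at most one unit of slope.\<close>
  show "filterlim (\<lambda>u. complementary \<phi> u / u) at_top at_top"
    unfolding filterlim_at_top
  proof
    fix Z :: real
    define C where "C = \<bar>Z\<bar> + 1"
    have C: "C > 0" by (simp add: C_def)
    have "Z \<le> complementary \<phi> v / v" if v: "v \<ge> \<phi> C" for v
    proof -
      have v0: "0 < v" using orlicz_pos[OF C] v by linarith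
      have "Z * v \<le> (C - 1) * v" using v0 by (intro mult_right_mono) (auto simp: C_def)
      also have "\<dots> \<le> \<bar>C * v\<bar> - \<phi> C" using C v v0 by (simp add: abs_mult algebra_simps)
      also have "\<dots> \<le> complementary \<phi> v" by (rule complementary_upper[OF C])
      finally show ?thesis using v0 by (simp add: field_simps)
    qed
    then show "\<forall>\<^sub>F v in at_top. Z \<le> complementary \<phi> v / v"
      by (auto simp: eventually_at_top_linorder)
  qed
qed

text \<open>Iterating the negated inequality gives the doubling condition, with \<open>(1 + e) ^ n \<ge> 2\<close>.\<close>

lemma not_Delta2_witness:
  assumes "\<not> Delta2_infinity \<phi>" and e: "0 < e"
  shows "\<exists>v\<ge>V. \<phi> v < e * \<phi> ((1 + e) * v)"
proof (rule ccontr)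
  assume neg: "\<not> ?thesis"
  define U where "U = max V 0"
  have step: "e * \<phi> ((1 + e) * v) \<le> \<phi> v" if "U \<le> v" for v
    using neg that by (auto simp: U_def not_less)
  have iter: "e ^ n * \<phi> ((1 + e) ^ n * v) \<le> \<phi> v" if v: "U \<le> v" for n v
  proof (induction n)
    case (Suc n)
    have v0: "0 \<le> v" using v by (simp add: U_def)
    have "1 * v \<le> (1 + e) ^ n * v" using e v0 by (intro mult_right_mono) auto
    then have "e * \<phi> ((1 + e) * ((1 + e) ^ n * v)) \<le> \<phi> ((1 + e) ^ n * v)" using v by (intro step) auto
    then have "e ^ n * (e * \<phi> ((1 + e) * ((1 + e) ^ n * v))) \<le> e ^ n * \<phi> ((1 + e) ^ n * v)"
      using e by (intro mult_left_mono) auto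
    also have "\<dots> \<le> \<phi> v" by (rule Suc)
    finally show ?case by (simp add: ac_simps)
  qed simp
  obtain n where n: "2 < (1 + e) ^ n" using real_arch_pow[of "1 + e" 2] e by auto
  have "\<phi> (2 * v) \<le> (1 / e ^ n) * \<phi> v" if v: "U \<le> v" for v
  proof -
    have v0: "0 \<le> v" using v by (simp add: U_def)
    have "2 * v \<le> (1 + e) ^ n * v" using n v0 by (intro mult_right_mono) auto
    then have "e ^ n * \<phi> (2 * v) \<le> e ^ n * \<phi> ((1 + e) ^ n * v)"
      using e v0 by (intro mult_left_mono orlicz_mono) auto
    also have "\<dots> \<le> \<phi> v" by (rule iter[OF v])
    finally show ?thesis using e by (simp add: field_simps)
  qed
  then have "Delta2_infinity \<phi>"
    unfolding Delta2_infinity_def using e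
    by (intro exI[of _ "1 / e ^ n"] conjI exI[of _ U]) (auto simp: U_def)
  then show False using assms(1) by contradiction
qed

text \<open>The additive constant \<open>\<phi> (2 * u0)\<close> covers the arguments below the
  threshold; it is harmless under an integral because the weight has finite mass.\<close>

lemma Delta2_bound:
  assumes "Delta2_infinity \<phi>"
  shows "\<exists>K>0. \<exists>C\<ge>0. \<forall>v\<ge>0. \<phi> (2 * v) \<le> K * \<phi> v + C"
proof -
  obtain K u0 where K: "K > 0" "u0 \<ge> 0" "\<And>u. u \<ge> u0 \<Longrightarrow> \<phi> (2 * u) \<le> K * \<phi> u"
    using assms by (auto simp: Delta2_infinity_def)
  have "\<phi> (2 * v) \<le> K * \<phi> v + \<phi> (2 * u0)" if v: "0 \<le> v" for v
  proof (cases "u0 \<le> v")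
    case True then show ?thesis using K(3)[OF True] orlicz_nonneg[of "2 * u0"] by simp
  next
    case False
    then have "\<phi> (2 * v) \<le> \<phi> (2 * u0)" using v by (intro orlicz_mono) auto
    moreover have "0 \<le> K * \<phi> v" using K(1) orlicz_nonneg[of v] by simp
    ultimately show ?thesis by linarith
  qed
  then show ?thesis using K(1) orlicz_nonneg[of "2 * u0"] by blast
qed

end

section \<open>Weights\<close>

text \<open>Equality can fail at jumps of \<open>h\<close>, where the rearrangement takes the right
  limit. Everywhere inside the interval \<open>rearr x \<le> h\<close>, since
  \<open>{h > h t}\<close> lies left of \<open>t\<close>. Superlevel sets are thus nested and have
  equal measure, so for each rational level they agree up to a null set.\<close>

lemma AE_rearr_decreasing:
  assumes x [measurable]: "x \<in> borel_measurable leb01" and h: "decreasing01 h"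
    and eq: "AE t in leb01. \<bar>x t\<bar> = h t"
  shows "AE t in leb01. rearr x t = h t"
proof -
  have [measurable]: "h \<in> borel_measurable leb01" "rearr x \<in> borel_measurable leb01"
    using decreasing01_leb01[OF h] decreasing01_leb01[OF decreasing01_rearr[OF x]] by auto
  have d: "distr_fun x \<theta> = measure leb01 {s \<in> space leb01. h s > \<theta>}" for \<theta>
    unfolding distr_fun_eq
  proof (rule measure_eq_AE)
    show "AE t in leb01. t \<in> {s \<in> space leb01. \<theta> < \<bar>x s\<bar>} \<longleftrightarrow> t \<in> {s \<in> space leb01. \<theta> < h s}"
      using eq by eventually_elim auto
  qed measurable
  have le: "rearr x t \<le> h t" if t: "0 < t" "t < 1" for t
  proof (rule ccontr)
    assume "\<not> ?thesis"
    then have "t < distr_fun x (h t)" using less_rearr_iff[OF x decreasing01D(1)[OF h], of t t] by simp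
    also have "\<dots> \<le> measure leb01 {0..<t}"
      unfolding d
    proof (rule leb01.finite_measure_mono)
      show "{s \<in> space leb01. h t < h s} \<subseteq> {0..<t}"
      proof
        fix s assume s: "s \<in> {s \<in> space leb01. h t < h s}"
        show "s \<in> {0..<t}" using s decreasing01D(2)[OF h, of t s] t by (cases "t \<le> s") auto
      qed
      show "{0..<t} \<in> sets leb01" using t by (auto simp: sets_restrict_space_iff)
    qed
    also have "measure leb01 {0..<t} = t" using t by (subst measure_restrict_space) auto
    finally show False by simp
  qed
  have tail: "AE t in leb01. h t > \<theta> \<longrightarrow> rearr x t > \<theta>" if \<theta>: "0 \<le> \<theta>" for \<theta>
  proof -
    have "measure leb01 {t \<in> space leb01. rearr x t > \<theta>} = max 0 (min 1 (distr_fun x \<theta>))"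
    proof (rule measure_leb01_initial)
      show "{t \<in> space leb01. \<theta> < rearr x t} \<inter> {0<..<1} = {0<..<1} \<inter> {..<distr_fun x \<theta>}"
        unfolding less_rearr_iff[OF x \<theta>] by auto
      show "{t \<in> space leb01. \<theta> < rearr x t} \<in> sets leb01" by measurable
    qed
    also have "\<dots> = distr_fun x \<theta>" using distr_fun_bounds[of x \<theta>] by simp
    also have "\<dots> = measure leb01 {s \<in> space leb01. h s > \<theta>}" by (rule d)
    finally have m: "measure leb01 {t \<in> space leb01. rearr x t > \<theta>} = measure leb01 {s \<in> space leb01. h s > \<theta>}" .
    have sub: "{t \<in> space leb01. rearr x t > \<theta>} \<subseteq> {s \<in> space leb01. h s > \<theta>}"
    proof
      fix t assume t: "t \<in> {t \<in> space leb01. rearr x t > \<theta>}"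
      then have "0 < t \<and> t < 1 \<and> \<theta> < rearr x t" using less_rearr_iff[OF x \<theta>, of t] by blast
      then show "t \<in> {s \<in> space leb01. h s > \<theta>}" using le[of t] by auto
    qed
    have sets: "{t \<in> space leb01. rearr x t > \<theta>} \<in> sets leb01" "{s \<in> space leb01. h s > \<theta>} \<in> sets leb01"
      by measurable
    have "measure leb01 ({s \<in> space leb01. h s > \<theta>} - {t \<in> space leb01. rearr x t > \<theta>}) = 0"
      unfolding leb01.finite_measure_Diff[OF sets(2,1) sub] m by simp
    then have "{s \<in> space leb01. h s > \<theta>} - {t \<in> space leb01. rearr x t > \<theta>} \<in> null_sets leb01"
      using sets.Diff[OF sets(2,1)] by (simp only: null_sets_def leb01.emeasure_eq_measure) simp
    then show ?thesis by (rule AE_I') auto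
  qed
  have "AE t in leb01. \<forall>q\<in>\<rat> \<inter> {0..}. h t > q \<longrightarrow> rearr x t > q"
    by (rule AE_ball_countable[THEN iffD2]) (auto intro: tail countable_rat countable_Int1)
  then show ?thesis
    using AE_leb01_pos
  proof eventually_elim
    case (elim t)
    show ?case
    proof (rule antisym[OF le], goal_cases)
      case 3
      show ?case
      proof (rule ccontr)
        assume "\<not> ?case"
        then obtain q where q: "q \<in> \<rat>" "rearr x t < q" "q < h t"
          using Rats_dense_in_real[of "rearr x t" "h t"] by auto
        moreover have "0 \<le> rearr x t" by (rule decreasing01D(1)[OF decreasing01_rearr[OF x]])
        ultimately show False using elim by force
      qed
    qed (use elim in auto)
  qed
qed

lemma nn_integral_arrangement:
  assumes "\<tau> \<in> borel_measurable leb01" "distr leb01 borel \<tau> = distr leb01 borel (\<lambda>t. t)"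
    and F: "F \<in> borel_measurable borel"
  shows "(\<integral>\<^sup>+s. F (\<tau> s) \<partial>leb01) = (\<integral>\<^sup>+t. F t \<partial>leb01)"
proof -
  have id: "(\<lambda>t. t) \<in> borel_measurable leb01" by (rule borel_imp_leb01) simp
  show ?thesis
    using nn_integral_distr[OF assms(1), of F] nn_integral_distr[OF id, of F] assms(2) F by simp
qed

locale positive_weight =
  fixes \<omega> :: "real \<Rightarrow> real"
  assumes decreasing: "decreasing01 \<omega>"
    and positive: "0 < t \<Longrightarrow> t < 1 \<Longrightarrow> 0 < \<omega> t"
    and finite_mass: "(\<integral>\<^sup>+t. ennreal (\<omega> t) \<partial>leb01) < \<infinity>"
begin

lemma w_borel [measurable]: "\<omega> \<in> borel_measurable borel" "\<omega> \<in> borel_measurable leb01"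
  using decreasing by (auto intro: decreasing01_borel decreasing01_leb01)

definition mw :: "real measure" where "mw = density leb01 (\<lambda>t. ennreal (\<omega> t))"

lemma space_mw [simp]: "space mw = {0..<1}" and sets_mw [measurable_cong, simp]: "sets mw = sets leb01"
  by (simp_all add: mw_def)

lemma emeasure_mw: "A \<in> sets leb01 \<Longrightarrow> emeasure mw A = (\<integral>\<^sup>+t. ennreal (\<omega> t) * indicator A t \<partial>leb01)"
  unfolding mw_def by (rule emeasure_density) auto

sublocale mw: finite_measure mw
proof (rule finite_measureI)
  have "emeasure mw (space mw) = (\<integral>\<^sup>+t. ennreal (\<omega> t) * indicator (space leb01) t \<partial>leb01)"
    using emeasure_mw[of "space leb01"] sets.top[of leb01] by simp
  also have "\<dots> = (\<integral>\<^sup>+t. ennreal (\<omega> t) \<partial>leb01)"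
    by (intro nn_integral_cong) simp
  finally show "emeasure mw (space mw) \<noteq> \<infinity>" using finite_mass by simp
qed

definition W :: real where "W = measure mw (space mw)"

lemma nn_integral_mw: "f \<in> borel_measurable leb01 \<Longrightarrow> (\<integral>\<^sup>+t. f t \<partial>mw) = (\<integral>\<^sup>+t. ennreal (\<omega> t) * f t \<partial>leb01)"
  unfolding mw_def by (rule nn_integral_density) auto

lemma AE_mw_pos: "AE t in mw. 0 < t \<and> t < 1"
  unfolding mw_def by (subst AE_density) (use AE_leb01_pos in \<open>auto elim: eventually_mono\<close>)

text \<open>Positivity of the weight enters here: Lebesgue measure is absolutely continuous with
  respect to \<open>mw\<close>. In particular this makes \<open>tail_mass\<close> positive.\<close>

lemma mw_pos_measure:
  assumes "A \<in> sets leb01" "0 < measure leb01 A" shows "0 < measure mw A"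
proof (rule ccontr)
  assume "\<not> ?thesis"
  then have "measure mw A = 0" using measure_nonneg[of mw A] by linarith
  then have "(\<integral>\<^sup>+t. ennreal (\<omega> t) * indicator A t \<partial>leb01) = 0"
    using emeasure_mw[OF assms(1)] by (simp add: mw.emeasure_eq_measure)
  then have "AE t in leb01. ennreal (\<omega> t) * indicator A t = 0"
    using assms(1) by (subst (asm) nn_integral_0_iff_AE) auto
  then have "AE t in leb01. t \<notin> A"
    using AE_leb01_pos
    by eventually_elim (use positive in \<open>force simp: indicator_def split: if_splits\<close>)
  then have "emeasure leb01 A = 0"
    using assms(1) sets.sets_into_space[OF assms(1)] by (subst (asm) AE_iff_measurable[OF assms(1)]) auto
  then show False using assms(2) by (simp add: measure_def)
qed

sublocale ord: measurable_strict_order mw "(<)"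
proof
  have [measurable]: "(\<lambda>x. x) \<in> borel_measurable leb01" by (rule borel_imp_leb01) simp
  have [measurable]: "fst \<in> borel_measurable (leb01 \<Otimes>\<^sub>M leb01)" "snd \<in> borel_measurable (leb01 \<Otimes>\<^sub>M leb01)"
    using measurable_compose[OF measurable_fst \<open>(\<lambda>x. x) \<in> borel_measurable leb01\<close>]
      measurable_compose[OF measurable_snd \<open>(\<lambda>x. x) \<in> borel_measurable leb01\<close>] by auto
  have "Measurable.pred (leb01 \<Otimes>\<^sub>M leb01) (\<lambda>(r, s). r < (s::real))"
    unfolding split_beta' by measurable
  also have "?this \<longleftrightarrow> Measurable.pred (mw \<Otimes>\<^sub>M mw) (\<lambda>(r, s). r < s)"
    by (intro arg_cong2[where f="\<lambda>M f. f \<in> M"] measurable_cong_sets sets_pair_measure_cong) simp_all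
  finally show "Measurable.pred (mw \<Otimes>\<^sub>M mw) (\<lambda>(r, s). r < s)" .
  show "{s} \<in> null_sets mw" if "s \<in> space mw" for s
  proof -
    have "{s} \<in> null_sets leb01"
      using that by (auto simp: null_sets_def emeasure_restrict_space sets_restrict_space_iff)
    moreover have "absolutely_continuous leb01 mw"
      unfolding mw_def by (rule absolutely_continuousI_density) auto
    ultimately show ?thesis by (auto simp: absolutely_continuous_def)
  qed
qed auto

text \<open>The primitive of the weight, obtained as the rank function of \<open>mw\<close> so that
  its uniform distribution under \<open>mw\<close> comes for free.\<close>

abbreviation M :: "real \<Rightarrow> real" where "M \<equiv> ord.rank"

lemma M_eq: "M t = measure mw {s \<in> space mw. s < t}"
  by (simp add: ord.rank_def ord.below_def)

lemma initial_sets [simp]: "{s. 0 \<le> s \<and> s < 1 \<and> s < (t::real)} \<in> sets leb01"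
proof -
  have "{s. 0 \<le> s \<and> s < 1 \<and> s < t} = {0..<min 1 t}" by auto
  then show ?thesis by (auto simp: sets_restrict_space_iff)
qed

lemma M_mono: "s \<le> t \<Longrightarrow> M s \<le> M t"
  unfolding M_eq by (intro mw.finite_measure_mono) auto

lemma M_pos: assumes "0 < t" shows "0 < M t"
  unfolding M_eq
proof (rule mw_pos_measure)
  show "{s \<in> space mw. s < t} \<in> sets leb01" by simp
  have "{s \<in> space mw. s < t} = {0..<min 1 t}" by auto
  then show "0 < measure leb01 {s \<in> space mw. s < t}"
    using assms by (simp add: measure_restrict_space)
qed

lemma M_one: "1 \<le> t \<Longrightarrow> M t = W"
  unfolding M_eq W_def by (intro arg_cong[where f="measure mw"]) auto

lemma W_pos: "0 < W" using M_pos[of 1] M_one[of 1] by simp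

lemma M_less: assumes "t < 1" shows "M t < W"
proof -
  have "0 < measure mw (space mw - {s \<in> space mw. s < t})"
  proof (rule mw_pos_measure)
    show "space mw - {s \<in> space mw. s < t} \<in> sets leb01" by (intro sets.Diff) (use sets.top[of leb01] in simp_all)
    have "space mw - {s \<in> space mw. s < t} = {max 0 t..<1}" by auto
    then show "0 < measure leb01 (space mw - {s \<in> space mw. s < t})"
      using assms by (simp add: measure_restrict_space)
  qed
  then show ?thesis
    unfolding M_eq W_def by (subst (asm) mw.finite_measure_compl) auto
qed

text \<open>The weight of \<open>[1 - t, 1)\<close>: as \<omega> decreases, the least mass that a
  set of Lebesgue measure \<open>t\<close> can receive from any arrangement of \<omega>.\<close>

definition tail_mass :: "real \<Rightarrow> real" where "tail_mass t = W - M (1 - t)"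

lemma tail_mass_pos: "0 < t \<Longrightarrow> 0 < tail_mass t" using M_less[of "1 - t"] by (simp add: tail_mass_def)

lemma tail_mass_mono: "s \<le> t \<Longrightarrow> tail_mass s \<le> tail_mass t" unfolding tail_mass_def using M_mono[of "1 - t" "1 - s"] by simp

end

section \<open>The weight transported by a measure preserving map\<close>

locale arranged_weight = positive_weight +
  fixes \<tau> :: "real \<Rightarrow> real"
  assumes \<tau> [measurable]: "\<tau> \<in> borel_measurable leb01"
    and preserving: "distr leb01 borel \<tau> = distr leb01 borel (\<lambda>t. t)"
begin

definition P :: "real measure" where "P = density leb01 (\<lambda>s. ennreal (\<omega> (\<tau> s)))"

lemma w\<tau>_borel [measurable]: "(\<lambda>s. \<omega> (\<tau> s)) \<in> borel_measurable leb01"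
  by (rule measurable_compose[OF \<tau> w_borel(1)])

lemma space_P [simp]: "space P = {0..<1}" and sets_P [measurable_cong, simp]: "sets P = sets leb01"
  by (simp_all add: P_def)

lemma emeasure_P: "A \<in> sets leb01 \<Longrightarrow> emeasure P A = (\<integral>\<^sup>+s. ennreal (\<omega> (\<tau> s)) * indicator A s \<partial>leb01)"
  unfolding P_def by (rule emeasure_density) auto

lemma nn_integral_P: "f \<in> borel_measurable leb01 \<Longrightarrow> (\<integral>\<^sup>+s. f s \<partial>P) = (\<integral>\<^sup>+s. ennreal (\<omega> (\<tau> s)) * f s \<partial>leb01)"
  unfolding P_def by (rule nn_integral_density) auto

lemma nn_integral_P_comp:
  assumes [measurable]: "F \<in> borel_measurable borel"
  shows "(\<integral>\<^sup>+s. F (\<tau> s) \<partial>P) = (\<integral>\<^sup>+t. F t \<partial>mw)"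
proof -
  have "(\<integral>\<^sup>+s. F (\<tau> s) \<partial>P) = (\<integral>\<^sup>+s. ennreal (\<omega> (\<tau> s)) * F (\<tau> s) \<partial>leb01)"
    by (rule nn_integral_P) measurable
  also have "\<dots> = (\<integral>\<^sup>+t. ennreal (\<omega> t) * F t \<partial>leb01)"
    by (rule nn_integral_arrangement[OF \<tau> preserving]) measurable
  also have "\<dots> = (\<integral>\<^sup>+t. F t \<partial>mw)"
    by (rule nn_integral_mw[symmetric]) (rule borel_imp_leb01, measurable)
  finally show ?thesis .
qed

lemma emeasure_P_space: "emeasure P (space P) = ennreal W"
  using nn_integral_P_comp[of "\<lambda>_. 1"] by (simp add: W_def mw.emeasure_eq_measure)

sublocale P: finite_measure P
  by (rule finite_measureI) (simp only: emeasure_P_space, simp)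

lemma measure_P_space: "measure P (space P) = W"
  using emeasure_P_space W_pos by (simp add: measure_def)

text \<open>Hardy-Littlewood for the indicator of \<open>E\<close> and
  \<open>\<omega> \<circ> \<tau>\<close>: the latter has the tails of \<omega>, and the mass is
  largest when \<open>E\<close> becomes the initial interval of the same length.\<close>

lemma emeasure_P_le:
  assumes E [measurable]: "E \<in> sets leb01"
  shows "emeasure P E \<le> ennreal (M (measure leb01 E))"
proof -
  define e where "e = measure leb01 E"
  have e: "0 \<le> e" "e \<le> 1"
    using leb01.bounded_measure[of E] by (auto simp: e_def measure_restrict_space)
  have dec: "decreasing01 (indicator {0<..<e})"
    using e by (auto simp: decreasing01_def indicator_def)
  have init: "{0<..<e} \<in> sets leb01" using e by (auto simp: sets_restrict_space_iff)
  have ind: "indicator {0<..<e} \<in> borel_measurable leb01" using init by simp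
  have "emeasure P E = (\<integral>\<^sup>+s. ennreal (indicator E s) * ennreal (\<omega> (\<tau> s)) \<partial>leb01)"
    unfolding emeasure_P[OF E] by (intro nn_integral_cong) (auto split: split_indicator)
  also have "\<dots> \<le> (\<integral>\<^sup>+t. ennreal (indicator {0<..<e} t) * ennreal (\<omega> t) \<partial>leb01)"
  proof (rule nn_integral_mult_mono_nested)
    show "sigma_finite_measure leb01" "sigma_finite_measure leb01" by (rule leb01.sigma_finite_measure_axioms)+
    show "emeasure leb01 {s \<in> space leb01. a < indicator E s} \<le>
        emeasure leb01 {t \<in> space leb01. a < indicator {0<..<e} t}" if "0 < a" for a :: real
    proof (cases "a < 1")
      case True
      have "E \<subseteq> space leb01" by (rule sets.sets_into_space[OF E])
      then have 1: "{s \<in> space leb01. a < indicator E s} = E"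
        using True that by (auto simp: indicator_def split: if_splits)
      have 2: "{t \<in> space leb01. a < indicator {0<..<e} t} = {0<..<e}"
        using True that e by (auto simp: indicator_def split: if_splits)
      show ?thesis unfolding 1 2 using e
        by (simp add: emeasure_leb01_le leb01.emeasure_eq_measure[of E] e_def)
    next
      case False
      then have "{s \<in> space leb01. a < indicator E s} = {}" by (auto simp: indicator_def)
      then show ?thesis by (simp only:) simp
    qed
    show "emeasure leb01 {s \<in> space leb01. a < \<omega> (\<tau> s)} \<le> emeasure leb01 {t \<in> space leb01. a < \<omega> t}" for a
    proof -
      have "emeasure leb01 {s \<in> space leb01. a < \<omega> (\<tau> s)} = (\<integral>\<^sup>+s. indicator {t. a < \<omega> t} (\<tau> s) \<partial>leb01)"
        proof -
        have "(\<integral>\<^sup>+s. indicator {t. a < \<omega> t} (\<tau> s) \<partial>leb01) = (\<integral>\<^sup>+s. indicator {s \<in> space leb01. a < \<omega> (\<tau> s)} s \<partial>leb01)"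
          by (intro nn_integral_cong) (auto split: split_indicator)
        also have "\<dots> = emeasure leb01 {s \<in> space leb01. a < \<omega> (\<tau> s)}"
          by (rule nn_integral_indicator) measurable
        finally show ?thesis ..
      qed
      also have "\<dots> = (\<integral>\<^sup>+t. indicator {t. a < \<omega> t} t \<partial>leb01)"
        by (rule nn_integral_arrangement[OF \<tau> preserving]) measurable
      also have "\<dots> = emeasure leb01 {t \<in> space leb01. a < \<omega> t}"
      proof -
        have "(\<integral>\<^sup>+t. indicator {t. a < \<omega> t} t \<partial>leb01) = (\<integral>\<^sup>+t. indicator {t \<in> space leb01. a < \<omega> t} t \<partial>leb01)"
          by (intro nn_integral_cong) (auto split: split_indicator)
        also have "\<dots> = emeasure leb01 {t \<in> space leb01. a < \<omega> t}"
          by (rule nn_integral_indicator) measurable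
        finally show ?thesis .
      qed
      finally show ?thesis by simp
    qed
    show "0 < a \<Longrightarrow> 0 < b \<Longrightarrow> (AE t in leb01. a < indicator {0<..<e} t \<longrightarrow> b < \<omega> t) \<or>
        (AE t in leb01. b < \<omega> t \<longrightarrow> a < indicator {0<..<e} t)" for a b :: real
      by (rule decreasing01_nested[OF dec decreasing])
  qed (use ind in measurable)
  also have "\<dots> = emeasure mw {0<..<e}"
    unfolding emeasure_mw[OF init] by (intro nn_integral_cong) (auto split: split_indicator)
  also have "\<dots> \<le> emeasure mw {s \<in> space mw. s < e}"
    by (intro emeasure_mono) (use e in auto)
  also have "\<dots> = ennreal (M (measure leb01 E))"
    unfolding M_eq e_def by (simp add: mw.emeasure_eq_measure)
  finally show ?thesis .
qed

text \<open>The upper bound applied to the complement of \<open>E\<close>. The left side does not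
  involve \<tau>, which is the uniformity on which the comparison of different arrangements
  rests.\<close>

lemma tail_mass_le_P:
  assumes E: "E \<in> sets leb01"
  shows "tail_mass (measure leb01 E) \<le> measure P E"
proof -
  have E': "E \<in> sets P" using E by simp
  have C: "space leb01 - E \<in> sets leb01" using E by (rule sets.compl_sets)
  have "measure leb01 (space leb01 - E) = 1 - measure leb01 E"
    unfolding leb01.finite_measure_compl[OF E] by (simp add: measure_restrict_space)
  then have "ennreal (measure P (space leb01 - E)) \<le> ennreal (M (1 - measure leb01 E))"
    using emeasure_P_le[OF C] by (simp add: P.emeasure_eq_measure)
  moreover have "0 \<le> M (1 - measure leb01 E)" by (simp add: M_eq)
  ultimately have "measure P (space leb01 - E) \<le> M (1 - measure leb01 E)" by simp
  moreover have "measure P (space leb01 - E) = W - measure P E"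
    using P.finite_measure_compl[OF E'] measure_P_space by simp
  ultimately show ?thesis by (simp add: tail_mass_def)
qed

end

section \<open>The norm through decreasing test functions and arbitrary densities\<close>

context positive_weight begin

text \<open>Extended-valued form of the norm, with test functions that are decreasing from the start;
  \<open>dual_norm_eq_SUP\<close> below identifies it with the supremum in the definition of the Orlicz norm.\<close>

definition dual_norm :: "(real \<Rightarrow> real) \<Rightarrow> (real \<Rightarrow> real) \<Rightarrow> ennreal" where
  "dual_norm \<psi> x = (SUP h\<in>{h. decreasing01 h \<and> (\<integral>\<^sup>+t. ennreal (\<psi> (h t)) \<partial>mw) \<le> 1}.
     \<integral>\<^sup>+t. ennreal (rearr x t) * ennreal (h t) \<partial>mw)"

lemma less_dual_norm_arrange:
  assumes \<psi>: "orlicz_function \<psi>" and z [measurable]: "z \<in> borel_measurable leb01"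
    and L: "L < dual_norm \<psi> z"
  obtains \<tau> v where "arranged_weight \<omega> \<tau>" "v \<in> borel_measurable leb01" "\<And>s. 0 \<le> v s"
    "(\<integral>\<^sup>+s. ennreal (\<psi> (v s)) \<partial>arranged_weight.P \<omega> \<tau>) \<le> 1"
    "L < (\<integral>\<^sup>+s. ennreal \<bar>z s\<bar> * ennreal (v s) \<partial>arranged_weight.P \<omega> \<tau>)"
proof -
  obtain h where h: "decreasing01 h" "(\<integral>\<^sup>+t. ennreal (\<psi> (h t)) \<partial>mw) \<le> 1"
    "L < (\<integral>\<^sup>+t. ennreal (rearr z t) * ennreal (h t) \<partial>mw)"
    using L unfolding dual_norm_def less_SUP_iff by auto
  have [measurable]: "h \<in> borel_measurable borel" "rearr z \<in> borel_measurable borel"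
    using decreasing01_borel[OF h(1)] decreasing01_borel[OF decreasing01_rearr[OF z]] by auto
  have [measurable]: "\<psi> \<in> borel_measurable borel" by (rule orlicz_borel[OF \<psi>])
  obtain \<tau> where \<tau> [measurable]: "\<tau> \<in> borel_measurable leb01"
    and d: "distr leb01 borel \<tau> = distr leb01 borel (\<lambda>t. t)"
    and le: "\<And>s. s \<in> {0..<1} \<Longrightarrow> rearr z (\<tau> s) \<le> \<bar>z s\<bar>"
    using exists_arrangement[OF z] by blast
  interpret arranged_weight \<omega> \<tau> by unfold_locales (fact \<tau> d)+
  show thesis
  proof (rule that[of \<tau> "\<lambda>s. h (\<tau> s)"])
    show "arranged_weight \<omega> \<tau>" by unfold_locales
    show "(\<lambda>s. h (\<tau> s)) \<in> borel_measurable leb01" by measurable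
    show "0 \<le> h (\<tau> s)" for s by (rule decreasing01D(1)[OF h(1)])
    show "(\<integral>\<^sup>+s. ennreal (\<psi> (h (\<tau> s))) \<partial>P) \<le> 1"
      using h(2) nn_integral_P_comp[of "\<lambda>t. ennreal (\<psi> (h t))"] by simp
    have "(\<integral>\<^sup>+t. ennreal (rearr z t) * ennreal (h t) \<partial>mw) = (\<integral>\<^sup>+s. ennreal (rearr z (\<tau> s)) * ennreal (h (\<tau> s)) \<partial>P)"
      by (rule nn_integral_P_comp[symmetric]) measurable
    also have "\<dots> \<le> (\<integral>\<^sup>+s. ennreal \<bar>z s\<bar> * ennreal (h (\<tau> s)) \<partial>P)"
      by (intro nn_integral_mono mult_right_mono ennreal_leI) (auto intro: le)
    finally show "L < (\<integral>\<^sup>+s. ennreal \<bar>z s\<bar> * ennreal (h (\<tau> s)) \<partial>P)"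
      using h(3) by (rule less_le_trans[rotated])
  qed
qed

end

context arranged_weight begin

text \<open>The densities \<open>v\<close> need not be arranged like \<open>\<omega> \<circ> \<tau>\<close>: replacing \<open>v\<close> by its decreasing
  rearrangement \<open>h\<close> with respect to \<open>\<omega> dt\<close> preserves its distribution and only increases the pairing.\<close>

lemma pairing_le_dual_norm:
  assumes \<psi>: "orlicz_function \<psi>" and f [measurable]: "f \<in> borel_measurable leb01"
    and v [measurable]: "v \<in> borel_measurable leb01" and v0: "\<And>s. 0 \<le> v s"
    and mod: "(\<integral>\<^sup>+s. ennreal (\<psi> (v s)) \<partial>P) \<le> 1"
  shows "(\<integral>\<^sup>+s. ennreal \<bar>f s\<bar> * ennreal (v s) \<partial>P) \<le> dual_norm \<psi> f"
proof -
  have vP [measurable]: "v \<in> borel_measurable P" by (simp add: measurable_cong_sets[OF sets_P refl] v)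
  have [measurable]: "\<psi> \<in> borel_measurable borel" by (rule orlicz_borel[OF \<psi>])
  define d where "d = (\<lambda>\<theta>. measure P {s \<in> space P. v s > \<theta>})"
  \<comment> \<open>The inverse is taken at \<open>M t\<close> rather than at \<open>t\<close>
    because \<open>M\<close> is what is uniformly distributed under \<open>mw\<close>; so
    \<open>h\<close> gets under \<open>mw\<close> the tails that \<open>v\<close> has under
    \<open>P\<close>.\<close>
  define h where "h t = (if 0 < t \<and> t < 1 then gen_inv d (M t) else 0)" for t
  have less_h: "\<theta> < h t \<longleftrightarrow> 0 < t \<and> t < 1 \<and> M t < d \<theta>" if "0 \<le> \<theta>" for \<theta> t
    using P.less_gen_inv_tail_iff[OF vP M_pos that, of t] that unfolding h_def d_def by auto
  have "0 \<le> gen_inv d (M t)" if "0 < t" for t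
    unfolding d_def by (rule gen_inv_nonneg[OF P.tail_tendsto_0[OF vP] M_pos[OF that]])
  then have h0: "0 \<le> h t" for t unfolding h_def by auto
  have h: "decreasing01 h"
    unfolding decreasing01_def
  proof (intro conjI allI impI)
    fix s t :: real assume st: "0 < s" "s \<le> t" "t < 1"
    show "h t \<le> h s"
    proof (rule ccontr)
      assume "\<not> ?thesis"
      then have "M t < d (h s)" using less_h[OF h0, of s t] by auto
      then have "h s < h s" using less_h[OF h0, of s s] st M_mono[OF st(2)] by auto
      then show False by simp
    qed
  next
    show "h t = 0" if "t \<le> 0 \<or> 1 \<le> t" for t using that by (auto simp: h_def)
  qed (rule h0)
  have hm [measurable]: "h \<in> borel_measurable mw"
    using decreasing01_leb01[OF h] by (simp add: measurable_cong_sets[OF sets_mw refl])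
  have [measurable]: "rearr f \<in> borel_measurable mw"
    using decreasing01_leb01[OF decreasing01_rearr[OF f]] by (simp add: measurable_cong_sets[OF sets_mw refl])
  have dW: "0 \<le> d \<theta>" "d \<theta> \<le> W" for \<theta>
    using P.bounded_measure measure_P_space by (auto simp: d_def)
  have dist: "emeasure P {s \<in> space P. v s > \<theta>} = emeasure mw {t \<in> space mw. h t > \<theta>}" if "0 \<le> \<theta>" for \<theta>
  proof -
    have "emeasure mw {t \<in> space mw. h t > \<theta>} = emeasure mw {t \<in> space mw. M t < d \<theta>}"
    proof (rule emeasure_eq_AE)
      show "AE t in mw. t \<in> {t \<in> space mw. h t > \<theta>} \<longleftrightarrow> t \<in> {t \<in> space mw. M t < d \<theta>}"
        using AE_mw_pos by eventually_elim (auto simp: less_h[OF that])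
      show "{t \<in> space mw. h t > \<theta>} \<in> sets mw" by measurable
      show "{t \<in> space mw. M t < d \<theta>} \<in> sets mw" by (rule ord.rank_sets)
    qed
    also have "\<dots> = ennreal (d \<theta>)"
      using ord.rank_less_eq[of "d \<theta>"] dW[of \<theta>]
      by (simp only: mw.emeasure_eq_measure W_def)
    finally show ?thesis by (simp only: d_def P.emeasure_eq_measure)
  qed
  have mass: "emeasure mw (space mw) = emeasure P (space P)"
    unfolding emeasure_P_space W_def by (rule mw.emeasure_eq_measure)
  have sf: "sigma_finite_measure P" "sigma_finite_measure mw" by unfold_locales
  have "(\<integral>\<^sup>+t. ennreal (\<psi> (h t)) \<partial>mw) \<le> (\<integral>\<^sup>+s. ennreal (\<psi> (v s)) \<partial>P)"
  proof (rule nn_integral_mono_tails[OF sf(2,1)])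
    show "emeasure mw {t \<in> space mw. a < \<psi> (h t)} \<le> emeasure P {s \<in> space P. a < \<psi> (v s)}" if a: "0 < a" for a
    proof -
      \<comment> \<open>As \<psi> is strictly increasing, the level \<open>a\<close> of
        \<open>\<psi> \<circ> h\<close> is the level \<open>b\<close> of \<open>h\<close>, and
        likewise for \<open>v\<close>.\<close>
      obtain b where b: "0 \<le> b" "\<psi> b = a" using orlicz_surj[OF \<psi>, of a] a by auto
      have iff: "a < \<psi> u \<longleftrightarrow> b < u" if "0 \<le> u" for u
        using orlicz_strict_mono[OF \<psi> b(1), of u] orlicz_mono[OF \<psi> that, of b] b(2) by force
      show ?thesis using dist[OF b(1)] by (simp add: iff h0 v0)
    qed
  qed (use mass in auto)
  then have adm: "(\<integral>\<^sup>+t. ennreal (\<psi> (h t)) \<partial>mw) \<le> 1" using mod by (rule order_trans)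
  have "(\<integral>\<^sup>+s. ennreal \<bar>f s\<bar> * ennreal (v s) \<partial>P) \<le> (\<integral>\<^sup>+t. ennreal (rearr f t) * ennreal (h t) \<partial>mw)"
  proof (rule nn_integral_mult_mono_nested[OF sf])
    show "rearr f \<in> borel_measurable mw" by measurable
    show "(\<lambda>s. \<bar>f s\<bar>) \<in> borel_measurable P"
      using f by (simp add: measurable_cong_sets[OF sets_P refl])
    show "emeasure P {s \<in> space P. a < v s} \<le> emeasure mw {t \<in> space mw. a < h t}" if "0 < a" for a
      using dist[of a] that by simp
    show "(AE t in mw. a < rearr f t \<longrightarrow> b < h t) \<or> (AE t in mw. b < h t \<longrightarrow> a < rearr f t)"
      if "0 < a" "0 < b" for a b
      by (rule decreasing01_nested[OF decreasing01_rearr[OF f] h that])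
    \<comment> \<open>Only an inequality here: \<open>f\<close> need not be sorted along \<tau>, and
      among all sets of the given Lebesgue measure the initial interval has the largest
      weight.\<close>
    show "emeasure P {s \<in> space P. a < \<bar>f s\<bar>} \<le> emeasure mw {t \<in> space mw. a < rearr f t}" if "0 < a" for a
    proof -
      have "{s \<in> space leb01. a < \<bar>f s\<bar>} \<in> sets leb01" by measurable
      from emeasure_P_le[OF this] have "emeasure P {s \<in> space P. a < \<bar>f s\<bar>} \<le> ennreal (M (distr_fun f a))"
        unfolding distr_fun_eq by simp
      also have "\<dots> = emeasure mw {s \<in> space mw. s < distr_fun f a}"
        by (simp add: M_eq mw.emeasure_eq_measure)
      also have "\<dots> = emeasure mw {t \<in> space mw. a < rearr f t}"
      proof (rule emeasure_eq_AE)
        show "AE t in mw. t \<in> {s \<in> space mw. s < distr_fun f a} \<longleftrightarrow> t \<in> {t \<in> space mw. a < rearr f t}"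
          using AE_mw_pos
        proof eventually_elim
          case (elim t) then show ?case using less_rearr_iff[OF f, of a t] that by auto
        qed
        show "{s \<in> space mw. s < distr_fun f a} \<in> sets mw" by simp
        show "{t \<in> space mw. a < rearr f t} \<in> sets mw"
          by measurable
      qed
      finally show ?thesis .
    qed
  qed (use hm vP in auto)
  also have "\<dots> \<le> dual_norm \<psi> f"
    unfolding dual_norm_def using h adm by (intro SUP_upper) auto
  finally show ?thesis .
qed

end

section \<open>Almost square pairs\<close>

context arranged_weight begin

text \<open>The majorant \<open>R\<close> spares the exact modular of a modified density; it will be
  \<open>\<psi> \<circ> v\<close> or a combination of it with constants and an indicator, whose
  integral is explicit.\<close>

lemma pairing_integrable:
  assumes \<psi>: "orlicz_function \<psi>" and f: "f \<in> borel_measurable leb01" and f1: "dual_norm \<psi> f \<le> 1"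
    and g: "g \<in> borel_measurable leb01" "\<And>s. 0 \<le> g s"
    and R: "integrable P R" "\<And>s. s \<in> space P \<Longrightarrow> \<psi> (g s) \<le> R s" "(\<integral>s. R s \<partial>P) \<le> 1"
  shows "integrable P (\<lambda>s. \<bar>f s\<bar> * g s)" "(\<integral>s. \<bar>f s\<bar> * g s \<partial>P) \<le> 1"
proof -
  have R0: "0 \<le> R s" if "s \<in> space P" for s
    using R(2)[OF that] orlicz_nonneg[OF \<psi>, of "g s"] by linarith
  have "(\<integral>\<^sup>+s. ennreal (\<psi> (g s)) \<partial>P) \<le> (\<integral>\<^sup>+s. ennreal (R s) \<partial>P)"
    by (intro nn_integral_mono ennreal_leI R(2))
  also have "\<dots> = ennreal (\<integral>s. R s \<partial>P)"
    using R0 by (intro nn_integral_eq_integral R(1) AE_I2)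
  also have "\<dots> \<le> 1" using R(3) by (simp add: ennreal_le_1)
  finally have "(\<integral>\<^sup>+s. ennreal \<bar>f s\<bar> * ennreal (g s) \<partial>P) \<le> 1"
    using pairing_le_dual_norm[OF \<psi> f g] f1 by (blast intro: order_trans)
  then have le: "(\<integral>\<^sup>+s. ennreal (\<bar>f s\<bar> * g s) \<partial>P) \<le> 1"
    by (simp add: ennreal_mult g)
  have m: "(\<lambda>s. \<bar>f s\<bar> * g s) \<in> borel_measurable P"
    using f g(1) by (simp add: measurable_cong_sets[OF sets_P refl])
  show int: "integrable P (\<lambda>s. \<bar>f s\<bar> * g s)"
    using le by (intro integrableI_nonneg m) (auto simp: g intro: le_less_trans)
  show "(\<integral>s. \<bar>f s\<bar> * g s \<partial>P) \<le> 1"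
    using le nn_integral_eq_integral[OF int] by (simp add: g ennreal_le_1)
qed

lemma integrable_indicator_P: "A \<in> sets P \<Longrightarrow> integrable P (\<lambda>s. indicator A s :: real)"
  by (rule integrable_real_indicator) (simp_all add: P.emeasure_eq_measure)

lemma sets_P_Int: "A \<in> sets P \<Longrightarrow> A \<inter> {0..<1} = A"
  using sets.Int_space_eq2[of A P] by simp

lemma small_measure:
  assumes "E \<in> sets leb01" "measure P E < tail_mass r" shows "measure leb01 E < r"
  using tail_mass_le_P[OF assms(1)] tail_mass_mono[of r "measure leb01 E"] assms(2) by linarith

text \<open>The first bound needs no doubling condition: a density \<open>v\<close> that almost norms \<open>x\<close> is bounded away
  from \<open>0\<close> on most of \<open>{c \<le> \<bar>x\<bar>}\<close>, since otherwise \<open>(1 - q) v\<close> plus a small constant on the bad set \<open>G\<close>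
  would be a better density (\<open>\<psi> u / u\<close> tends to \<open>0\<close> at \<open>0\<close>); and \<open>xy \<le> 0\<close> costs \<open>2 min \<bar>x\<bar> \<bar>y\<bar>\<close> in \<open>\<bar>x + y\<bar>\<close>.
  If \<open>\<bar>y\<bar>\<close> were small on much of \<open>{c \<le> \<bar>x\<bar>}\<close>, the part of \<open>v\<close> living there would be a fixed amount of
  modular that is useless for \<open>y\<close>, and the doubling condition would turn it into a loss of norm.\<close>

lemma near_square_sets:
  fixes x y v :: "real \<Rightarrow> real"
  assumes \<psi>: "orlicz_function \<psi>"
    and x: "x \<in> borel_measurable leb01" "dual_norm \<psi> x \<le> 1"
    and y: "y \<in> borel_measurable leb01" "dual_norm \<psi> y \<le> 1"
    and v: "v \<in> borel_measurable leb01" "\<And>s. 0 \<le> v s" "(\<integral>\<^sup>+s. ennreal (\<psi> (v s)) \<partial>P) \<le> 1"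
    and big: "ennreal (1 - \<delta>) < (\<integral>\<^sup>+s. ennreal \<bar>(x s + y s) / 2\<bar> * ennreal (v s) \<partial>P)"
    and \<delta>: "0 < \<delta>" "\<delta> < 1"
    and c: "0 < c" and v0: "0 < v0" and e: "0 < e"
    and c1: "W * \<psi> (2 * v0) \<le> 1"
    and c2: "W * \<psi> (2 * v0) + 2 * \<delta> < c * v0 * tail_mass r"
    and c3: "\<delta> < min c e * v0 * tail_mass r"
  shows "measure leb01 {s \<in> space leb01. c \<le> \<bar>x s\<bar> \<and> e \<le> \<bar>y s\<bar> \<and> x s * y s \<le> 0} < 2 * r"
    and "\<lbrakk>0 < \<eta>; \<eta> \<le> 1; 0 < K; 0 \<le> C; \<And>u. 0 \<le> u \<Longrightarrow> \<psi> (2 * u) \<le> K * \<psi> u + C;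
      \<eta> * (K + C * W) \<le> \<psi> v0 * tail_mass r; 0 < V; \<And>u. V \<le> u \<Longrightarrow> u \<le> \<psi> u;
      e * (V * W + 1) + 1 / (1 + \<eta>) \<le> 1 - 2 * \<delta>\<rbrakk> \<Longrightarrow>
      measure leb01 {s \<in> space leb01. c \<le> \<bar>x s\<bar> \<and> \<bar>y s\<bar> < e} < 2 * r"
proof -
  have [measurable]: "\<psi> \<in> borel_measurable borel" by (rule orlicz_borel[OF \<psi>])
  have [measurable]: "x \<in> borel_measurable P" "y \<in> borel_measurable P" "v \<in> borel_measurable P"
    using x(1) y(1) v(1) by (simp_all add: measurable_cong_sets[OF sets_P refl])
  have PW: "measure P (space P) = W" by (rule measure_P_space)
  have int\<psi>: "integrable P (\<lambda>s. \<psi> (v s))"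
    using v(3) by (intro integrableI_nonneg) (auto simp: orlicz_nonneg[OF \<psi>] intro: le_less_trans)
  have \<psi>1: "(\<integral>s. \<psi> (v s) \<partial>P) \<le> 1"
    using v(3) nn_integral_eq_integral[OF int\<psi>] by (simp add: orlicz_nonneg[OF \<psi>] ennreal_le_1)
  note X = pairing_integrable[OF \<psi> x v(1,2) int\<psi> order_refl \<psi>1]
  note Y = pairing_integrable[OF \<psi> y v(1,2) int\<psi> order_refl \<psi>1]
  define Xi where "Xi = (\<integral>s. \<bar>x s\<bar> * v s \<partial>P)"
  define Yi where "Yi = (\<integral>s. \<bar>y s\<bar> * v s \<partial>P)"
  have le1: "Xi \<le> 1" "Yi \<le> 1" unfolding Xi_def Yi_def by (rule X(2) Y(2))+
  have half: "\<bar>(x s + y s) / 2\<bar> * v s \<le> (\<bar>x s\<bar> * v s + \<bar>y s\<bar> * v s) / 2" for s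
  proof -
    have "\<bar>(x s + y s) / 2\<bar> \<le> (\<bar>x s\<bar> + \<bar>y s\<bar>) / 2" using abs_triangle_ineq[of "x s" "y s"] by simp
    then have "\<bar>(x s + y s) / 2\<bar> * v s \<le> (\<bar>x s\<bar> + \<bar>y s\<bar>) / 2 * v s" by (intro mult_right_mono v(2))
    then show ?thesis by (simp add: field_simps)
  qed
  have intXY: "integrable P (\<lambda>s. (\<bar>x s\<bar> * v s + \<bar>y s\<bar> * v s) / 2)"
    using X(1) Y(1) by simp
  have intZ: "integrable P (\<lambda>s. \<bar>(x s + y s) / 2\<bar> * v s)"
  proof (rule Bochner_Integration.integrable_bound[OF intXY])
    show "AE s in P. norm (\<bar>(x s + y s) / 2\<bar> * v s) \<le> norm ((\<bar>x s\<bar> * v s + \<bar>y s\<bar> * v s) / 2)"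
      using half v(2) by (intro AE_I2) (smt (verit) abs_ge_zero mult_nonneg_nonneg real_norm_def)
  qed measurable
  have Z: "1 - \<delta> < (\<integral>s. \<bar>(x s + y s) / 2\<bar> * v s \<partial>P)"
  proof -
    have "(\<integral>\<^sup>+s. ennreal \<bar>(x s + y s) / 2\<bar> * ennreal (v s) \<partial>P) = (\<integral>\<^sup>+s. ennreal (\<bar>(x s + y s) / 2\<bar> * v s) \<partial>P)"
      by (simp only: ennreal_mult v abs_ge_zero)
    also have "\<dots> = ennreal (\<integral>s. \<bar>(x s + y s) / 2\<bar> * v s \<partial>P)"
      by (intro nn_integral_eq_integral intZ) (simp add: v)
    finally show ?thesis using big \<delta> by (simp add: ennreal_less_iff)
  qed
  have "(\<integral>s. \<bar>(x s + y s) / 2\<bar> * v s \<partial>P) \<le> (\<integral>s. (\<bar>x s\<bar> * v s + \<bar>y s\<bar> * v s) / 2 \<partial>P)"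
    by (rule integral_mono[OF intZ intXY half])
  also have "\<dots> = (Xi + Yi) / 2" using X(1) Y(1) by (simp add: Xi_def Yi_def)
  \<comment> \<open>Both pairings are at most \<open>1\<close> and their mean exceeds
    \<open>1 - \<delta>\<close>, so each exceeds \<open>1 - 2 * \<delta>\<close>.\<close>
  finally have XY: "1 - 2 * \<delta> < Xi" "1 - 2 * \<delta> < Yi" using Z le1 by auto

  define G where "G = {s \<in> space P. c \<le> \<bar>x s\<bar> \<and> v s < v0}"
  have G [measurable]: "G \<in> sets P" unfolding G_def by measurable
  \<comment> \<open>\<open>q\<close> is the modular of the constant \<open>2 * v0\<close>, and by
    convexity shrinking \<open>v\<close> by \<open>1 - q\<close> makes room for it. On
    \<open>G\<close> the new density stays below \<open>2 * v0\<close>; off \<open>G\<close> it is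
    the shrunken \<open>v\<close>.\<close>
  define q where "q = W * \<psi> (2 * v0)"
  have q: "0 \<le> q" "q \<le> 1" using c1 W_pos orlicz_nonneg[OF \<psi>, of "2 * v0"] by (auto simp: q_def)
  define v' where "v' s = (1 - q) * v s + v0 * indicator G s" for s
  have R: "integrable P (\<lambda>s. (1 - q) * \<psi> (v s) + \<psi> (2 * v0))" using int\<psi> by simp
  have v'R: "\<psi> (v' s) \<le> (1 - q) * \<psi> (v s) + \<psi> (2 * v0)" for s
  proof (cases "s \<in> G")
    case True
    have "(1 - q) * v s \<le> 1 * v s" using q v(2)[of s] by (intro mult_right_mono) auto
    then have "v' s \<le> 2 * v0" "0 \<le> v' s" using True q v0 v(2)[of s] by (auto simp: v'_def G_def)
    then have "\<psi> (v' s) \<le> \<psi> (2 * v0)" by (intro orlicz_mono[OF \<psi>])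
    moreover have "0 \<le> (1 - q) * \<psi> (v s)" using q orlicz_nonneg[OF \<psi>, of "v s"] by simp
    ultimately show ?thesis by linarith
  next
    case False
    then show ?thesis
      using orlicz_scale[OF \<psi>, of "1 - q" "v s"] q orlicz_nonneg[OF \<psi>, of "2 * v0"] by (simp add: v'_def)
  qed
  have R1: "(\<integral>s. (1 - q) * \<psi> (v s) + \<psi> (2 * v0) \<partial>P) \<le> 1"
  proof -
    have "(\<integral>s. (1 - q) * \<psi> (v s) + \<psi> (2 * v0) \<partial>P) = (1 - q) * (\<integral>s. \<psi> (v s) \<partial>P) + q"
      using int\<psi> by (simp add: PW[simplified] q_def)
    also have "\<dots> \<le> (1 - q) * 1 + q" using q \<psi>1 by (intro add_right_mono mult_left_mono) auto
    finally show ?thesis by simp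
  qed
  have v'm: "v' \<in> borel_measurable leb01" "0 \<le> v' s" for s
  proof -
    have "v' \<in> borel_measurable P" unfolding v'_def by measurable
    then show "v' \<in> borel_measurable leb01" by (simp add: measurable_cong_sets[OF sets_P refl])
    show "0 \<le> v' s" using q v0 v(2)[of s] by (auto simp: v'_def)
  qed
  note X' = pairing_integrable[OF \<psi> x v'm R v'R R1]
  have indG: "integrable P (\<lambda>s. indicator G s :: real)" using G by (rule integrable_indicator_P)
  have PG: "measure P G < tail_mass r"
  proof -
    \<comment> \<open>The new density gains \<open>c * v0\<close> per unit of \<open>P\<close> on
      \<open>G\<close> and loses the fraction \<open>q\<close> of a pairing that was within
      \<open>2 * \<delta>\<close> of the maximum.\<close>
    have "(1 - q) * Xi + c * v0 * measure P G = (\<integral>s. (1 - q) * (\<bar>x s\<bar> * v s) + c * v0 * indicator G s \<partial>P)"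
      using X(1) indG by (simp add: Xi_def sets_P_Int[OF G])
    also have "\<dots> \<le> (\<integral>s. \<bar>x s\<bar> * v' s \<partial>P)"
    proof (rule integral_mono[OF _ X'(1)])
      show "integrable P (\<lambda>s. (1 - q) * (\<bar>x s\<bar> * v s) + c * v0 * indicator G s)"
        using X(1) indG by simp
      show "(1 - q) * (\<bar>x s\<bar> * v s) + c * v0 * indicator G s \<le> \<bar>x s\<bar> * v' s" for s
        using v0 by (auto simp: v'_def algebra_simps G_def indicator_def)
    qed
    also have "\<dots> \<le> 1" by (rule X'(2))
    finally have "c * v0 * measure P G \<le> 1 - (1 - q) * Xi" by simp
    also have "\<dots> \<le> 1 - (1 - q) * (1 - 2 * \<delta>)"
      using q XY by (intro diff_left_mono mult_left_mono) auto
    also have "\<dots> \<le> q + 2 * \<delta>" using q \<delta> by (simp add: algebra_simps)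
    also have "\<dots> < c * v0 * tail_mass r" using c2 by (simp add: q_def)
    finally show ?thesis using c v0 by simp
  qed
  then have muG: "measure leb01 G < r" using G by (intro small_measure) auto

  show "measure leb01 {s \<in> space leb01. c \<le> \<bar>x s\<bar> \<and> e \<le> \<bar>y s\<bar> \<and> x s * y s \<le> 0} < 2 * r"
  proof -
    define m where "m = min c e"
    have m: "0 < m" "m \<le> c" "m \<le> e" using c e by (auto simp: m_def)
    define B where "B = {s \<in> space P. c \<le> \<bar>x s\<bar> \<and> e \<le> \<bar>y s\<bar> \<and> x s * y s \<le> 0 \<and> v0 \<le> v s}"
    have B [measurable]: "B \<in> sets P" unfolding B_def by measurable
    have indB: "integrable P (\<lambda>s. indicator B s :: real)" using B by (rule integrable_indicator_P)
    have "\<bar>(x s + y s) / 2\<bar> * v s \<le> (\<bar>x s\<bar> * v s + \<bar>y s\<bar> * v s) / 2 - m * v0 * indicator B s" for s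
    proof (cases "s \<in> B")
      case True
      then have b: "c \<le> \<bar>x s\<bar>" "e \<le> \<bar>y s\<bar>" "x s * y s \<le> 0" "v0 \<le> v s" by (auto simp: B_def)
      have "\<bar>x s + y s\<bar> \<le> \<bar>x s\<bar> + \<bar>y s\<bar> - 2 * m"
        using b(1-3) m by (auto simp: mult_le_0_iff)
      then have "\<bar>x s + y s\<bar> / 2 \<le> (\<bar>x s\<bar> + \<bar>y s\<bar> - 2 * m) / 2"
        by (rule divide_right_mono) simp
      then have "\<bar>(x s + y s) / 2\<bar> \<le> (\<bar>x s\<bar> + \<bar>y s\<bar>) / 2 - m"
        by (simp add: diff_divide_distrib)
      then have "\<bar>(x s + y s) / 2\<bar> * v s \<le> ((\<bar>x s\<bar> + \<bar>y s\<bar>) / 2 - m) * v s"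
        by (intro mult_right_mono v(2))
      moreover have "m * v0 \<le> m * v s" using b(4) m by (intro mult_left_mono) auto
      ultimately show ?thesis using True by (simp add: algebra_simps add_divide_distrib)
    qed (use half in simp)
    then have "(\<integral>s. \<bar>(x s + y s) / 2\<bar> * v s \<partial>P) \<le> (\<integral>s. (\<bar>x s\<bar> * v s + \<bar>y s\<bar> * v s) / 2 - m * v0 * indicator B s \<partial>P)"
      using intXY indB by (intro integral_mono intZ) auto
    also have "\<dots> = (Xi + Yi) / 2 - m * v0 * measure P B"
      using X(1) Y(1) indB by (simp add: Xi_def Yi_def sets_P_Int[OF B])
    finally have "1 - \<delta> < (Xi + Yi) / 2 - m * v0 * measure P B" by (rule less_le_trans[OF Z])
    moreover have "(Xi + Yi) / 2 \<le> 1" using le1 by simp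
    ultimately have "m * v0 * measure P B < \<delta>" by (smt (verit))
    also note c3[folded m_def]
    finally have "measure P B < tail_mass r" using m v0 by (simp add: mult_less_cancel_left_pos)
    then have muB: "measure leb01 B < r" using B by (intro small_measure) auto
    have "measure leb01 {s \<in> space leb01. c \<le> \<bar>x s\<bar> \<and> e \<le> \<bar>y s\<bar> \<and> x s * y s \<le> 0} \<le> measure leb01 (G \<union> B)"
      using G B by (intro leb01.finite_measure_mono) (auto simp: G_def B_def)
    also have "\<dots> \<le> measure leb01 G + measure leb01 B" using G B by (intro measure_Un_le) auto
    finally show ?thesis using muG muB by simp
  qed

  assume \<eta>: "0 < \<eta>" "\<eta> \<le> 1" and K: "0 < K" "0 \<le> C" "\<And>u. 0 \<le> u \<Longrightarrow> \<psi> (2 * u) \<le> K * \<psi> u + C"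
    and \<eta>K: "\<eta> * (K + C * W) \<le> \<psi> v0 * tail_mass r" and V: "0 < V" "\<And>u. V \<le> u \<Longrightarrow> u \<le> \<psi> u"
    and small: "e * (V * W + 1) + 1 / (1 + \<eta>) \<le> 1 - 2 * \<delta>"
  show "measure leb01 {s \<in> space leb01. c \<le> \<bar>x s\<bar> \<and> \<bar>y s\<bar> < e} < 2 * r"
  proof (rule ccontr)
    assume large: "\<not> ?thesis"
    define D where "D = {s \<in> space P. c \<le> \<bar>x s\<bar> \<and> \<bar>y s\<bar> < e \<and> v0 \<le> v s}"
    have D [measurable]: "D \<in> sets P" unfolding D_def by measurable
    have indD: "integrable P (\<lambda>s. indicator D s :: real)" using D by (rule integrable_indicator_P)
    have "measure leb01 {s \<in> space leb01. c \<le> \<bar>x s\<bar> \<and> \<bar>y s\<bar> < e} \<le> measure leb01 (G \<union> D)"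
      using G D by (intro leb01.finite_measure_mono) (auto simp: G_def D_def)
    also have "\<dots> \<le> measure leb01 G + measure leb01 D" using G D by (intro measure_Un_le) auto
    finally have "r \<le> measure leb01 D" using muG large by simp
    then have PD: "tail_mass r \<le> measure P D" using tail_mass_mono[of r "measure leb01 D"] tail_mass_le_P[of D] D by auto
    \<comment> \<open>\<open>v\<close> is switched off on \<open>D\<close> and raised elsewhere by
      \<open>1 + \<eta>\<close>, that is, to a convex combination of \<open>v\<close> and
      \<open>2 * v\<close>. The modular saved on \<open>D\<close>, at least
      \<open>\<psi> v0 * tail_mass r\<close>, pays the doubling cost
      \<open>\<eta> * (K + C * W)\<close>.\<close>
    define g where "g s = (1 + \<eta>) * (v s * (1 - indicator D s))" for s
    have gm: "g \<in> borel_measurable leb01" "0 \<le> g s" for s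
    proof -
      have "g \<in> borel_measurable P" unfolding g_def by measurable
      then show "g \<in> borel_measurable leb01" by (simp add: measurable_cong_sets[OF sets_P refl])
      show "0 \<le> g s" using \<eta> v(2)[of s] by (auto simp: g_def indicator_def)
    qed
    define R where "R s = (1 + \<eta> * K) * \<psi> (v s) - \<psi> v0 * indicator D s + \<eta> * C" for s
    have Rint: "integrable P R" unfolding R_def using int\<psi> indD by simp
    have gR: "\<psi> (g s) \<le> R s" for s
    proof (cases "s \<in> D")
      case True
      then have "\<psi> v0 \<le> \<psi> (v s)" using v0 by (intro orlicz_mono[OF \<psi>]) (auto simp: D_def)
      moreover have "0 \<le> \<eta> * K * \<psi> (v s)" "0 \<le> \<eta> * C" using \<eta> K orlicz_nonneg[OF \<psi>, of "v s"] by auto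
      ultimately show ?thesis using True by (simp add: g_def R_def orlicz_zero[OF \<psi>] algebra_simps)
    next
      case False
      have "\<psi> ((1 - \<eta>) *\<^sub>R v s + \<eta> *\<^sub>R (2 * v s)) \<le> (1 - \<eta>) * \<psi> (v s) + \<eta> * \<psi> (2 * v s)"
        using \<eta> by (intro convex_onD[OF orlicz_convex[OF \<psi>]]) auto
      also have "(1 - \<eta>) *\<^sub>R v s + \<eta> *\<^sub>R (2 * v s) = g s" using False by (simp add: g_def algebra_simps)
      also have "(1 - \<eta>) * \<psi> (v s) + \<eta> * \<psi> (2 * v s) \<le> 1 * \<psi> (v s) + \<eta> * (K * \<psi> (v s) + C)"
        using \<eta> orlicz_nonneg[OF \<psi>, of "v s"] K(3)[OF v(2)[of s]]
        by (intro add_mono mult_right_mono mult_left_mono) auto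
      finally show ?thesis using False by (simp add: R_def algebra_simps)
    qed
    have RI: "(\<integral>s. R s \<partial>P) \<le> 1"
    proof -
      have "(\<integral>s. R s \<partial>P) = (1 + \<eta> * K) * (\<integral>s. \<psi> (v s) \<partial>P) - \<psi> v0 * measure P D + \<eta> * C * W"
        unfolding R_def using int\<psi> indD by (simp add: PW[simplified] sets_P_Int[OF D])
      also have "\<dots> \<le> (1 + \<eta> * K) * 1 - \<psi> v0 * tail_mass r + \<eta> * C * W"
        using \<psi>1 PD \<eta> K orlicz_nonneg[OF \<psi>, of v0] by (intro add_mono diff_mono mult_left_mono) auto
      also have "\<dots> \<le> 1" using \<eta>K by (simp add: algebra_simps)
      finally show ?thesis .
    qed
    note Y' = pairing_integrable[OF \<psi> y gm Rint gR RI]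
    \<comment> \<open>Superlinearity bounds the integral of \<open>v\<close> independently of
      \<open>v\<close> and \<tau>, so the region where \<open>\<bar>y\<bar> < e\<close> adds at most
      \<open>e * (V * W + 1)\<close> to the pairing.\<close>
    have "v s \<le> V + \<psi> (v s)" for s
      using V(2)[of "v s"] V(1) orlicz_nonneg[OF \<psi>, of "v s"] by (cases "V \<le> v s") auto
    then have "norm (v s) \<le> norm (V + \<psi> (v s))" for s
      using v(2)[of s] by (smt (verit) real_norm_def)
    then have intv: "integrable P v"
      using int\<psi> by (intro Bochner_Integration.integrable_bound[of P "\<lambda>s. V + \<psi> (v s)" v]) auto
    have "(\<integral>s. v s \<partial>P) \<le> (\<integral>s. V + \<psi> (v s) \<partial>P)"
      using int\<psi> intv \<open>\<And>s. v s \<le> V + \<psi> (v s)\<close> by (intro integral_mono) auto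
    also have "\<dots> \<le> V * W + 1" using int\<psi> \<psi>1 by (simp add: PW[simplified] mult.commute)
    finally have vI: "(\<integral>s. v s \<partial>P) \<le> V * W + 1" .
    \<comment> \<open>Off \<open>D\<close> the pairing is that of the admissible \<open>g\<close>
      divided by \<open>1 + \<eta>\<close>. The resulting total is at most
      \<open>1 - 2 * \<delta>\<close>, against \<open>XY\<close>.\<close>
    have "Yi \<le> (\<integral>s. (\<bar>y s\<bar> * g s) / (1 + \<eta>) + e * v s \<partial>P)"
      unfolding Yi_def
    proof (rule integral_mono[OF Y(1)])
      show "integrable P (\<lambda>s. (\<bar>y s\<bar> * g s) / (1 + \<eta>) + e * v s)" using Y'(1) intv by simp
      show "\<bar>y s\<bar> * v s \<le> (\<bar>y s\<bar> * g s) / (1 + \<eta>) + e * v s" for s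
      proof (cases "s \<in> D")
        case True
        then have "\<bar>y s\<bar> * v s \<le> e * v s" using v(2)[of s] by (intro mult_right_mono) (auto simp: D_def)
        then show ?thesis using True by (simp add: g_def)
      next
        case False then show ?thesis using \<eta> e v(2)[of s] by (simp add: g_def)
      qed
    qed
    also have "\<dots> = (\<integral>s. \<bar>y s\<bar> * g s \<partial>P) / (1 + \<eta>) + e * (\<integral>s. v s \<partial>P)" using Y'(1) intv by simp
    also have "\<dots> \<le> 1 / (1 + \<eta>) + e * (V * W + 1)"
      using Y'(2) \<eta> e vI by (intro add_mono divide_right_mono mult_left_mono) auto
    finally show False using XY(2) small by simp
  qed
qed

end

section \<open>From the doubling condition to non-squareness: choice of the constants\<close>

lemma rearr_uminus: "rearr (\<lambda>s. - y s) = rearr y"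
  by (simp add: rearr_def rearrangement_def distr_fun_def fun_eq_iff)

context positive_weight begin

lemma dual_norm_uminus: "dual_norm \<psi> (\<lambda>s. - y s) = dual_norm \<psi> y"
  by (simp add: dual_norm_def rearr_uminus)

lemma dual_norm_pos_imp:
  assumes x [measurable]: "x \<in> borel_measurable leb01" and pos: "0 < dual_norm \<psi> x"
  obtains c where "0 < c" "0 < measure leb01 {s \<in> space leb01. c \<le> \<bar>x s\<bar>}"
proof -
  have "0 < distr_fun x 0"
  proof (rule ccontr)
    assume "\<not> ?thesis"
    then have "\<not> 0 < rearr x t" for t using less_rearr_iff[OF x, of 0 t] by auto
    then have "ennreal (rearr x t) = 0" for t by (simp add: ennreal_neg not_less)
    then show False using pos by (simp add: dual_norm_def less_SUP_iff)
  qed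
  then have "0 < measure leb01 {s \<in> space leb01. \<bar>x s\<bar> > 0}" by (simp only: distr_fun_eq)
  from order_tendstoD(1)[OF leb01.tail_right_cont[OF abs_meas[OF x]] this]
  obtain n where n: "0 < measure leb01 {s \<in> space leb01. \<bar>x s\<bar> > 0 + 1 / Suc n}"
    by (auto simp: eventually_sequentially)
  also have "\<dots> \<le> measure leb01 {s \<in> space leb01. 1 / Suc n \<le> \<bar>x s\<bar>}"
    by (rule leb01.finite_measure_mono, force, measurable)
  finally show thesis by (intro that[of "1 / Suc n"]) auto
qed

text \<open>If both halves had norm close to \<open>1\<close>, each with its own arrangement, the three sets bounded in
  \<open>near_square_sets\<close> (for \<open>y\<close> and for \<open>-y\<close>) would cover \<open>{c \<le> \<bar>x\<bar>}\<close>.\<close>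

lemma non_square_of_Delta2:
  assumes \<psi>: "orlicz_function \<psi>" and \<Delta>: "Delta2_infinity \<psi>"
    and x [measurable]: "x \<in> borel_measurable leb01" and x1: "dual_norm \<psi> x \<le> 1" and x0: "0 < dual_norm \<psi> x"
  shows "\<exists>\<delta>. 0 < \<delta> \<and> \<delta> < 1 \<and> (\<forall>y\<in>borel_measurable leb01. dual_norm \<psi> y \<le> 1 \<longrightarrow>
    dual_norm \<psi> (\<lambda>t. (x t - y t) / 2) \<le> ennreal (1 - \<delta>) \<or> dual_norm \<psi> (\<lambda>t. (x t + y t) / 2) \<le> ennreal (1 - \<delta>))"
proof -
  obtain c where c: "0 < c" and s0: "0 < measure leb01 {s \<in> space leb01. c \<le> \<bar>x s\<bar>}"
    using dual_norm_pos_imp[OF x x0] .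
  \<comment> \<open>A sixth, because three exceptional sets of measure less than
    \<open>2 * r\<close> each must fail to cover.\<close>
  define r where "r = measure leb01 {s \<in> space leb01. c \<le> \<bar>x s\<bar>} / 6"
  have r: "0 < r" using s0 by (simp add: r_def)
  define \<kappa> where "\<kappa> = tail_mass r"
  have \<kappa>: "0 < \<kappa>" using tail_mass_pos[OF r] by (simp add: \<kappa>_def)
  \<comment> \<open>At the argument \<open>2 * v0\<close> this slope makes the cost
    \<open>W * \<psi> (2 * v0)\<close> at most half of the gain \<open>c * v0 * \<kappa>\<close>.
    The bound \<open>1 / (c * \<kappa>)\<close> in \<open>v0\<close> keeps that gain, and with it
    the cost, below \<open>1\<close>.\<close>
  obtain d where d: "0 < d" "\<And>u. 0 \<le> u \<Longrightarrow> u \<le> d \<Longrightarrow> \<psi> u \<le> (c * \<kappa> / (4 * W)) * u"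
    using orlicz_sublinear[OF \<psi>, of "c * \<kappa> / (4 * W)"] c \<kappa> W_pos by auto
  define v0 where "v0 = min (d / 2) (1 / (c * \<kappa>))"
  have v0: "0 < v0" using d(1) c \<kappa> by (simp add: v0_def)
  have "\<psi> (2 * v0) \<le> (c * \<kappa> / (4 * W)) * (2 * v0)" using v0 by (intro d(2)) (auto simp: v0_def)
  then have "W * \<psi> (2 * v0) \<le> W * ((c * \<kappa> / (4 * W)) * (2 * v0))" using W_pos by (intro mult_left_mono) auto
  also have "\<dots> = c * v0 * \<kappa> / 2" using W_pos by simp
  finally have \<psi>v0: "W * \<psi> (2 * v0) \<le> c * v0 * \<kappa> / 2" .
  have "c * \<kappa> * v0 \<le> c * \<kappa> * (1 / (c * \<kappa>))" using c \<kappa> by (intro mult_left_mono) (auto simp: v0_def)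
  then have cv0: "c * v0 * \<kappa> \<le> 1" using c \<kappa> by (simp add: ac_simps)
  obtain K C where K: "0 < K" "0 \<le> C" "\<And>u. 0 \<le> u \<Longrightarrow> \<psi> (2 * u) \<le> K * \<psi> u + C"
    using Delta2_bound[OF \<psi> \<Delta>] by auto
  have KC: "0 < K + C * W" using K W_pos by (simp add: add_pos_nonneg)
  \<comment> \<open>The cap \<open>1\<close> permits the convex combination of \<open>v\<close> and
    \<open>2 * v\<close>; the other entry keeps the doubling cost within the modular saved.\<close>
  define \<eta> where "\<eta> = min 1 (\<psi> v0 * \<kappa> / (K + C * W))"
  have \<eta>: "0 < \<eta>" "\<eta> \<le> 1" using orlicz_pos[OF \<psi> v0] \<kappa> KC by (auto simp: \<eta>_def)
  have "\<eta> * (K + C * W) \<le> \<psi> v0 * \<kappa> / (K + C * W) * (K + C * W)"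
    using KC by (intro mult_right_mono) (auto simp: \<eta>_def)
  then have \<eta>K: "\<eta> * (K + C * W) \<le> \<psi> v0 * \<kappa>" using KC by simp
  obtain V where V: "0 < V" "\<And>u. V \<le> u \<Longrightarrow> u \<le> \<psi> u" using orlicz_superlinear[OF \<psi>, of 1] by auto
  have VW: "0 < V * W + 1" using V(1) W_pos by (simp add: add_pos_pos)
  \<comment> \<open>The relative gain from the factor \<open>1 + \<eta>\<close>. One half of it
    absorbs \<open>e * (V * W + 1)\<close>, the other half \<open>2 * \<delta>\<close>.\<close>
  define g where "g = 1 - 1 / (1 + \<eta>)"
  have g: "0 < g" using \<eta> by (simp add: g_def)
  define e where "e = g / (2 * (V * W + 1))"
  have e: "0 < e" using g VW by (simp add: e_def)
  define m where "m = min c e"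
  have m: "0 < m" using c e by (simp add: m_def)
  \<comment> \<open>In this order the entries keep \<delta> below \<open>1\<close>, let
    \<open>2 * \<delta>\<close> use a quarter of \<open>c * v0 * \<kappa>\<close>, stay under the
    loss caused by opposite signs, and leave half of \<open>g\<close> for
    \<open>2 * \<delta>\<close>.\<close>
  define \<delta> where "\<delta> = Min {1 / 2, c * v0 * \<kappa> / 8, m * v0 * \<kappa> / 2, g / 4}"
  have \<delta>: "0 < \<delta>" using c v0 \<kappa> m g by (simp add: \<delta>_def)
  have \<delta>le: "\<delta> \<le> 1 / 2" "\<delta> \<le> c * v0 * \<kappa> / 8" "\<delta> \<le> m * v0 * \<kappa> / 2" "\<delta> \<le> g / 4"
    unfolding \<delta>_def by (rule Min_le; simp)+
  have pos: "0 < c * v0 * \<kappa>" "0 < m * v0 * \<kappa>" using c v0 \<kappa> m by auto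
  have c1: "W * \<psi> (2 * v0) \<le> 1" using \<psi>v0 cv0 by linarith
  have c2: "W * \<psi> (2 * v0) + 2 * \<delta> < c * v0 * tail_mass r" using \<psi>v0 \<delta>le(2) pos(1) by (simp only: \<kappa>_def[symmetric])
  have c3: "\<delta> < min c e * v0 * tail_mass r" using \<delta>le(3) pos(2) by (simp only: \<kappa>_def[symmetric] m_def[symmetric])
  have c4: "\<eta> * (K + C * W) \<le> \<psi> v0 * tail_mass r" using \<eta>K by (simp add: \<kappa>_def)
  have "g / (2 * q) * q = g / 2" if "0 < q" for q :: real using that by simp
  then have "e * (V * W + 1) = g / 2" unfolding e_def using VW by blast
  moreover have "1 / (1 + \<eta>) = 1 - g" by (simp add: g_def)
  ultimately have c5: "e * (V * W + 1) + 1 / (1 + \<eta>) \<le> 1 - 2 * \<delta>" using \<delta>le(4) by simp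
  have "dual_norm \<psi> (\<lambda>t. (x t - y t) / 2) \<le> ennreal (1 - \<delta>) \<or> dual_norm \<psi> (\<lambda>t. (x t + y t) / 2) \<le> ennreal (1 - \<delta>)"
    if y [measurable]: "y \<in> borel_measurable leb01" and y1: "dual_norm \<psi> y \<le> 1" for y
  proof (rule ccontr)
    assume neg: "\<not> ?thesis"
    have sets: "measure leb01 {s \<in> space leb01. c \<le> \<bar>x s\<bar> \<and> e \<le> \<bar>u s\<bar> \<and> x s * u s \<le> 0} < 2 * r"
      "measure leb01 {s \<in> space leb01. c \<le> \<bar>x s\<bar> \<and> \<bar>u s\<bar> < e} < 2 * r"
      if u [measurable]: "u \<in> borel_measurable leb01" and u1: "dual_norm \<psi> u \<le> 1"
        and big: "ennreal (1 - \<delta>) < dual_norm \<psi> (\<lambda>t. (x t + u t) / 2)" for u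
    proof -
      have z: "(\<lambda>t. (x t + u t) / 2) \<in> borel_measurable leb01" by measurable
      obtain \<tau> v where arr: "arranged_weight \<omega> \<tau>" and v: "v \<in> borel_measurable leb01" "\<And>s. 0 \<le> v s"
        "(\<integral>\<^sup>+s. ennreal (\<psi> (v s)) \<partial>arranged_weight.P \<omega> \<tau>) \<le> 1"
        "ennreal (1 - \<delta>) < (\<integral>\<^sup>+s. ennreal \<bar>(x s + u s) / 2\<bar> * ennreal (v s) \<partial>arranged_weight.P \<omega> \<tau>)"
        using less_dual_norm_arrange[OF \<psi> z big] by blast
      have \<delta>1: "\<delta> < 1" using \<delta>le(1) by simp
      note * = arranged_weight.near_square_sets[OF arr \<psi> x x1 u u1 v \<delta> \<delta>1 c v0 e c1 c2 c3]
      show "measure leb01 {s \<in> space leb01. c \<le> \<bar>x s\<bar> \<and> e \<le> \<bar>u s\<bar> \<and> x s * u s \<le> 0} < 2 * r"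
        by (rule *(1))
      show "measure leb01 {s \<in> space leb01. c \<le> \<bar>x s\<bar> \<and> \<bar>u s\<bar> < e} < 2 * r"
        by (rule *(2)[OF \<eta> K c4 V c5])
    qed
    have p: "ennreal (1 - \<delta>) < dual_norm \<psi> (\<lambda>t. (x t + y t) / 2)"
      "ennreal (1 - \<delta>) < dual_norm \<psi> (\<lambda>t. (x t + - y t) / 2)"
      using neg by (auto simp: not_le)
    note s1 = sets[OF y y1 p(1)]
    have y': "(\<lambda>t. - y t) \<in> borel_measurable leb01" "dual_norm \<psi> (\<lambda>t. - y t) \<le> 1"
      using y y1 by (auto simp: dual_norm_uminus)
    note s2 = sets[OF y' p(2)]
    let ?A = "{s \<in> space leb01. c \<le> \<bar>x s\<bar> \<and> \<bar>y s\<bar> < e}"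
    let ?B = "{s \<in> space leb01. c \<le> \<bar>x s\<bar> \<and> e \<le> \<bar>y s\<bar> \<and> x s * y s \<le> 0}"
    let ?C = "{s \<in> space leb01. c \<le> \<bar>x s\<bar> \<and> e \<le> \<bar>- y s\<bar> \<and> x s * - y s \<le> 0}"
    have meas: "?A \<in> sets leb01" "?B \<in> sets leb01" "?C \<in> sets leb01" by measurable
    have "measure leb01 {s \<in> space leb01. c \<le> \<bar>x s\<bar>} \<le> measure leb01 (?A \<union> (?B \<union> ?C))"
      using meas by (intro leb01.finite_measure_mono sets.Un) auto
    also have "\<dots> \<le> measure leb01 ?A + measure leb01 (?B \<union> ?C)"
      using meas by (intro measure_Un_le sets.Un)
    also have "measure leb01 (?B \<union> ?C) \<le> measure leb01 ?B + measure leb01 ?C"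
      using meas by (intro measure_Un_le)
    finally have "6 * r < 2 * r + (2 * r + 2 * r)"
      using s1 s2(1) unfolding r_def by linarith
    then show False by simp
  qed
  then show ?thesis using \<delta> \<delta>le(1) by (intro exI[of _ \<delta>]) auto
qed

text \<open>Young's inequality for \<open>c * rearr x t\<close> and \<open>h t\<close>, divided by
  \<open>c\<close>.\<close>

lemma dual_norm_finite:
  assumes \<phi>: "orlicz_function \<phi>" and x: "x \<in> borel_measurable leb01" and c: "0 < c"
    and fin: "(\<integral>\<^sup>+t. ennreal (\<phi> (c * rearr x t)) \<partial>mw) < \<infinity>"
  shows "dual_norm (complementary \<phi>) x < \<infinity>"
proof -
  have [measurable]: "\<phi> \<in> borel_measurable borel" "complementary \<phi> \<in> borel_measurable borel"
    by (rule orlicz_borel[OF \<phi>] orlicz_borel[OF orlicz_complementary[OF \<phi>]])+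
  have meas: "f \<in> borel_measurable mw" if "decreasing01 f" for f
    using decreasing01_leb01[OF that] by (simp add: measurable_cong_sets[OF sets_mw refl])
  note xd = decreasing01_rearr[OF x]
  note [measurable] = meas[OF xd]
  let ?B = "ennreal (1 / c) * ((\<integral>\<^sup>+t. ennreal (\<phi> (c * rearr x t)) \<partial>mw) + 1)"
  have "dual_norm (complementary \<phi>) x \<le> ?B"
    unfolding dual_norm_def
  proof (rule SUP_least)
    fix h assume "h \<in> {h. decreasing01 h \<and> (\<integral>\<^sup>+t. ennreal (complementary \<phi> (h t)) \<partial>mw) \<le> 1}"
    then have h: "decreasing01 h" "(\<integral>\<^sup>+t. ennreal (complementary \<phi> (h t)) \<partial>mw) \<le> 1" by auto
    note [measurable] = meas[OF h(1)]
    have "(\<integral>\<^sup>+t. ennreal (rearr x t) * ennreal (h t) \<partial>mw) \<le>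
        (\<integral>\<^sup>+t. ennreal (1 / c) * (ennreal (\<phi> (c * rearr x t)) + ennreal (complementary \<phi> (h t))) \<partial>mw)"
    proof (rule nn_integral_mono)
      fix t
      have "(c * rearr x t) * h t \<le> \<phi> (c * rearr x t) + complementary \<phi> (h t)"
        using c decreasing01D(1)[OF xd] decreasing01D(1)[OF h(1)] by (intro young[OF \<phi>]) auto
      then have "rearr x t * h t \<le> (1 / c) * (\<phi> (c * rearr x t) + complementary \<phi> (h t))"
        using c by (simp add: field_simps)
      then have "ennreal (rearr x t * h t) \<le> ennreal ((1 / c) * (\<phi> (c * rearr x t) + complementary \<phi> (h t)))"
        by (rule ennreal_leI)
      then show "ennreal (rearr x t) * ennreal (h t) \<le>
          ennreal (1 / c) * (ennreal (\<phi> (c * rearr x t)) + ennreal (complementary \<phi> (h t)))"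
        using c orlicz_nonneg[OF \<phi>] complementary_nonneg[OF \<phi>] decreasing01D(1)[OF xd] decreasing01D(1)[OF h(1)]
        by (simp only: ennreal_mult ennreal_plus add_nonneg_nonneg zero_le_divide_1_iff less_imp_le)
    qed
    also have "\<dots> = ennreal (1 / c) * ((\<integral>\<^sup>+t. ennreal (\<phi> (c * rearr x t)) \<partial>mw) + (\<integral>\<^sup>+t. ennreal (complementary \<phi> (h t)) \<partial>mw))"
      by (subst nn_integral_cmult, measurable) (subst nn_integral_add, measurable)
    also have "\<dots> \<le> ?B" using h(2) by (intro mult_left_mono add_left_mono) auto
    finally show "(\<integral>\<^sup>+t. ennreal (rearr x t) * ennreal (h t) \<partial>mw) \<le> ?B" .
  qed
  also have "?B < \<infinity>" using fin by (simp add: ennreal_mult_less_top)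
  finally show ?thesis .
qed

end

section \<open>Step functions\<close>

context positive_weight begin

lemma decreasing01_mw: "decreasing01 f \<Longrightarrow> f \<in> borel_measurable mw"
  using decreasing01_leb01 by (simp add: measurable_cong_sets[OF sets_mw refl])

lemma AE_mw: "AE t in leb01. Q t \<Longrightarrow> AE t in mw. Q t"
  unfolding mw_def by (subst AE_density) (auto elim: eventually_mono)

text \<open>The functions fed to the norm have this form up to sign; \<open>step01\<close> is the
  truncated version that serves as rearrangement and as test function.\<close>

definition step :: "real \<Rightarrow> real \<Rightarrow> real \<Rightarrow> real \<Rightarrow> real" where
  "step a b e t = (if t < e then a else b)"

definition step01 :: "real \<Rightarrow> real \<Rightarrow> real \<Rightarrow> real \<Rightarrow> real" where
  "step01 a b e t = (if 0 < t \<and> t < 1 then step a b e t else 0)"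

lemma decreasing01_step01: "0 \<le> b \<Longrightarrow> b \<le> a \<Longrightarrow> decreasing01 (step01 a b e)"
  by (auto simp: decreasing01_def step01_def step_def)

lemma step_borel [measurable]: "step a b e \<in> borel_measurable leb01"
  unfolding step_def[abs_def] by (rule borel_imp_leb01) measurable

lemma rearr_step:
  assumes "0 \<le> b" "b \<le> a"
    and x: "x \<in> borel_measurable leb01" "\<And>t. 0 < t \<Longrightarrow> t < 1 \<Longrightarrow> \<bar>x t\<bar> = step a b e t"
  shows "AE t in mw. rearr x t = step01 a b e t"
proof (rule AE_mw, rule AE_rearr_decreasing[OF x(1) decreasing01_step01[OF assms(1,2)]])
  show "AE t in leb01. \<bar>x t\<bar> = step01 a b e t"
    using AE_leb01_pos by eventually_elim (simp add: x(2) step01_def)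
qed

lemma nn_integral_step01:
  fixes F :: "real \<Rightarrow> real"
  shows "(\<integral>\<^sup>+t. ennreal (F (step01 a b e t)) \<partial>mw) = ennreal (F a) * ennreal (M e) + ennreal (F b) * ennreal (W - M e)"
proof -
  have A: "{s \<in> space mw. s < e} \<in> sets mw" by simp
  have "(\<integral>\<^sup>+t. ennreal (F (step01 a b e t)) \<partial>mw) = (\<integral>\<^sup>+t. ennreal (F a) * indicator {s \<in> space mw. s < e} t
      + ennreal (F b) * indicator (space mw - {s \<in> space mw. s < e}) t \<partial>mw)"
  proof (rule nn_integral_cong_AE)
    show "AE t in mw. ennreal (F (step01 a b e t)) = ennreal (F a) * indicator {s \<in> space mw. s < e} t
      + ennreal (F b) * indicator (space mw - {s \<in> space mw. s < e}) t"
      using AE_mw_pos by eventually_elim (auto simp: step01_def step_def indicator_def)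
  qed
  also have "\<dots> = (\<integral>\<^sup>+t. ennreal (F a) * indicator {s \<in> space mw. s < e} t \<partial>mw)
      + (\<integral>\<^sup>+t. ennreal (F b) * indicator (space mw - {s \<in> space mw. s < e}) t \<partial>mw)"
    using A by (intro nn_integral_add borel_measurable_times_ennreal borel_measurable_const borel_measurable_indicator sets.Diff sets.top)
  also have "\<dots> = ennreal (F a) * emeasure mw {s \<in> space mw. s < e} + ennreal (F b) * emeasure mw (space mw - {s \<in> space mw. s < e})"
    using A by (intro arg_cong2[where f="(+)"] nn_integral_cmult_indicator sets.Diff sets.top)
  also have "\<dots> = ennreal (F a) * ennreal (M e) + ennreal (F b) * ennreal (W - M e)"
    unfolding mw.emeasure_eq_measure mw.finite_measure_compl[OF A] M_eq W_def ..
  finally show ?thesis .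
qed

lemma M_le_W: "M t \<le> W" unfolding M_eq W_def by (rule mw.bounded_measure)

lemma M_0: "M 0 = 0" proof -
  have "{s \<in> space mw. s < 0} = {}" by auto
  then show ?thesis unfolding M_eq by (simp only: measure_empty)
qed

lemma M_nonneg: "0 \<le> M t" by (simp add: M_eq)

text \<open>By uniform distribution the set \<open>{M < q}\<close> has mass exactly
  \<open>q\<close>. It is an initial segment, hence agrees with the points below its supremum
  \<open>e\<close> except possibly at the null point \<open>e\<close>.\<close>

lemma M_surj:
  assumes "0 < q" "q < W" obtains e where "0 < e" "e < 1" "M e = q"
proof -
  define S where "S = {s \<in> space mw. M s < q}"
  have S: "measure mw S = q" using ord.rank_less_eq[of q] assms by (simp add: W_def S_def)
  then have ne: "S \<noteq> {}" using assms by auto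
  have bdd: "bdd_above S" by (rule bdd_aboveI[of _ 1]) (auto simp: S_def)
  define e where "e = Sup S"
  have Me: "M e = q"
  proof (rule antisym)
    have "{s \<in> space mw. s < e} \<subseteq> S"
    proof
      fix s assume s: "s \<in> {s \<in> space mw. s < e}"
      then obtain s' where "s' \<in> S" "s < s'" unfolding e_def using less_cSup_iff[OF ne bdd] by auto
      then show "s \<in> S" using s M_mono[of s s'] by (auto simp: S_def)
    qed
    then show "M e \<le> q"
      unfolding M_eq S[symmetric] by (rule mw.finite_measure_mono) (auto simp: S_def intro: ord.rank_sets[simplified])
    have null: "{s \<in> space mw. s = e} \<in> null_sets mw"
    proof (cases "e \<in> space mw")
      case True
      then have "{s \<in> space mw. s = e} = {e}" by auto
      then show ?thesis using ord.points_null[OF True] by (simp only:)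
    next
      case False
      then have "{s \<in> space mw. s = e} = {}" by auto
      then show ?thesis by (simp only: null_sets.empty_sets)
    qed
    have "q \<le> measure mw ({s \<in> space mw. s < e} \<union> {s \<in> space mw. s = e})"
      unfolding S[symmetric]
    proof (rule mw.finite_measure_mono)
      show "S \<subseteq> {s \<in> space mw. s < e} \<union> {s \<in> space mw. s = e}"
        using cSup_upper[OF _ bdd] by (force simp: e_def S_def)
      show "{s \<in> space mw. s < e} \<union> {s \<in> space mw. s = e} \<in> sets mw"
        using null by (intro sets.Un) auto
    qed
    also have "\<dots> = M e"
      unfolding M_eq using null by (intro measure_Un_null_set) auto
    finally show "q \<le> M e" .
  qed
  have "0 < e" using M_mono[of e 0] M_0 Me assms(1) by (cases "0 < e") auto
  moreover have "e < 1" using M_one[of e] Me assms(2) by (cases "e < 1") auto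
  ultimately show thesis using Me that by auto
qed

text \<open>Jensen's inequality on the initial interval: a test function of modular at most
  \<open>1\<close> has mean at most \<open>v\<close> there, where \<open>v\<close> is the constant
  of modular \<open>1\<close>. The supporting line of \<psi> at \<open>v\<close> gives this upon
  integration.\<close>

lemma dual_norm_step_le:
  assumes \<psi>: "orlicz_function \<psi>" and a: "0 \<le> a" and v: "0 < v" "\<psi> v * M e = 1"
  shows "dual_norm \<psi> (step a 0 e) \<le> ennreal (a * (v * M e))"
  unfolding dual_norm_def
proof (rule SUP_least)
  fix h assume "h \<in> {h. decreasing01 h \<and> (\<integral>\<^sup>+t. ennreal (\<psi> (h t)) \<partial>mw) \<le> 1}"
  then have h: "decreasing01 h" "(\<integral>\<^sup>+t. ennreal (\<psi> (h t)) \<partial>mw) \<le> 1" by auto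
  have h0: "0 \<le> h t" for t by (rule decreasing01D(1)[OF h(1)])
  have [measurable]: "h \<in> borel_measurable mw" by (rule decreasing01_mw[OF h(1)])
  have [measurable]: "\<psi> \<in> borel_measurable borel" by (rule orlicz_borel[OF \<psi>])
  define E where "E = {s \<in> space mw. s < e}"
  have E [measurable]: "E \<in> sets mw" by (simp add: E_def)
  have E': "E \<in> sets leb01" using E by simp
  have emE: "emeasure mw E = ennreal (M e)" by (simp add: E_def M_eq mw.emeasure_eq_measure)
  obtain p where p: "0 < p" "\<And>u. \<psi> v + p * (u - v) \<le> \<psi> u" using orlicz_support[OF \<psi> v(1)] by auto
  define I where "I = (\<integral>\<^sup>+t. ennreal (h t) * indicator E t \<partial>mw)"
  have ME: "ennreal (\<psi> v) * ennreal (M e) = 1"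
    using v(2) orlicz_nonneg[OF \<psi>, of v] by (simp add: ennreal_mult[symmetric] M_nonneg)
  \<comment> \<open>The term with \<open>p * v\<close> goes to the other side, since
    \<open>ennreal\<close> has no faithful subtraction.\<close>
  have "1 + ennreal p * I = (\<integral>\<^sup>+t. ennreal (\<psi> v) * indicator E t + ennreal p * (ennreal (h t) * indicator E t) \<partial>mw)"
    unfolding I_def by (simp add: nn_integral_add nn_integral_cmult E' emE ME)
  also have "\<dots> \<le> (\<integral>\<^sup>+t. ennreal (\<psi> (h t)) + ennreal (p * v) * indicator E t \<partial>mw)"
  proof (rule nn_integral_mono)
    fix t
    have "\<psi> v + p * h t \<le> \<psi> (h t) + p * v" using p(2)[of "h t"] by (simp add: algebra_simps)
    then have "ennreal (\<psi> v + p * h t) \<le> ennreal (\<psi> (h t) + p * v)" by (rule ennreal_leI)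
    then have "ennreal (\<psi> v) + ennreal p * ennreal (h t) \<le> ennreal (\<psi> (h t)) + ennreal (p * v)"
      using p(1) v(1) h0[of t] orlicz_nonneg[OF \<psi>] by (simp add: ennreal_mult[symmetric] flip: ennreal_plus)
    then show "ennreal (\<psi> v) * indicator E t + ennreal p * (ennreal (h t) * indicator E t) \<le>
        ennreal (\<psi> (h t)) + ennreal (p * v) * indicator E t"
      by (auto split: split_indicator)
  qed
  also have "\<dots> = (\<integral>\<^sup>+t. ennreal (\<psi> (h t)) \<partial>mw) + ennreal (p * v) * ennreal (M e)"
    by (simp add: nn_integral_add nn_integral_cmult E' emE)
  also have "\<dots> \<le> 1 + ennreal (p * v) * ennreal (M e)" using h(2) by (rule add_right_mono)
  also have "\<dots> = 1 + ennreal p * ennreal (v * M e)"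
    using p(1) v(1) by (simp add: ennreal_mult M_nonneg mult.assoc)
  finally have "ennreal p * I \<le> ennreal p * ennreal (v * M e)"
    by (simp add: ennreal_add_left_cancel_le)
  then have "I \<le> ennreal (v * M e)"
    using p(1) by (subst (asm) ennreal_mult_le_mult_iff) auto
  have "(\<integral>\<^sup>+t. ennreal (rearr (step a 0 e) t) * ennreal (h t) \<partial>mw) = (\<integral>\<^sup>+t. ennreal a * (ennreal (h t) * indicator E t) \<partial>mw)"
  proof (rule nn_integral_cong_AE)
    have "\<bar>step a 0 e t\<bar> = step a 0 e t" for t using a by (simp add: step_def)
    then have "AE t in mw. rearr (step a 0 e) t = step01 a 0 e t" by (intro rearr_step) (use a in auto)
    then show "AE t in mw. ennreal (rearr (step a 0 e) t) * ennreal (h t) = ennreal a * (ennreal (h t) * indicator E t)"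
      using AE_mw_pos by eventually_elim (auto simp: step01_def step_def E_def)
  qed
  also have "\<dots> = ennreal a * I" unfolding I_def by (rule nn_integral_cmult) measurable
  also have "\<dots> \<le> ennreal a * ennreal (v * M e)" using \<open>I \<le> _\<close> by (rule mult_left_mono) simp
  also have "\<dots> = ennreal (a * (v * M e))" using a v(1) by (simp add: ennreal_mult M_nonneg)
  finally show "(\<integral>\<^sup>+t. ennreal (rearr (step a 0 e) t) * ennreal (h t) \<partial>mw) \<le> ennreal (a * (v * M e))" .
qed

lemma ennreal_mult_add:
  "0 \<le> a \<Longrightarrow> 0 \<le> b \<Longrightarrow> 0 \<le> c \<Longrightarrow> 0 \<le> d \<Longrightarrow>
    ennreal a * ennreal b + ennreal c * ennreal d = ennreal (a * b + c * d)"
  by (simp add: ennreal_mult)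

text \<open>The test function is \<open>step01 u w e\<close>, with its jump at the same place. Only
  the modulus of \<open>x\<close> is prescribed, so that a half difference with changing sign is
  covered.\<close>

lemma dual_norm_step_ge:
  assumes \<psi>: "orlicz_function \<psi>" and ab: "0 \<le> b" "b \<le> a" and uw: "0 \<le> w" "w \<le> u"
    and adm: "\<psi> u * M e + \<psi> w * (W - M e) \<le> 1"
    and x: "x \<in> borel_measurable leb01" "\<And>t. 0 < t \<Longrightarrow> t < 1 \<Longrightarrow> \<bar>x t\<bar> = step a b e t"
  shows "ennreal (a * u * M e + b * w * (W - M e)) \<le> dual_norm \<psi> x"
proof -
  have WM: "0 \<le> W - M e" using M_le_W[of e] by simp
  have "(\<integral>\<^sup>+t. ennreal (\<psi> (step01 u w e t)) \<partial>mw) = ennreal (\<psi> u * M e + \<psi> w * (W - M e))"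
    unfolding nn_integral_step01 using orlicz_nonneg[OF \<psi>] WM by (intro ennreal_mult_add M_nonneg)
  also have "\<dots> \<le> 1" using adm by (simp add: ennreal_le_1)
  finally have "(\<integral>\<^sup>+t. ennreal (rearr x t) * ennreal (step01 u w e t) \<partial>mw) \<le> dual_norm \<psi> x"
    unfolding dual_norm_def using decreasing01_step01[OF uw] by (intro SUP_upper) auto
  moreover have "(\<integral>\<^sup>+t. ennreal (rearr x t) * ennreal (step01 u w e t) \<partial>mw) = (\<integral>\<^sup>+t. ennreal ((\<lambda>r. r) (step01 (a * u) (b * w) e t)) \<partial>mw)"
  proof (rule nn_integral_cong_AE)
    have "AE t in mw. rearr x t = step01 a b e t" by (rule rearr_step[OF ab x])
    then show "AE t in mw. ennreal (rearr x t) * ennreal (step01 u w e t) = ennreal ((\<lambda>r. r) (step01 (a * u) (b * w) e t))"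
    proof eventually_elim
      case (elim t)
      then show ?case
        using ab uw by (auto simp: step01_def step_def ennreal_mult)
    qed
  qed
  moreover have "\<dots> = ennreal (a * u * M e + b * w * (W - M e))"
    using ab uw WM by (subst nn_integral_step01[of "\<lambda>r. r"], intro ennreal_mult_add M_nonneg) auto
  ultimately show ?thesis by simp
qed

text \<open>The order of quantifiers matters: a single \<open>step c 0 1\<close>, which is
  constantly \<open>c\<close> on \<open>[0,1)\<close>, must work for all \<delta>, while the height
  \<open>a\<close> and the length \<open>e\<close> of the spike vary with \<delta>.\<close>

lemma square_of_not_Delta2:
  assumes \<psi>: "orlicz_function \<psi>" and \<Delta>: "\<not> Delta2_infinity \<psi>"
  obtains c where "0 < c" "dual_norm \<psi> (step c 0 1) = 1"
    "\<And>\<delta>. 0 < \<delta> \<Longrightarrow> \<delta> < 1 \<Longrightarrow> \<exists>a e. 0 \<le> a \<and> dual_norm \<psi> (step a 0 e) \<le> 1 \<and>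
      ennreal (1 - \<delta>) < dual_norm \<psi> (\<lambda>t. (step c 0 1 t - step a 0 e t) / 2) \<and>
      ennreal (1 - \<delta>) < dual_norm \<psi> (\<lambda>t. (step c 0 1 t + step a 0 e t) / 2)"
proof -
  \<comment> \<open>\<open>v1\<close> is the constant density of modular \<open>1\<close>;
    \<open>c\<close> is scaled so that its pairing with \<open>v1\<close> is
    \<open>1\<close>.\<close>
  obtain v1 where v1: "0 \<le> v1" "\<psi> v1 = 1 / W" using orlicz_surj[OF \<psi>, of "1 / W"] W_pos by auto
  have v1p: "0 < v1" using v1 orlicz_zero[OF \<psi>] W_pos by (cases "v1 = 0") auto
  have \<psi>v1: "\<psi> v1 * W = 1" using v1 W_pos by simp
  define c where "c = 1 / (W * v1)"
  have c: "0 < c" using W_pos v1p by (simp add: c_def)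
  have cvW: "c * (v1 * W) = 1" using W_pos v1p by (simp add: c_def)
  have M1: "M 1 = W" by (rule M_one) simp
  have "dual_norm \<psi> (step c 0 1) = 1"
  proof (rule antisym)
    show "dual_norm \<psi> (step c 0 1) \<le> 1"
      using dual_norm_step_le[OF \<psi>, of c v1 1] c v1p \<psi>v1 cvW by (simp add: M1)
    show "1 \<le> dual_norm \<psi> (step c 0 1)"
      using dual_norm_step_ge[OF \<psi>, of 0 c 0 v1 1 "step c 0 1"] c v1p \<psi>v1 cvW
      by (simp add: M1 mult.assoc) (simp add: step_def)
  qed
  moreover have "\<exists>a e. 0 \<le> a \<and> dual_norm \<psi> (step a 0 e) \<le> 1 \<and>
      ennreal (1 - \<delta>) < dual_norm \<psi> (\<lambda>t. (step c 0 1 t - step a 0 e t) / 2) \<and>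
      ennreal (1 - \<delta>) < dual_norm \<psi> (\<lambda>t. (step c 0 1 t + step a 0 e t) / 2)"
    if \<delta>: "0 < \<delta>" "\<delta> < 1" for \<delta>
  proof -
    define \<epsilon> where "\<epsilon> = \<delta> / 4"
    have \<epsilon>: "0 < \<epsilon>" "\<epsilon> < 1 / 4" using \<delta> by (auto simp: \<epsilon>_def)
    \<comment> \<open>Beyond \<open>V\<close> the growth of \<psi> forces
      \<open>c * v * q \<le> \<epsilon>\<close>, so the constant function hardly pairs with the
      density over the short interval.\<close>
    obtain V where V: "0 < V" "\<And>v. V \<le> v \<Longrightarrow> (c / \<epsilon>) * v \<le> \<psi> v"
      using orlicz_superlinear[OF \<psi>, of "c / \<epsilon>"] by auto
    \<comment> \<open>Lowering \<open>(1 + \<epsilon>) * v\<close> to \<open>v\<close> costs only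
      the factor \<open>1 + \<epsilon>\<close> in the pairing with the spike but drops the modular
      from \<open>1\<close> to less than \<epsilon>. Taking \<open>v \<ge> v1\<close> later keeps
      the combined density decreasing and makes \<open>q / W\<close> small.\<close>
    obtain v where vV: "max V v1 \<le> v" and v\<psi>: "\<psi> v < \<epsilon> * \<psi> ((1 + \<epsilon>) * v)"
      using not_Delta2_witness[OF \<psi> \<Delta> \<epsilon>(1)] by blast
    have v: "0 < v" "V \<le> v" "v1 \<le> v" using vV V(1) by auto
    define v' where "v' = (1 + \<epsilon>) * v"
    have v': "0 < v'" "v \<le> v'" using v \<epsilon> by (auto simp: v'_def)
    \<comment> \<open>The mass of the interval on which the constant \<open>v'\<close> has modular
      exactly \<open>1\<close>.\<close>
    define q where "q = 1 / \<psi> v'"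
    have \<psi>v': "0 < \<psi> v'" by (rule orlicz_pos[OF \<psi> v'(1)])
    have q: "0 < q" "\<psi> v' * q = 1" using \<psi>v' by (auto simp: q_def)
    have "\<psi> v \<le> \<psi> v'" using v v' by (intro orlicz_mono[OF \<psi>]) auto
    then have "(c / \<epsilon>) * v * q \<le> \<psi> v' * q" using V(2)[OF v(2)] q(1) by (intro mult_right_mono) auto
    then have cvq: "c * v * q \<le> \<epsilon>" using q(2) \<epsilon>(1) by (simp add: field_simps)
    have "c * v1 * q \<le> c * v * q" using c q(1) v(3) by (intro mult_right_mono mult_left_mono) auto
    then have "c * v1 * q \<le> \<epsilon>" using cvq by simp
    moreover have cv1: "c * v1 = 1 / W" using v1p by (simp add: c_def)
    ultimately have qW: "q / W \<le> \<epsilon>" by simp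
    have "q < W"
    proof -
      have "q / W < 1" using qW \<epsilon> by simp
      then show ?thesis using W_pos by (simp add: field_simps)
    qed
    then obtain e where e: "0 < e" "e < 1" "M e = q" using M_surj[OF q(1)] by blast
    define a where "a = 1 / (q * v')"
    have a: "0 < a" using q v' by (simp add: a_def)
    have avq: "a * (v' * q) = 1" using q v' by (simp add: a_def)
    have y: "dual_norm \<psi> (step a 0 e) \<le> 1"
      using dual_norm_step_le[OF \<psi>, of a v' e] a v' q avq e by simp
    have v'2: "v' \<le> 2 * v" using v(1) \<epsilon> by (simp add: v'_def)
    \<comment> \<open>The outcome \<open>2 * c \<le> a\<close> gives
      \<open>(a - c) / 2 \<ge> c / 2\<close>, so the moduli of both half sums are decreasing step
      functions.\<close>
    have "2 * c * (v' * q) \<le> 4 * (c * v * q)"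
      using mult_left_mono[OF v'2, of "2 * c * q"] c q by (simp add: ac_simps)
    also have "\<dots> \<le> 1" using cvq \<epsilon> by simp
    also have "1 = a * (v' * q)" by (rule avq[symmetric])
    finally have ac: "2 * c \<le> a" using v' q by simp
    \<comment> \<open>Shrinking \<open>v1\<close> by \<open>1 - \<epsilon>\<close> leaves modular
      \<epsilon> for the value \<open>v\<close> on the short interval.\<close>
    define w where "w = (1 - \<epsilon>) * v1"
    have w: "0 \<le> w" "w \<le> v"
    proof -
      show "0 \<le> w" using \<epsilon> v1p by (simp add: w_def)
      have "(1 - \<epsilon>) * v1 \<le> 1 * v1" using \<epsilon> v1p by (intro mult_right_mono) auto
      then show "w \<le> v" using v(3) by (simp add: w_def)
    qed
    have adm: "\<psi> v * M e + \<psi> w * (W - M e) \<le> 1"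
    proof -
      have "\<psi> v * q \<le> \<epsilon> * \<psi> v' * q" using v\<psi> q(1) by (intro mult_right_mono) (auto simp: v'_def)
      then have 1: "\<psi> v * q \<le> \<epsilon>" using q(2) by (simp add: mult.assoc)
      have "\<psi> w \<le> (1 - \<epsilon>) * \<psi> v1" unfolding w_def using \<epsilon> by (intro orlicz_scale[OF \<psi>]) auto
      then have "\<psi> w * (W - q) \<le> ((1 - \<epsilon>) * \<psi> v1) * W"
        using \<open>q < W\<close> q(1) \<epsilon> orlicz_nonneg[OF \<psi>, of v1] by (intro mult_mono) auto
      also have "\<dots> = 1 - \<epsilon>" using \<psi>v1 by (simp add: mult.assoc)
      finally show ?thesis using 1 by (simp add: e(3))
    qed
    \<comment> \<open>One density serves both signs. Half of
      \<open>a * v * q \<ge> 1 - \<epsilon>\<close>, less half of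
      \<open>c * v * q \<le> \<epsilon>\<close>, plus half of
      \<open>c * w * (W - q) \<ge> 1 - 2 * \<epsilon>\<close> is at least
      \<open>1 - 2 * \<epsilon> = 1 - \<delta> / 2\<close>.\<close>
    have key: "1 - \<delta> < p * v * M e + c / 2 * w * (W - M e)" if p: "(a - c) / 2 \<le> p" for p
    proof -
      have "(1 - \<epsilon>) * (1 + \<epsilon>) \<le> 1" using \<epsilon> by (simp add: algebra_simps)
      also have "1 = (a * v * q) * (1 + \<epsilon>)" using avq by (simp add: v'_def ac_simps)
      finally have "(1 - \<epsilon>) * (1 + \<epsilon>) \<le> (a * v * q) * (1 + \<epsilon>)" .
      then have avq': "1 - \<epsilon> \<le> a * v * q" using \<epsilon> by simp
      have "c * w * (W - q) = (1 - \<epsilon>) * (c * v1 * (W - q))" by (simp add: w_def)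
      also have "c * v1 * (W - q) = 1 - q / W" unfolding cv1 using W_pos by (simp add: field_simps)
      finally have cw: "c * w * (W - q) = (1 - \<epsilon>) * (1 - q / W)" .
      have "(1 - \<epsilon>) * (1 - \<epsilon>) \<le> (1 - \<epsilon>) * (1 - q / W)" using \<epsilon> qW by (intro mult_left_mono) auto
      moreover have "1 - 2 * \<epsilon> \<le> (1 - \<epsilon>) * (1 - \<epsilon>)" by (simp add: algebra_simps)
      ultimately have cw': "1 - 2 * \<epsilon> \<le> c * w * (W - q)" using cw by simp
      have "(a - c) / 2 * (v * q) \<le> p * (v * q)" using p v(1) q(1) by (intro mult_right_mono) auto
      then have "(a * v * q - c * v * q) / 2 \<le> p * v * q" by (simp add: algebra_simps diff_divide_distrib)
      moreover have "c / 2 * w * (W - q) = c * w * (W - q) / 2" by simp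
      ultimately show ?thesis
        unfolding e(3) using avq' cvq cw' \<epsilon> \<delta> by (simp add: \<epsilon>_def field_simps)
    qed
    have large: "ennreal (1 - \<delta>) < dual_norm \<psi> z"
      if z: "z \<in> borel_measurable leb01" and p: "(a - c) / 2 \<le> p"
        "\<And>t. 0 < t \<Longrightarrow> t < 1 \<Longrightarrow> \<bar>z t\<bar> = step p (c / 2) e t" for z p
    proof -
      have "ennreal (1 - \<delta>) < ennreal (p * v * M e + c / 2 * w * (W - M e))"
        using key[OF p(1)] \<delta> by (simp add: ennreal_less_iff)
      also have "\<dots> \<le> dual_norm \<psi> z"
        using c ac p(1) w adm by (intro dual_norm_step_ge[OF \<psi> _ _ _ _ _ z p(2)]) auto
      finally show ?thesis .
    qed
    have "ennreal (1 - \<delta>) < dual_norm \<psi> (\<lambda>t. (step c 0 1 t - step a 0 e t) / 2)"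
      by (rule large[of _ "(a - c) / 2"], measurable) (use ac c in \<open>auto simp: step_def\<close>)
    moreover have "ennreal (1 - \<delta>) < dual_norm \<psi> (\<lambda>t. (step c 0 1 t + step a 0 e t) / 2)"
      by (rule large[of _ "(a + c) / 2"], measurable) (use ac c in \<open>auto simp: step_def\<close>)
    ultimately show ?thesis using y a by (intro exI[of _ a] exI[of _ e]) auto
  qed
  ultimately show thesis using that c by blast
qed

end

text \<open>The value of the weight at the null point \<open>0\<close> is arbitrary and must be removed.\<close>

definition open_part :: "(real \<Rightarrow> real) \<Rightarrow> real \<Rightarrow> real" where
  "open_part \<omega> t = (if 0 < t \<and> t < 1 then \<omega> t else 0)"

text \<open>Points of positive weight occur arbitrarily close to \<open>1\<close>, and monotonicity
  spreads positivity to their left. Mass is finite since \<omega> is integrable up to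
  \<open>1/2\<close> and at most \<open>\<omega> (1/2)\<close> afterwards.\<close>

lemma positive_weight_open_part:
  assumes \<omega>: "weight_function \<omega>" and we: "weight_end \<omega> = 1"
  shows "positive_weight (open_part \<omega>)"
proof
  have nonneg: "0 \<le> \<omega> t" if "0 \<le> t" "t < 1" for t using \<omega> that by (auto simp: weight_function_def)
  have anti: "\<omega> t \<le> \<omega> s" if "0 < s" "s \<le> t" "t < 1" for s t
    using \<omega> that by (auto simp: weight_function_def monotone_on_def)
  show dec: "decreasing01 (open_part \<omega>)"
    using nonneg anti by (auto simp: decreasing01_def open_part_def)
  show "0 < open_part \<omega> t" if t: "0 < t" "t < 1" for t
  proof -
    have "ereal t < weight_end \<omega>" using t we by (simp add: one_ereal_def)
    then obtain s where "t < s" "s < 1" "0 < \<omega> s"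
      by (auto simp: weight_end_def less_SUP_iff)
    then show ?thesis using anti[of t s] t by (simp add: open_part_def)
  qed
  have [measurable]: "open_part \<omega> \<in> borel_measurable borel" by (rule decreasing01_borel[OF dec])
  have "set_integrable lebesgue {0..1/2} \<omega>" using \<omega> by (auto simp: weight_function_def)
  then have int: "(\<integral>\<^sup>+t. ennreal (norm (indicator {0..1/2} t *\<^sub>R \<omega> t)) \<partial>lebesgue) < \<infinity>"
    unfolding set_integrable_def integrable_iff_bounded by blast
  have m: "(\<lambda>t. ennreal (norm (indicator {0..1/2} t *\<^sub>R \<omega> t))) \<in> borel_measurable lebesgue"
  proof -
    have [measurable]: "(\<lambda>t. indicator {0..1/2} t *\<^sub>R \<omega> t) \<in> borel_measurable lebesgue"
      using borel_measurable_integrable[OF \<open>set_integrable lebesgue {0..1/2} \<omega>\<close>[unfolded set_integrable_def]] .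
    show ?thesis by measurable
  qed
  have "(\<integral>\<^sup>+t. ennreal (open_part \<omega> t) \<partial>leb01) \<le>
      (\<integral>\<^sup>+t. ennreal (norm (indicator {0..1/2} t *\<^sub>R \<omega> t)) + ennreal (\<omega> (1/2)) \<partial>leb01)"
  proof (rule nn_integral_mono)
    fix t assume "t \<in> space leb01"
    show "ennreal (open_part \<omega> t) \<le> ennreal (norm (indicator {0..1/2} t *\<^sub>R \<omega> t)) + ennreal (\<omega> (1/2))"
    proof (cases "0 < t \<and> t \<le> 1/2")
      case True
      then show ?thesis by (auto simp: open_part_def intro!: add_increasing2 ennreal_leI)
    next
      case False
      then have "open_part \<omega> t \<le> \<omega> (1/2)" using anti[of "1/2" t] nonneg[of "1/2"] by (auto simp: open_part_def)
      then show ?thesis by (intro add_increasing ennreal_leI) auto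
    qed
  qed
  also have "\<dots> = (\<integral>\<^sup>+t. ennreal (norm (indicator {0..1/2} t *\<^sub>R \<omega> t)) \<partial>leb01) + ennreal (\<omega> (1/2)) * emeasure leb01 (space leb01)"
    by (subst nn_integral_add) (use m in \<open>auto intro: measurable_restrict_space1\<close>)
  also have "\<dots> \<le> (\<integral>\<^sup>+t. ennreal (norm (indicator {0..1/2} t *\<^sub>R \<omega> t)) \<partial>lebesgue) + ennreal (\<omega> (1/2)) * 1"
  proof (intro add_mono mult_left_mono)
    show "(\<integral>\<^sup>+t. ennreal (norm (indicator {0..1/2} t *\<^sub>R \<omega> t)) \<partial>leb01) \<le>
        (\<integral>\<^sup>+t. ennreal (norm (indicator {0..1/2} t *\<^sub>R \<omega> t)) \<partial>lebesgue)"
      by (subst nn_integral_restrict_space, simp) (intro nn_integral_mono, auto split: split_indicator)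
  qed (auto simp: emeasure_restrict_space)
  also have "\<dots> < \<infinity>" using int by simp
  finally show "(\<integral>\<^sup>+t. ennreal (open_part \<omega> t) \<partial>leb01) < \<infinity>" .
qed

section \<open>Translation of the modular and the Orlicz norm to the truncated weight\<close>

context
  fixes \<omega> :: "real \<Rightarrow> real" and \<psi> :: "real \<Rightarrow> real"
  assumes weight: "weight_function \<omega>" "weight_end \<omega> = 1" and orl: "orlicz_function \<psi>"
begin

interpretation w: positive_weight "open_part \<omega>"
  using weight by (rule positive_weight_open_part)

lemma modular_eq:
  assumes y: "y \<in> borel_measurable leb01"
  shows "modular \<psi> \<omega> y = (\<integral>\<^sup>+t. ennreal (\<psi> (rearr y t)) \<partial>w.mw)"
proof -
  have [measurable]: "rearr y \<in> borel_measurable leb01" "\<psi> \<in> borel_measurable borel"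
    by (rule decreasing01_leb01[OF decreasing01_rearr[OF y]] orlicz_borel[OF orl])+
  have "(\<integral>\<^sup>+t. ennreal (\<psi> (rearr y t)) \<partial>w.mw) = (\<integral>\<^sup>+t. ennreal (open_part \<omega> t) * ennreal (\<psi> (rearr y t)) \<partial>leb01)"
    by (rule w.nn_integral_mw) measurable
  also have "\<dots> = modular \<psi> \<omega> y"
    unfolding modular_def
  proof (rule nn_integral_cong_AE)
    show "AE t in leb01. ennreal (open_part \<omega> t) * ennreal (\<psi> (rearr y t)) = ennreal (\<psi> (rearrangement y t) * \<omega> t)"
      using AE_leb01_pos
    proof eventually_elim
      case (elim t)
      then have "0 \<le> \<omega> t" using weight by (auto simp: weight_function_def)
      then show ?case using elim orlicz_nonneg[OF orl]
        by (simp add: open_part_def rearr_def ennreal_mult mult.commute)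
    qed
  qed
  finally show ?thesis ..
qed

lemma pairing_eq:
  assumes x: "x \<in> borel_measurable leb01" and y: "y \<in> borel_measurable leb01"
  shows "(\<integral>\<^sup>+t. ennreal (rearrangement x t * rearrangement y t * \<omega> t) \<partial>leb01) =
    (\<integral>\<^sup>+t. ennreal (rearr x t) * ennreal (rearr y t) \<partial>w.mw)"
proof -
  have [measurable]: "rearr x \<in> borel_measurable leb01" "rearr y \<in> borel_measurable leb01"
    by (rule decreasing01_leb01[OF decreasing01_rearr[OF x]] decreasing01_leb01[OF decreasing01_rearr[OF y]])+
  have "(\<integral>\<^sup>+t. ennreal (rearr x t) * ennreal (rearr y t) \<partial>w.mw) =
      (\<integral>\<^sup>+t. ennreal (open_part \<omega> t) * (ennreal (rearr x t) * ennreal (rearr y t)) \<partial>leb01)"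
    by (rule w.nn_integral_mw) measurable
  also have "\<dots> = (\<integral>\<^sup>+t. ennreal (rearrangement x t * rearrangement y t * \<omega> t) \<partial>leb01)"
  proof (rule nn_integral_cong_AE)
    show "AE t in leb01. ennreal (open_part \<omega> t) * (ennreal (rearr x t) * ennreal (rearr y t)) =
        ennreal (rearrangement x t * rearrangement y t * \<omega> t)"
      using AE_leb01_pos
    proof eventually_elim
      case (elim t)
      then have "0 \<le> \<omega> t" using weight by (auto simp: weight_function_def)
      then show ?case using elim rearrangement_nonneg[OF x, of t] rearrangement_nonneg[OF y, of t]
        by (simp add: open_part_def rearr_def ennreal_mult[symmetric] ac_simps)
    qed
  qed
  finally show ?thesis ..
qed

text \<open>The rearrangement of an admissible \<open>y\<close> is a decreasing test function, and
  conversely a decreasing test function equals its own rearrangement almost everywhere.\<close>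

lemma dual_norm_eq_SUP:
  assumes x: "x \<in> borel_measurable leb01"
  shows "(SUP y\<in>{y \<in> borel_measurable leb01. modular \<psi> \<omega> y \<le> 1}.
       \<integral>\<^sup>+ t. ennreal (rearrangement x t * rearrangement y t * \<omega> t) \<partial>leb01) = w.dual_norm \<psi> x"
proof (rule antisym)
  show "(SUP y\<in>{y \<in> borel_measurable leb01. modular \<psi> \<omega> y \<le> 1}.
       \<integral>\<^sup>+ t. ennreal (rearrangement x t * rearrangement y t * \<omega> t) \<partial>leb01) \<le> w.dual_norm \<psi> x"
  proof (rule SUP_least)
    fix y assume "y \<in> {y \<in> borel_measurable leb01. modular \<psi> \<omega> y \<le> 1}"
    then have y: "y \<in> borel_measurable leb01" "modular \<psi> \<omega> y \<le> 1" by auto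
    show "(\<integral>\<^sup>+ t. ennreal (rearrangement x t * rearrangement y t * \<omega> t) \<partial>leb01) \<le> w.dual_norm \<psi> x"
      unfolding pairing_eq[OF x y(1)] w.dual_norm_def
      using y(2) decreasing01_rearr[OF y(1)] by (intro SUP_upper) (simp add: modular_eq[OF y(1)])
  qed
  show "w.dual_norm \<psi> x \<le> (SUP y\<in>{y \<in> borel_measurable leb01. modular \<psi> \<omega> y \<le> 1}.
       \<integral>\<^sup>+ t. ennreal (rearrangement x t * rearrangement y t * \<omega> t) \<partial>leb01)"
    unfolding w.dual_norm_def
  proof (rule SUP_least)
    fix h assume "h \<in> {h. decreasing01 h \<and> (\<integral>\<^sup>+t. ennreal (\<psi> (h t)) \<partial>w.mw) \<le> 1}"
    then have h: "decreasing01 h" "(\<integral>\<^sup>+t. ennreal (\<psi> (h t)) \<partial>w.mw) \<le> 1" by auto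
    have hm: "h \<in> borel_measurable leb01" by (rule decreasing01_leb01[OF h(1)])
    have "AE t in leb01. rearr h t = h t"
      by (rule AE_rearr_decreasing[OF hm h(1)]) (simp add: decreasing01D(1)[OF h(1)])
    then have ae: "AE t in w.mw. rearr h t = h t" by (rule w.AE_mw)
    have "modular \<psi> \<omega> h = (\<integral>\<^sup>+t. ennreal (\<psi> (h t)) \<partial>w.mw)"
      unfolding modular_eq[OF hm] by (rule nn_integral_cong_AE) (use ae in \<open>auto elim: eventually_mono\<close>)
    then have mod: "modular \<psi> \<omega> h \<le> 1" using h(2) by simp
    have "(\<integral>\<^sup>+t. ennreal (rearr x t) * ennreal (h t) \<partial>w.mw) = (\<integral>\<^sup>+t. ennreal (rearr x t) * ennreal (rearr h t) \<partial>w.mw)"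
      by (rule nn_integral_cong_AE) (use ae in \<open>auto elim: eventually_mono\<close>)
    also have "\<dots> = (\<integral>\<^sup>+ t. ennreal (rearrangement x t * rearrangement h t * \<omega> t) \<partial>leb01)"
      by (rule pairing_eq[OF x hm, symmetric])
    also have "\<dots> \<le> (SUP y\<in>{y \<in> borel_measurable leb01. modular \<psi> \<omega> y \<le> 1}.
       \<integral>\<^sup>+ t. ennreal (rearrangement x t * rearrangement y t * \<omega> t) \<partial>leb01)"
      using hm mod by (intro SUP_upper) auto
    finally show "(\<integral>\<^sup>+t. ennreal (rearr x t) * ennreal (h t) \<partial>w.mw) \<le> \<dots>" .
  qed
qed

end

theorem theorem4p2:
  fixes \<phi> \<psi> \<omega> :: "real \<Rightarrow> real"
  assumes "orlicz_function \<phi>"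
    and "\<psi> = complementary \<phi>"
    and "weight_function \<omega>"
    and "weight_end \<omega> = 1"
  shows "locally_uniformly_non_square (orlicz_lorentz_space \<phi> \<omega>) (orlicz_norm \<phi> \<omega>)
    \<longleftrightarrow> Delta2_infinity \<psi>"
proof -
  note \<phi> = assms(1)
  have \<psi>: "orlicz_function \<psi>" unfolding assms(2) by (rule orlicz_complementary[OF \<phi>])
  interpret positive_weight "open_part \<omega>" by (rule positive_weight_open_part[OF assms(3,4)])
  let ?X = "orlicz_lorentz_space \<phi> \<omega>" and ?N = "orlicz_norm \<phi> \<omega>"
  have norm: "?N x = enn2real (dual_norm \<psi> x)" if "x \<in> borel_measurable leb01" for x
    unfolding orlicz_norm_def assms(2)[symmetric] dual_norm_eq_SUP[OF assms(3,4) \<psi> that] ..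
  have meas: "x \<in> borel_measurable leb01" if "x \<in> ?X" for x
    using that by (simp add: orlicz_lorentz_space_def)
  have fin: "dual_norm \<psi> x < \<infinity>" if x: "x \<in> ?X" for x
  proof -
    obtain c where c: "0 < c" "modular \<phi> \<omega> (\<lambda>t. c * x t) < \<infinity>"
      using x by (auto simp: orlicz_lorentz_space_def)
    have "rearr (\<lambda>t. c * x t) t = c * rearr x t" for t
      using rearrangement_scale[OF meas[OF x] _ c(1)] by (simp add: rearr_def)
    then have "(\<integral>\<^sup>+t. ennreal (\<phi> (c * rearr x t)) \<partial>mw) < \<infinity>"
      using c(2) modular_eq[OF assms(3,4) \<phi>, of "\<lambda>t. c * x t"] meas[OF x] by simp
    then show ?thesis unfolding assms(2) by (rule dual_norm_finite[OF \<phi> meas[OF x] c(1)])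
  qed
  \<comment> \<open>\<open>enn2real\<close> maps infinity to \<open>0\<close>, so without finiteness
    a bound on the real norm would say nothing about \<open>dual_norm\<close>.\<close>
  have norm_le: "?N x \<le> r \<longleftrightarrow> dual_norm \<psi> x \<le> ennreal r" if "x \<in> borel_measurable leb01" "dual_norm \<psi> x < \<infinity>" "0 \<le> r" for x r
    unfolding norm[OF that(1)] using that(2,3) by (cases "dual_norm \<psi> x") auto
  show ?thesis
  proof
    assume \<Delta>: "Delta2_infinity \<psi>"
    show "locally_uniformly_non_square ?X ?N"
      unfolding locally_uniformly_non_square_def
    proof (intro ballI impI)
      fix x assume x: "x \<in> ?X" "?N x = 1"
      have "dual_norm \<psi> x \<le> ennreal 1"
        using norm_le[OF meas[OF x(1)] fin[OF x(1)], of 1] x(2) by simp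
      moreover have "0 < dual_norm \<psi> x"
        using x(2) norm[OF meas[OF x(1)]] by (cases "dual_norm \<psi> x = 0") (auto simp: zero_less_iff_neq_zero)
      ultimately obtain \<delta> where \<delta>: "0 < \<delta>" "\<delta> < 1"
        and alt: "\<And>y. y \<in> borel_measurable leb01 \<Longrightarrow> dual_norm \<psi> y \<le> 1 \<Longrightarrow>
          dual_norm \<psi> (\<lambda>t. (x t - y t) / 2) \<le> ennreal (1 - \<delta>) \<or> dual_norm \<psi> (\<lambda>t. (x t + y t) / 2) \<le> ennreal (1 - \<delta>)"
        using non_square_of_Delta2[OF \<psi> \<Delta> meas[OF x(1)]] by auto
      have "min (?N (\<lambda>t. (x t - y t) / 2)) (?N (\<lambda>t. (x t + y t) / 2)) \<le> 1 - \<delta>"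
        if y: "y \<in> ?X" "?N y \<le> 1" for y
      proof -
        have m: "(\<lambda>t. (x t - y t) / 2) \<in> borel_measurable leb01" "(\<lambda>t. (x t + y t) / 2) \<in> borel_measurable leb01"
          using meas[OF x(1)] meas[OF y(1)] by auto
        have "dual_norm \<psi> y \<le> 1" using norm_le[OF meas[OF y(1)] fin[OF y(1)], of 1] y(2) by simp
        from alt[OF meas[OF y(1)] this] show ?thesis
          unfolding norm[OF m(1)] norm[OF m(2)] using \<delta>
          by (auto simp: min_le_iff_disj intro: enn2real_leI)
      qed
      then show "\<exists>\<delta>. 0 < \<delta> \<and> \<delta> < 1 \<and> (\<forall>y\<in>?X. ?N y \<le> 1 \<longrightarrow>
          min (?N (\<lambda>t. (x t - y t) / 2)) (?N (\<lambda>t. (x t + y t) / 2)) \<le> 1 - \<delta>)"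
        using \<delta> by blast
    qed
  next
    assume lu: "locally_uniformly_non_square ?X ?N"
    show "Delta2_infinity \<psi>"
    proof (rule ccontr)
      assume "\<not> Delta2_infinity \<psi>"
      then obtain c where c: "0 < c" "dual_norm \<psi> (step c 0 1) = 1"
        and bad: "\<And>\<delta>. 0 < \<delta> \<Longrightarrow> \<delta> < 1 \<Longrightarrow> \<exists>a e. 0 \<le> a \<and> dual_norm \<psi> (step a 0 e) \<le> 1 \<and>
          ennreal (1 - \<delta>) < dual_norm \<psi> (\<lambda>t. (step c 0 1 t - step a 0 e t) / 2) \<and>
          ennreal (1 - \<delta>) < dual_norm \<psi> (\<lambda>t. (step c 0 1 t + step a 0 e t) / 2)"
        using square_of_not_Delta2[OF \<psi>] by blast
      \<comment> \<open>Finite mass of the weight puts bounded functions into the space; this makes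
        the step functions and their half sums members, so that \<open>norm_le\<close> applies to
        them.\<close>
      have bounded: "z \<in> ?X" if z [measurable]: "z \<in> borel_measurable leb01" and B: "\<And>t. \<bar>z t\<bar> \<le> B" for z B
      proof -
        have "rearr z t \<le> B" for t
        proof (rule ccontr)
          assume "\<not> ?thesis"
          moreover have "0 \<le> B" using B[of 0] by linarith
          ultimately have "0 < t \<and> t < distr_fun z B" using less_rearr_iff[OF z, of B t] by auto
          moreover have "{s \<in> space leb01. \<bar>z s\<bar> > B} = {}" using B by (auto simp: not_less)
          then have "distr_fun z B = 0" unfolding distr_fun_eq by (simp only: measure_empty)
          ultimately show False by auto
        qed
        then have "\<phi> (rearr z t) \<le> \<phi> B" for t
          using decreasing01D(1)[OF decreasing01_rearr[OF z]] by (intro orlicz_mono[OF \<phi>])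
        then have "(\<integral>\<^sup>+t. ennreal (\<phi> (rearr z t)) \<partial>mw) \<le> (\<integral>\<^sup>+t. ennreal (\<phi> B) \<partial>mw)"
          by (intro nn_integral_mono ennreal_leI)
        also have "\<dots> < \<infinity>" by (simp add: mw.emeasure_eq_measure ennreal_mult_less_top)
        finally have "modular \<phi> \<omega> z < \<infinity>" by (simp add: modular_eq[OF assms(3,4) \<phi> z])
        then show ?thesis using z unfolding orlicz_lorentz_space_def by (auto intro!: exI[of _ 1])
      qed
      have step_X: "step a 0 e \<in> ?X" for a e by (rule bounded[of _ "\<bar>a\<bar>"]) (auto simp: step_def)
      have "?N (step c 0 1) = 1" by (simp add: norm c(2))
      with lu step_X obtain \<delta> where \<delta>: "0 < \<delta>" "\<delta> < 1"
        and alt: "\<And>y. y \<in> ?X \<Longrightarrow> ?N y \<le> 1 \<Longrightarrow>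
          min (?N (\<lambda>t. (step c 0 1 t - y t) / 2)) (?N (\<lambda>t. (step c 0 1 t + y t) / 2)) \<le> 1 - \<delta>"
        unfolding locally_uniformly_non_square_def by blast
      obtain a e where y: "dual_norm \<psi> (step a 0 e) \<le> 1"
        and lower: "ennreal (1 - \<delta>) < dual_norm \<psi> (\<lambda>t. (step c 0 1 t - step a 0 e t) / 2)"
          "ennreal (1 - \<delta>) < dual_norm \<psi> (\<lambda>t. (step c 0 1 t + step a 0 e t) / 2)"
        using bad[OF \<delta>] by blast
      note [measurable] = step_borel[of c 0 1] step_borel[of a 0 e]
      have X: "(\<lambda>t. (step c 0 1 t - step a 0 e t) / 2) \<in> ?X"
        by (rule bounded[of _ "\<bar>c\<bar> + \<bar>a\<bar>"], measurable, auto simp: step_def)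
      have X': "(\<lambda>t. (step c 0 1 t + step a 0 e t) / 2) \<in> ?X"
        by (rule bounded[of _ "\<bar>c\<bar> + \<bar>a\<bar>"], measurable, auto simp: step_def)
      have "?N (step a 0 e) \<le> 1" using norm_le[OF meas[OF step_X] fin[OF step_X], of 1] y by simp
      from alt[OF step_X this] show False
        using lower \<delta> norm_le[OF meas[OF X] fin[OF X], of "1 - \<delta>"] norm_le[OF meas[OF X'] fin[OF X'], of "1 - \<delta>"]
        by (auto simp: min_le_iff_disj dest: leD)
    qed
  qed
qed

end
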